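(* Let $p$ and $q$ be distinct prime numbers with $q\equiv1\pmod p$. Let $F=\langle a:a^p=1\rangle$ be cyclic of order $p$ and $\Gamma=\langle s,t:s^q=t^q=sts^{-1}t^{-1}=1\rangle\simeq\mathbb Z_q\times\mathbb Z_q$. Let $1<n\le q-1$ with $n^p\equiv1\pmod q$, let $0\le\lambda<p-1$ be an integer, and let $G_\lambda=\Gamma\rtimes F$ be the semidirect product with respect to the action $a.s=s^n$, $a.t=t^{n^\lambda}$. Let $[\omega]\in H^2(\widehat\Gamma,k^\times)$ be the cohomology class corresponding to the skew-symmetric nondegenerate bicharacter $\Omega(u,v)=\det(u\,v)$ on $\widehat\Gamma$, and let $\phi=\sum_{x,y\in\widehat\Gamma}\omega(x,y)\,\delta_x\otimes\delta_y\in k\Gamma\otimes k\Gamma\subseteq kG_\lambda\otimes kG_\lambda$. Then: (i) $\mathcal B_\lambda\simeq(kG_\lambda)_\phi$ as Hopf algebras; (ii) the Hopf algebra $\mathcal B_\lambda^*$ is not a cocycle deformation of any finite group; that is, there are no finite group $N$ and invertible normalized $2$-cocycle $J\in kN\otimes kN$ with $\mathcal B_\lambda^*\simeq(kN)_J$ as Hopf algebras.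
   Context: $k$ is an algebraically closed field of characteristic zero. $\widehat\Gamma$ is the character group of $\Gamma$, and $\delta_x=\frac1{|\Gamma|}\sum_{g\in\Gamma}x(g)g$ for $x\in\widehat\Gamma$. The group $\widehat\Gamma\simeq\mathbb F_q^2$ is written in coordinates with respect to the basis dual to $s,t$, and $\det(u\,v)\in\mathbb F_q$ is viewed in $k^\times$ through a fixed primitive $q$-th root of unity $\xi$, i.e. $\Omega(u,v)=\xi^{\det(u\,v)}$; $\omega$ is a normalized $2$-cocycle with $\omega(u,v)\omega(v,u)^{-1}=\Omega(u,v)$. An invertible normalized $2$-cocycle for a Hopf algebra $H$ is an invertible $\phi\in H\otimes H$ with $(\phi\otimes 1)(\Delta\otimes \mathrm{id})(\phi)=(1\otimes\phi)(\mathrm{id}\otimes\Delta)(\phi)$ and $(\epsilon\otimes\mathrm{id})(\phi)=1=(\mathrm{id}\otimes\epsilon)(\phi)$; $H_\phi$ is $H$ as an algebra with the same counit and comultiplication $\Delta_\phi(h)=\phi\Delta(h)\phi^{-1}$. $\mathcal B_\lambda$ ($0\le\lambda<p-1$) are the known nontrivial semisimple Hopf algebras of dimension $pq^2$ for $q\equiv1\pmod p$; $G(\mathcal B_\lambda)\simeq\mathbb Z_q\times\mathbb Z_q$, $|G(\mathcal B_\lambda^* )|=p$ for $\lambda>0$ and $G(\mathcal B_0^* )\simeq\mathbb Z_{pq}$. Explicitly, $\mathcal B_\lambda$ is the (up to isomorphism unique) non-cocommutative Hopf algebra whose underlying algebra is the group algebra $kG_\lambda$, with $\epsilon(g)=1$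 for $g\in G_\lambda$, $\Delta(\gamma)=\gamma\otimes\gamma$ for $\gamma\in\Gamma$, and $\Delta(a)=J(a\otimes a)$ for some invertible $J\in k\Gamma\otimes k\Gamma$. *)

theory Defs
  imports
    "HOL-Computational_Algebra.Computational_Algebra"
    "HOL-Number_Theory.Cong"
    "HOL-Algebra.Elementary_Groups"
begin

section \<open>Finite-dimensional Hopf algebras over a field\<close>

text \<open>
  A finite-dimensional Hopf algebra is given on the free vector space over a finite set
  \<open>hbasis\<close>. A vector is its coefficient function (zero outside \<open>hbasis\<close>), and the structure maps
  are given by their values on basis elements. The tensor product of the free vector spaces over
  \<open>S\<close> and \<open>T\<close> is the free vector space over \<open>S \<times> T\<close>. The fields \<open>hmul\<close>, \<open>hcomul\<close>, \<open>hcounit\<close> carry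
  no meaning outside the basis.
\<close>

record ('b, 'k) alg =
  hbasis :: "'b set"
  hmul :: "'b \<Rightarrow> 'b \<Rightarrow> ('b \<Rightarrow> 'k)"
  hone :: "'b \<Rightarrow> 'k"

record ('b, 'k) hopf = "('b, 'k) alg" +
  hcomul :: "'b \<Rightarrow> ('b \<times> 'b \<Rightarrow> 'k)"
  hcounit :: "'b \<Rightarrow> 'k"

definition vecs :: "'b set \<Rightarrow> ('b \<Rightarrow> 'k::field) set" where
  "vecs S = {v. \<forall>x. x \<notin> S \<longrightarrow> v x = 0}"

definition basis_vec :: "'b \<Rightarrow> ('b \<Rightarrow> 'k::field)" where
  "basis_vec x = (\<lambda>y. if y = x then 1 else 0)"

text \<open>Linear extension of a map given on the basis \<open>S\<close>, for vector-valued maps and for forms.\<close>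

definition lin_ext :: "'b set \<Rightarrow> ('b \<Rightarrow> ('c \<Rightarrow> 'k::field)) \<Rightarrow> ('b \<Rightarrow> 'k) \<Rightarrow> ('c \<Rightarrow> 'k)" where
  "lin_ext S f v = (\<lambda>z. \<Sum>x\<in>S. v x * f x z)"

definition form_ext :: "'b set \<Rightarrow> ('b \<Rightarrow> 'k::field) \<Rightarrow> ('b \<Rightarrow> 'k) \<Rightarrow> 'k" where
  "form_ext S f v = (\<Sum>x\<in>S. v x * f x)"

definition tens :: "('b \<Rightarrow> 'k::field) \<Rightarrow> ('c \<Rightarrow> 'k) \<Rightarrow> ('b \<times> 'c \<Rightarrow> 'k)" where
  "tens v w = (\<lambda>(x, y). v x * w y)"

subsection \<open>Algebras\<close>

definition times_in :: "('b, 'k::field, 'm) alg_scheme \<Rightarrow> ('b \<Rightarrow> 'k) \<Rightarrow> ('b \<Rightarrow> 'k) \<Rightarrow> ('b \<Rightarrow> 'k)" where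
  "times_in A v w = (\<lambda>z. \<Sum>x\<in>hbasis A. \<Sum>y\<in>hbasis A. v x * w y * hmul A x y z)"

definition fd_algebra :: "('b, 'k::field, 'm) alg_scheme \<Rightarrow> bool" where
  "fd_algebra A \<longleftrightarrow>
     finite (hbasis A) \<and>
     hone A \<in> vecs (hbasis A) \<and>
     (\<forall>x\<in>hbasis A. \<forall>y\<in>hbasis A. hmul A x y \<in> vecs (hbasis A)) \<and>
     (\<forall>u\<in>vecs (hbasis A). \<forall>v\<in>vecs (hbasis A). \<forall>w\<in>vecs (hbasis A).
        times_in A (times_in A u v) w = times_in A u (times_in A v w)) \<and>
     (\<forall>v\<in>vecs (hbasis A). times_in A (hone A) v = v \<and> times_in A v (hone A) = v)"

definition tensor_alg ::
  "('b, 'k::field, 'm) alg_scheme \<Rightarrow> ('c, 'k, 'n) alg_scheme \<Rightarrow> ('b \<times> 'c, 'k) alg" where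
  "tensor_alg A B =
     \<lparr> hbasis = hbasis A \<times> hbasis B,
       hmul = (\<lambda>(a, b) (a', b'). tens (hmul A a a') (hmul B b b')),
       hone = tens (hone A) (hone B) \<rparr>"

definition is_inverse_in ::
  "('b, 'k::field, 'm) alg_scheme \<Rightarrow> ('b \<Rightarrow> 'k) \<Rightarrow> ('b \<Rightarrow> 'k) \<Rightarrow> bool" where
  "is_inverse_in A v w \<longleftrightarrow>
     v \<in> vecs (hbasis A) \<and> w \<in> vecs (hbasis A) \<and>
     times_in A v w = hone A \<and> times_in A w v = hone A"

definition invertible_in :: "('b, 'k::field, 'm) alg_scheme \<Rightarrow> ('b \<Rightarrow> 'k) \<Rightarrow> bool" where
  "invertible_in A v \<longleftrightarrow> (\<exists>w. is_inverse_in A v w)"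

definition inverse_in :: "('b, 'k::field, 'm) alg_scheme \<Rightarrow> ('b \<Rightarrow> 'k) \<Rightarrow> ('b \<Rightarrow> 'k)" where
  "inverse_in A v = (THE w. is_inverse_in A v w)"

subsection \<open>Hopf algebras\<close>

text \<open>The maps \<open>\<Delta> \<otimes> id\<close>, \<open>id \<otimes> \<Delta>\<close>, \<open>\<epsilon> \<otimes> id\<close>, \<open>id \<otimes> \<epsilon>\<close> on \<open>H \<otimes> H\<close>, where
  \<open>H \<otimes> H \<otimes> H\<close> has basis \<open>B \<times> (B \<times> B)\<close>.\<close>

definition comul_id :: "('b, 'k::field) hopf \<Rightarrow> ('b \<times> 'b \<Rightarrow> 'k) \<Rightarrow> ('b \<times> 'b \<times> 'b \<Rightarrow> 'k)" where
  "comul_id H t = (\<lambda>(x, y, z). \<Sum>b\<in>hbasis H. t (b, z) * hcomul H b (x, y))"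

definition id_comul :: "('b, 'k::field) hopf \<Rightarrow> ('b \<times> 'b \<Rightarrow> 'k) \<Rightarrow> ('b \<times> 'b \<times> 'b \<Rightarrow> 'k)" where
  "id_comul H t = (\<lambda>(x, y, z). \<Sum>b\<in>hbasis H. t (x, b) * hcomul H b (y, z))"

definition counit_id :: "('b, 'k::field) hopf \<Rightarrow> ('b \<times> 'b \<Rightarrow> 'k) \<Rightarrow> ('b \<Rightarrow> 'k)" where
  "counit_id H t = (\<lambda>z. \<Sum>b\<in>hbasis H. t (b, z) * hcounit H b)"

definition id_counit :: "('b, 'k::field) hopf \<Rightarrow> ('b \<times> 'b \<Rightarrow> 'k) \<Rightarrow> ('b \<Rightarrow> 'k)" where
  "id_counit H t = (\<lambda>z. \<Sum>b\<in>hbasis H. t (z, b) * hcounit H b)"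

definition bialgebra :: "('b, 'k::field) hopf \<Rightarrow> bool" where
  "bialgebra H \<longleftrightarrow>
     fd_algebra H \<and>
     (\<forall>x\<in>hbasis H. hcomul H x \<in> vecs (hbasis H \<times> hbasis H)) \<and>
     (\<forall>x\<in>hbasis H. comul_id H (hcomul H x) = id_comul H (hcomul H x)) \<and>
     (\<forall>x\<in>hbasis H. counit_id H (hcomul H x) = basis_vec x \<and>
                    id_counit H (hcomul H x) = basis_vec x) \<and>
     (\<forall>x\<in>hbasis H. \<forall>y\<in>hbasis H.
        lin_ext (hbasis H) (hcomul H) (hmul H x y) =
        times_in (tensor_alg H H) (hcomul H x) (hcomul H y)) \<and>
     lin_ext (hbasis H) (hcomul H) (hone H) = tens (hone H) (hone H) \<and>
     (\<forall>x\<in>hbasis H. \<forall>y\<in>hbasis H.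
        form_ext (hbasis H) (hcounit H) (hmul H x y) = hcounit H x * hcounit H y) \<and>
     form_ext (hbasis H) (hcounit H) (hone H) = 1"

definition is_antipode :: "('b, 'k::field) hopf \<Rightarrow> ('b \<Rightarrow> ('b \<Rightarrow> 'k)) \<Rightarrow> bool" where
  "is_antipode H S \<longleftrightarrow>
     (\<forall>x\<in>hbasis H. S x \<in> vecs (hbasis H)) \<and>
     (\<forall>x\<in>hbasis H.
        lin_ext (hbasis H \<times> hbasis H) (\<lambda>(y, z). times_in H (S y) (basis_vec z)) (hcomul H x)
          = (\<lambda>b. hcounit H x * hone H b) \<and>
        lin_ext (hbasis H \<times> hbasis H) (\<lambda>(y, z). times_in H (basis_vec y) (S z)) (hcomul H x)
          = (\<lambda>b. hcounit H x * hone H b))"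

definition hopf_algebra :: "('b, 'k::field) hopf \<Rightarrow> bool" where
  "hopf_algebra H \<longleftrightarrow> bialgebra H \<and> (\<exists>S. is_antipode H S)"

definition cocommutative :: "('b, 'k::field) hopf \<Rightarrow> bool" where
  "cocommutative H \<longleftrightarrow>
     (\<forall>x\<in>hbasis H. \<forall>y\<in>hbasis H. \<forall>z\<in>hbasis H. hcomul H x (y, z) = hcomul H x (z, y))"

text \<open>A linear map is given by the images \<open>f x\<close> of the basis vectors. Compatibility with the
  antipodes is automatic for bialgebra maps between Hopf algebras.\<close>

definition is_hopf_iso ::
  "('b, 'k::field) hopf \<Rightarrow> ('c, 'k) hopf \<Rightarrow> ('b \<Rightarrow> ('c \<Rightarrow> 'k)) \<Rightarrow> bool" where
  "is_hopf_iso H K f \<longleftrightarrow>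
     (\<forall>x\<in>hbasis H. f x \<in> vecs (hbasis K)) \<and>
     bij_betw (lin_ext (hbasis H) f) (vecs (hbasis H)) (vecs (hbasis K)) \<and>
     (\<forall>x\<in>hbasis H. \<forall>y\<in>hbasis H. lin_ext (hbasis H) f (hmul H x y) = times_in K (f x) (f y)) \<and>
     lin_ext (hbasis H) f (hone H) = hone K \<and>
     (\<forall>x\<in>hbasis H.
        lin_ext (hbasis H \<times> hbasis H) (\<lambda>(y, z). tens (f y) (f z)) (hcomul H x) =
        lin_ext (hbasis K) (hcomul K) (f x)) \<and>
     (\<forall>x\<in>hbasis H. form_ext (hbasis K) (hcounit K) (f x) = hcounit H x)"

definition hopf_isomorphic :: "('b, 'k::field) hopf \<Rightarrow> ('c, 'k) hopf \<Rightarrow> bool"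
    (infix "\<simeq>\<^sub>H" 50) where
  "H \<simeq>\<^sub>H K \<longleftrightarrow> (\<exists>f. is_hopf_iso H K f)"

text \<open>The dual, in the dual basis (indexed by the same set).\<close>

definition dual_hopf :: "('b, 'k::field) hopf \<Rightarrow> ('b, 'k) hopf" where
  "dual_hopf H =
     \<lparr> hbasis = hbasis H,
       hmul = (\<lambda>x y z. if z \<in> hbasis H then hcomul H z (x, y) else 0),
       hone = (\<lambda>z. if z \<in> hbasis H then hcounit H z else 0),
       hcomul = (\<lambda>x (y, z). if y \<in> hbasis H \<and> z \<in> hbasis H then hmul H y z x else 0),
       hcounit = (\<lambda>x. hone H x) \<rparr>"

definition group_hopf :: "('g, 'm) monoid_scheme \<Rightarrow> ('g, 'k::field) hopf" where
  "group_hopf G =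
     \<lparr> hbasis = carrier G,
       hmul = (\<lambda>x y. basis_vec (x \<otimes>\<^bsub>G\<^esub> y)),
       hone = basis_vec \<one>\<^bsub>G\<^esub>,
       hcomul = (\<lambda>x. basis_vec (x, x)),
       hcounit = (\<lambda>x. 1) \<rparr>"

subsection \<open>Cocycle deformations\<close>

definition invertible_normalized_cocycle ::
  "('b, 'k::field) hopf \<Rightarrow> ('b \<times> 'b \<Rightarrow> 'k) \<Rightarrow> bool" where
  "invertible_normalized_cocycle H \<phi> \<longleftrightarrow>
     invertible_in (tensor_alg H H) \<phi> \<and>
     times_in (tensor_alg H (tensor_alg H H))
       (\<lambda>(x, y, z). tens \<phi> (hone H) ((x, y), z)) (comul_id H \<phi>) =
     times_in (tensor_alg H (tensor_alg H H))
       (tens (hone H) \<phi>) (id_comul H \<phi>) \<and>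
     counit_id H \<phi> = hone H \<and> id_counit H \<phi> = hone H"

definition deform :: "('b, 'k::field) hopf \<Rightarrow> ('b \<times> 'b \<Rightarrow> 'k) \<Rightarrow> ('b, 'k) hopf" where
  "deform H \<phi> = H \<lparr> hcomul := (\<lambda>x.
     times_in (tensor_alg H H)
       (times_in (tensor_alg H H) \<phi> (hcomul H x)) (inverse_in (tensor_alg H H) \<phi>)) \<rparr>"

section \<open>Characters and group cocycles\<close>

definition field_units :: "'k::field monoid" where
  "field_units = \<lparr> carrier = UNIV - {0}, monoid.mult = (*), one = 1 \<rparr>"

definition char_group :: "('g, 'm) monoid_scheme \<Rightarrow> ('g \<Rightarrow> 'k::field) monoid" where
  "char_group G =
     \<lparr> carrier = hom G field_units \<inter> extensional (carrier G),
       monoid.mult = (\<lambda>\<chi> \<psi>. \<lambda>g\<in>carrier G. \<chi> g * \<psi> g),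
       one = (\<lambda>g\<in>carrier G. 1) \<rparr>"

definition normalized_group_cocycle ::
  "('a, 'm) monoid_scheme \<Rightarrow> ('a \<Rightarrow> 'a \<Rightarrow> 'k::field) \<Rightarrow> bool" where
  "normalized_group_cocycle A \<omega> \<longleftrightarrow>
     (\<forall>x\<in>carrier A. \<forall>y\<in>carrier A. \<omega> x y \<noteq> 0) \<and>
     (\<forall>x\<in>carrier A. \<forall>y\<in>carrier A. \<forall>z\<in>carrier A.
        \<omega> x y * \<omega> (x \<otimes>\<^bsub>A\<^esub> y) z = \<omega> y z * \<omega> x (y \<otimes>\<^bsub>A\<^esub> z)) \<and>
     (\<forall>x\<in>carrier A. \<omega> x \<one>\<^bsub>A\<^esub> = 1 \<and> \<omega> \<one>\<^bsub>A\<^esub> x = 1)"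

definition char_idem :: "('g, 'm) monoid_scheme \<Rightarrow> ('g \<Rightarrow> 'k::field) \<Rightarrow> ('g \<Rightarrow> 'k)" where
  "char_idem G \<chi> = (\<lambda>g. if g \<in> carrier G then \<chi> g / of_nat (order G) else 0)"

definition cocycle_element ::
  "('g, 'm) monoid_scheme \<Rightarrow> (('g \<Rightarrow> 'k::field) \<Rightarrow> ('g \<Rightarrow> 'k) \<Rightarrow> 'k) \<Rightarrow> ('g \<times> 'g \<Rightarrow> 'k)" where
  "cocycle_element G \<omega> = (\<lambda>gh.
     \<Sum>x\<in>carrier (char_group G). \<Sum>y\<in>carrier (char_group G).
       \<omega> x y * tens (char_idem G x) (char_idem G y) gh)"

definition is_primitive_root_of_unity :: "nat \<Rightarrow> 'k::field \<Rightarrow> bool" where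
  "is_primitive_root_of_unity m \<xi> \<longleftrightarrow> m > 0 \<and> \<xi> ^ m = 1 \<and> (\<forall>i. 0 < i \<and> i < m \<longrightarrow> \<xi> ^ i \<noteq> 1)"

section \<open>The groups and the Hopf algebras in question\<close>

definition semidirect_product ::
  "'a monoid \<Rightarrow> 'f monoid \<Rightarrow> ('f \<Rightarrow> 'a \<Rightarrow> 'a) \<Rightarrow> ('a \<times> 'f) monoid" where
  "semidirect_product N F act =
     \<lparr> carrier = carrier N \<times> carrier F,
       monoid.mult = (\<lambda>(x, f) (y, g). (x \<otimes>\<^bsub>N\<^esub> act f y, f \<otimes>\<^bsub>F\<^esub> g)),
       one = (\<one>\<^bsub>N\<^esub>, \<one>\<^bsub>F\<^esub>) \<rparr>"

type_synonym G_elt = "(int \<times> int) \<times> int"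

text \<open>The element \<open>((i, j), f)\<close> of \<open>G_grp\<close> is \<open>s\<^sup>i t\<^sup>j a\<^sup>f\<close>, where \<open>0 \<le> i, j < q\<close> and \<open>0 \<le> f < p\<close>;
  thus \<open>a s a\<^sup>-\<^sup>1 = s\<^sup>n\<close> and \<open>a t a\<^sup>-\<^sup>1 = t\<^sup>m\<close> with \<open>m = n ^ l\<close>.\<close>

definition F_act :: "nat \<Rightarrow> nat \<Rightarrow> nat \<Rightarrow> int \<Rightarrow> int \<times> int \<Rightarrow> int \<times> int" where
  "F_act q n l f = (\<lambda>(i, j). ((int n ^ nat f * i) mod int q, ((int n ^ l) ^ nat f * j) mod int q))"

definition G_grp :: "nat \<Rightarrow> nat \<Rightarrow> nat \<Rightarrow> nat \<Rightarrow> G_elt monoid" where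
  "G_grp p q n l =
     semidirect_product (integer_mod_group q \<times>\<times> integer_mod_group q) (integer_mod_group p)
       (F_act q n l)"

definition s_elt :: G_elt where "s_elt = ((1, 0), 0)"
definition t_elt :: G_elt where "t_elt = ((0, 1), 0)"
definition a_elt :: G_elt where "a_elt = ((0, 0), 1)"

definition Gam :: "nat \<Rightarrow> nat \<Rightarrow> nat \<Rightarrow> nat \<Rightarrow> G_elt monoid" where
  "Gam p q n l =
     (G_grp p q n l) \<lparr> carrier := carrier (integer_mod_group q \<times>\<times> integer_mod_group q) \<times> {0} \<rparr>"

text \<open>\<open>(u\<^sub>1, u\<^sub>2)\<close> are coordinates of the character \<open>\<chi>\<close> of \<open>\<Gamma>\<close> with respect to the basis dual to
  \<open>s, t\<close>, the field with \<open>q\<close> elements being embedded in the units of \<open>k\<close> through \<open>\<xi>\<close>.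
  They are integers determined modulo \<open>q\<close>.\<close>

definition has_coords :: "'k::field \<Rightarrow> (G_elt \<Rightarrow> 'k) \<Rightarrow> int \<times> int \<Rightarrow> bool" where
  "has_coords \<xi> \<chi> u \<longleftrightarrow> \<chi> s_elt = \<xi> powi fst u \<and> \<chi> t_elt = \<xi> powi snd u"

definition det2 :: "int \<times> int \<Rightarrow> int \<times> int \<Rightarrow> int" where
  "det2 u v = fst u * snd v - snd u * fst v"

text \<open>These conditions determine \<open>\<B>\<^sub>\<lambda>\<close> up to isomorphism; \<open>l\<close> stands for \<open>\<lambda>\<close>.\<close>

definition is_B :: "nat \<Rightarrow> nat \<Rightarrow> nat \<Rightarrow> nat \<Rightarrow> (G_elt, 'k::field) hopf \<Rightarrow> bool" where
  "is_B p q n l H \<longleftrightarrow>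
     (let G = G_grp p q n l; kG = group_hopf G;
          \<Gamma> = Gam p q n l; k\<Gamma> = (group_hopf \<Gamma> :: (G_elt, 'k) hopf)
      in hopf_algebra H \<and> \<not> cocommutative H \<and>
         hbasis H = hbasis kG \<and>
         (\<forall>x\<in>carrier G. \<forall>y\<in>carrier G. hmul H x y = hmul kG x y) \<and>
         hone H = hone kG \<and>
         (\<forall>g\<in>carrier G. hcounit H g = 1) \<and>
         (\<forall>\<gamma>\<in>carrier \<Gamma>. hcomul H \<gamma> = basis_vec (\<gamma>, \<gamma>)) \<and>
         (\<exists>J. invertible_in (tensor_alg k\<Gamma> k\<Gamma>) J \<and>
              hcomul H a_elt = times_in (tensor_alg kG kG) J (basis_vec (a_elt, a_elt))))"

end

theory Submission
  imports Defs "HOL-Algebra.Sylow" "HOL-Algebra.Multiplicative_Group" "HOL-Library.Product_Plus"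
begin

text \<open>
  Under the Fourier transform of \<open>\<Gamma>\<close> the element \<open>J\<close> with \<open>\<Delta>(a) = J(a \<otimes> a)\<close> becomes a 2-cocycle
  \<open>j\<close> on \<open>\<int>\<^sup>2\<close>, periodic modulo \<open>q\<close>, whose norm along the action \<open>A\<close> of \<open>a\<close> is trivial; its alternating
  form is \<open>\<xi>\<^bsup>c det\<^esup>\<close>, and \<open>c \<noteq> 0\<close> because \<open>\<B>\<close> is not cocommutative. For the twist by \<open>\<phi>\<close> the corresponding
  cocycle is \<open>\<omega>(x, y) / \<omega>(Ax, Ay)\<close> with alternating form \<open>\<xi>\<^bsup>(1 - N) det\<^esup>\<close>, \<open>N = n\<^bsup>1 + \<lambda>\<^esup> \<noteq> 1\<close>.
  Rescaling \<open>s \<mapsto> s\<^sup>r\<close> with \<open>c r = 1 - N\<close> makes the two forms equal, so that the cocycles differ by the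
  coboundary of some \<open>\<nu>\<close>, and \<open>s \<mapsto> s\<^sup>r\<close>, \<open>t \<mapsto> t\<close>, \<open>a \<mapsto> v a\<close>, where \<open>v\<close> has transform \<open>\<nu>\<close>, is the
  isomorphism of (i).

  For (ii), an algebra isomorphism \<open>\<B>\<^sup>* \<simeq> kN\<close> identifies the linear characters of \<open>N\<close> with the
  grouplike elements of \<open>\<B>\<close>, which are the \<open>q\<^sup>2\<close> elements of \<open>\<Gamma>\<close>. But \<open>N\<close> has order \<open>pq\<^sup>2\<close> with \<open>p < q\<close>,
  so its Sylow \<open>q\<close>-subgroup is normal of index \<open>p\<close> and \<open>p\<close> divides the number of linear characters.
\<close>

section \<open>Group algebras\<close>

text \<open>Products in the tensor powers of k\<Gamma> become pointwise under the transform, and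
  conjugation by \<open>a\<close> acts on characters through the diagonal matrix A. The norm of j is
  trivial because a^p = 1; likewise a \<mapsto> v a extends to an algebra map only if (v a)^p = 1,
  so \<nu> has to split the quotient of the two cocycles and to have trivial norm itself. Cocycles
  are lifted to Z^2 because a symmetric cocycle splits over a free group; periodicity of the
  splitting is restored by extracting q-th roots in k. Scaling s alone is a diagonal change of
  coordinates: it commutes with A and multiplies the determinant form by r. N \<noteq> 1 because n
  has order p modulo q and 0 < 1 + \<lambda> < p. The same fact decides (ii): a grouplike element
  supported on \<Gamma> a^k would make the product of the j(A^i x, A^i y) over i < k symmetric, but
  its alternating form has exponent c (1 + N + ... + N^(k-1)) times the determinant. Since c is a
  unit, this vanishes modulo q only if N^k = 1, so k = 0.\<close>

definition group_alg :: "('g, 'm) monoid_scheme \<Rightarrow> ('g \<Rightarrow> 'k::field) monoid" where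
  "group_alg G = \<lparr>carrier = vecs (carrier G), monoid.mult = times_in (group_hopf G),
     one = basis_vec \<one>\<^bsub>G\<^esub>\<rparr>"

lemma group_alg_simps [simp]:
  "carrier (group_alg G) = vecs (carrier G)"
  "monoid.mult (group_alg G) = times_in (group_hopf G)"
  "\<one>\<^bsub>group_alg G\<^esub> = basis_vec \<one>\<^bsub>G\<^esub>"
  by (simp_all add: group_alg_def)

lemma group_hopf_simps [simp]:
  "hbasis (group_hopf G) = carrier G"
  "hmul (group_hopf G) x y = basis_vec (x \<otimes>\<^bsub>G\<^esub> y)"
  "hone (group_hopf G) = basis_vec \<one>\<^bsub>G\<^esub>"
  "hcomul (group_hopf G) x = basis_vec (x, x)"
  "hcounit (group_hopf G) x = 1"
  by (simp_all add: group_hopf_def)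

lemma deform_simps [simp]:
  "hbasis (deform H \<phi>) = hbasis H" "hmul (deform H \<phi>) = hmul H" "hone (deform H \<phi>) = hone H"
  "hcounit (deform H \<phi>) = hcounit H"
  "hcomul (deform H \<phi>) x = times_in (tensor_alg H H)
     (times_in (tensor_alg H H) \<phi> (hcomul H x)) (inverse_in (tensor_alg H H) \<phi>)"
  by (simp_all add: deform_def)

lemma times_in_cong:
  assumes "hbasis A = hbasis B"
    and "\<And>x y. x \<in> hbasis A \<Longrightarrow> y \<in> hbasis A \<Longrightarrow> hmul A x y = hmul B x y"
  shows "times_in A = times_in B"
  unfolding times_in_def by (intro ext sum.cong) (use assms in auto)

lemma times_in_deform [simp]: "times_in (deform H \<phi>) = times_in H"
  by (rule times_in_cong) auto

lemma alg_truncate_simps [simp]: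
  "hbasis (alg.truncate A) = hbasis A" "hmul (alg.truncate A) = hmul A"
  "hone (alg.truncate A) = hone A"
  by (simp_all add: alg.truncate_def)

lemma times_in_truncate [simp]: "times_in (alg.truncate A) = times_in A"
  by (rule times_in_cong) auto

lemma tensor_alg_truncate [simp]: "tensor_alg A (alg.truncate B) = tensor_alg A B"
  by (simp add: tensor_alg_def)

lemma tens_basis_vec: "tens (basis_vec x) (basis_vec y) = basis_vec (x, y)"
  by (auto simp: tens_def basis_vec_def)

text \<open>kG \<otimes> kH is the group algebra of G x H, so a computation in a tensor power is one
  in a single group algebra. The truncation discards the coalgebra fields, which a tensor product of
  algebras does not carry.\<close>

lemma tensor_group_hopf [simp]:
  "tensor_alg (group_hopf G) (group_hopf H) = alg.truncate (group_hopf (G \<times>\<times> H))"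
  by (simp add: tensor_alg_def alg.truncate_def group_hopf_def tens_basis_vec fun_eq_iff
      split: prod.split)

lemma is_inverse_in_truncate [simp]: "is_inverse_in (alg.truncate A) = is_inverse_in A"
  by (simp add: fun_eq_iff is_inverse_in_def)

lemma invertible_in_truncate [simp]: "invertible_in (alg.truncate A) = invertible_in A"
  by (simp add: fun_eq_iff invertible_in_def)

lemma inverse_in_truncate [simp]: "inverse_in (alg.truncate A) = inverse_in A"
  by (simp add: fun_eq_iff inverse_in_def)

section \<open>Vectors, linear extensions and linear forms\<close>

lemma vecsI: "(\<And>x. x \<notin> S \<Longrightarrow> v x = 0) \<Longrightarrow> v \<in> vecs S"
  by (simp add: vecs_def)

lemma vecsD: "v \<in> vecs S \<Longrightarrow> x \<notin> S \<Longrightarrow> v x = 0"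
  by (simp add: vecs_def)

lemma vecs_mono: "S \<subseteq> T \<Longrightarrow> vecs S \<subseteq> vecs T"
  by (auto simp: vecs_def)

lemma basis_vec_in_vecs [simp]: "basis_vec x \<in> vecs S \<longleftrightarrow> x \<in> S"
  by (auto simp: vecs_def basis_vec_def)

lemma tens_in_vecs: "v \<in> vecs S \<Longrightarrow> w \<in> vecs T \<Longrightarrow> tens v w \<in> vecs (S \<times> T)"
  by (auto simp: vecs_def tens_def)

lemma basis_vec_inj: "basis_vec x = (basis_vec y :: _ \<Rightarrow> 'k::field) \<longleftrightarrow> x = y"
  unfolding basis_vec_def fun_eq_iff by (metis zero_neq_one)

lemma vec_expand: "finite S \<Longrightarrow> v \<in> vecs S \<Longrightarrow> v = (\<lambda>z. \<Sum>x\<in>S. v x * basis_vec x z)"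
  by (auto simp: basis_vec_def vecs_def fun_eq_iff if_distrib[where f="(*) _"] sum.delta cong: if_cong)

lemma lin_ext_basis [simp]: "finite S \<Longrightarrow> x \<in> S \<Longrightarrow> lin_ext S f (basis_vec x) = f x"
  by (auto simp: lin_ext_def basis_vec_def fun_eq_iff if_distrib[where f="\<lambda>c. c * _"] sum.delta cong: if_cong)

lemma form_ext_basis [simp]: "finite S \<Longrightarrow> x \<in> S \<Longrightarrow> form_ext S f (basis_vec x) = f x"
  by (auto simp: form_ext_def basis_vec_def if_distrib[where f="\<lambda>c. c * _"] sum.delta cong: if_cong)

lemma lin_ext_in_vecs: "(\<And>x. x \<in> S \<Longrightarrow> f x \<in> vecs T) \<Longrightarrow> lin_ext S f v \<in> vecs T"
  by (auto simp: lin_ext_def vecs_def)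

lemma lin_ext_lin_ext:
  assumes "finite S" "finite T"
  shows "lin_ext T g (lin_ext S f v) = lin_ext S (\<lambda>x. lin_ext T g (f x)) v"
  unfolding lin_ext_def sum_distrib_left sum_distrib_right
  by (subst sum.swap) (simp add: mult.assoc)

lemma form_ext_lin_ext:
  assumes "finite S" "finite T"
  shows "form_ext T g (lin_ext S f v) = form_ext S (\<lambda>x. form_ext T g (f x)) v"
  unfolding lin_ext_def form_ext_def sum_distrib_left sum_distrib_right
  by (subst sum.swap) (simp add: mult.assoc)

lemma lin_ext_cong: "(\<And>x. x \<in> S \<Longrightarrow> f x = g x) \<Longrightarrow> lin_ext S f v = lin_ext S g v"
  by (simp add: lin_ext_def)

lemma form_ext_cong: "(\<And>x. x \<in> S \<Longrightarrow> f x = g x) \<Longrightarrow> form_ext S f v = form_ext S g v"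
  by (simp add: form_ext_def)

lemma lin_ext_basis_vec: "finite S \<Longrightarrow> v \<in> vecs S \<Longrightarrow> lin_ext S basis_vec v = v"
  using vec_expand[of S v] by (simp add: lin_ext_def)

lemma lin_ext_mono:
  assumes "finite T" "S \<subseteq> T" "v \<in> vecs S" shows "lin_ext T f v = lin_ext S f v"
  unfolding lin_ext_def fun_eq_iff
  by (intro allI sum.mono_neutral_right) (use assms in \<open>auto simp: vecs_def\<close>)

lemma form_ext_mono:
  assumes "finite T" "S \<subseteq> T" "v \<in> vecs S" shows "form_ext T f v = form_ext S f v"
  unfolding form_ext_def
  by (intro sum.mono_neutral_right) (use assms in \<open>auto simp: vecs_def\<close>)

lemma form_ext_tens:
  "form_ext (S \<times> T) (\<lambda>(x, y). f x * g y) (tens v w) = form_ext S f v * form_ext T g w"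
  unfolding form_ext_def tens_def
  by (simp add: sum_product sum.cartesian_product case_prod_unfold mult_ac)

section \<open>The convolution algebra of a finite group\<close>

locale fin_group = group +
  assumes fin [simp, intro]: "finite (carrier G)"
begin

abbreviation times (infixl "\<star>" 70) where "times \<equiv> times_in (group_hopf G)"

lemma times_eq: "(v \<star> w) z = (\<Sum>x\<in>carrier G. \<Sum>y\<in>carrier G. v x * w y * basis_vec (x \<otimes> y) z)"
  by (simp add: times_in_def)

lemma times_in_vecs [simp]: "v \<star> w \<in> vecs (carrier G)"
  by (auto simp: vecs_def times_eq basis_vec_def intro!: sum.neutral)

text \<open>Pairing a convolution product with \<open>f\<close> pulls \<open>f\<close> back along
  the group law. Associativity, multiplicativity of linear extensions and multiplicativity of
  characters all reduce to this interchange of sums.\<close>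

lemma sum_times:
  "(\<Sum>z\<in>carrier G. (v \<star> w) z * f z) =
   (\<Sum>x\<in>carrier G. \<Sum>y\<in>carrier G. v x * w y * f (x \<otimes> y))" for f :: "'a \<Rightarrow> 'k::field"
proof -
  have "(\<Sum>z\<in>carrier G. (v \<star> w) z * f z) = (\<Sum>z\<in>carrier G. \<Sum>x\<in>carrier G. \<Sum>y\<in>carrier G.
      v x * w y * basis_vec (x \<otimes> y) z * f z)"
    by (simp add: times_eq sum_distrib_right)
  also have "\<dots> = (\<Sum>x\<in>carrier G. \<Sum>y\<in>carrier G. \<Sum>z\<in>carrier G.
      v x * w y * basis_vec (x \<otimes> y) z * f z)"
    by (subst sum.swap, rule sum.cong[OF refl], subst sum.swap, rule refl)
  also have "\<dots> = (\<Sum>x\<in>carrier G. \<Sum>y\<in>carrier G. v x * w y * f (x \<otimes> y))"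
  proof (intro sum.cong refl)
    fix x y assume "x \<in> carrier G" "y \<in> carrier G"
    then have "x \<otimes> y \<in> carrier G" by simp
    then have "form_ext (carrier G) f (basis_vec (x \<otimes> y)) = f (x \<otimes> y)" by simp
    then show "(\<Sum>z\<in>carrier G. v x * w y * basis_vec (x \<otimes> y) z * f z) = v x * w y * f (x \<otimes> y)"
      unfolding form_ext_def by (metis (no_types, lifting) mult.assoc sum.cong sum_distrib_left)
  qed
  finally show ?thesis .
qed

lemma times_assoc: "(u \<star> v) \<star> w = u \<star> (v \<star> w)"
proof
  fix z
  have "((u \<star> v) \<star> w) z = (\<Sum>c\<in>carrier G. \<Sum>a\<in>carrier G. (u \<star> v) a * (w c * basis_vec (a \<otimes> c) z))"
    by (subst sum.swap) (simp add: times_eq[of "u \<star> v"] mult.assoc)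
  also have "\<dots> = (\<Sum>c\<in>carrier G. \<Sum>x\<in>carrier G. \<Sum>y\<in>carrier G.
      u x * v y * (w c * basis_vec (x \<otimes> y \<otimes> c) z))"
    by (simp only: sum_times)
  also have "\<dots> = (\<Sum>x\<in>carrier G. \<Sum>y\<in>carrier G. \<Sum>c\<in>carrier G.
      u x * v y * (w c * basis_vec (x \<otimes> y \<otimes> c) z))"
    by (subst sum.swap, rule sum.cong[OF refl], subst sum.swap, rule refl)
  also have "\<dots> = (\<Sum>x\<in>carrier G. \<Sum>y\<in>carrier G. \<Sum>c\<in>carrier G.
      v y * w c * (u x * basis_vec (x \<otimes> (y \<otimes> c)) z))"
    by (intro sum.cong refl) (simp add: m_assoc)
  also have "\<dots> = (\<Sum>x\<in>carrier G. \<Sum>b\<in>carrier G. (v \<star> w) b * (u x * basis_vec (x \<otimes> b) z))"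
    by (simp only: sum_times)
  also have "\<dots> = (u \<star> (v \<star> w)) z"
    by (simp add: times_eq[of u] algebra_simps)
  finally show "((u \<star> v) \<star> w) z = (u \<star> (v \<star> w)) z" .
qed

lemma basis_times:
  assumes "g \<in> carrier G" "z \<in> carrier G"
  shows "(basis_vec g \<star> v) z = v (inv g \<otimes> z)"
proof -
  have "(basis_vec g \<star> v) z = form_ext (carrier G) (\<lambda>x. \<Sum>y\<in>carrier G. v y * basis_vec (x \<otimes> y) z) (basis_vec g)"
    by (simp add: times_eq form_ext_def sum_distrib_left mult.assoc)
  also have "\<dots> = (\<Sum>y\<in>carrier G. v y * basis_vec (g \<otimes> y) z)" using assms by simp
  also have "\<dots> = (\<Sum>y\<in>carrier G. v y * (if y = inv g \<otimes> z then 1 else 0))"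
    by (intro sum.cong refl) (use assms in \<open>auto simp: basis_vec_def m_assoc[symmetric]\<close>)
  also have "\<dots> = v (inv g \<otimes> z)" using assms
    by (simp add: if_distrib[where f="(*) _"] sum.delta cong: if_cong)
  finally show ?thesis .
qed

lemma times_basis:
  assumes "g \<in> carrier G" "z \<in> carrier G"
  shows "(v \<star> basis_vec g) z = v (z \<otimes> inv g)"
proof -
  have "(v \<star> basis_vec g) z = form_ext (carrier G) (\<lambda>y. \<Sum>x\<in>carrier G. v x * basis_vec (x \<otimes> y) z) (basis_vec g)"
    unfolding times_eq form_ext_def sum_distrib_left
    by (subst sum.swap) (simp add: mult_ac)
  also have "\<dots> = (\<Sum>x\<in>carrier G. v x * basis_vec (x \<otimes> g) z)" using assms by simp
  also have "\<dots> = (\<Sum>x\<in>carrier G. v x * (if x = z \<otimes> inv g then 1 else 0))"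
    by (intro sum.cong refl) (use assms in \<open>auto simp: basis_vec_def m_assoc\<close>)
  also have "\<dots> = v (z \<otimes> inv g)" using assms
    by (simp add: if_distrib[where f="(*) _"] sum.delta cong: if_cong)
  finally show ?thesis .
qed

lemma basis_times_basis:
  assumes "g \<in> carrier G" "h \<in> carrier G"
  shows "basis_vec g \<star> basis_vec h = (basis_vec (g \<otimes> h) :: _ \<Rightarrow> 'k::field)"
proof
  fix z show "(basis_vec g \<star> basis_vec h) z = (basis_vec (g \<otimes> h) z :: 'k)"
  proof (cases "z \<in> carrier G")
    case True
    then have "inv g \<otimes> z = h \<longleftrightarrow> z = g \<otimes> h" using assms
      by (metis inv_closed inv_inv inv_solve_left)
    with True assms show ?thesis by (simp add: basis_times) (simp add: basis_vec_def)
  next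
    case False
    then have "(basis_vec (g \<otimes> h) z :: 'k) = 0" using assms by (auto simp: basis_vec_def)
    with False show ?thesis by (simp add: vecsD[OF times_in_vecs])
  qed
qed

text \<open>Makes powers \<open>[^]\<close> available in kG, in particular the p-th power of
  \<open>v a\<close>.\<close>

lemma monoid_group_alg: "monoid (group_alg G :: ('a \<Rightarrow> 'k::field) monoid)"
proof (rule monoidI)
  fix x :: "'a \<Rightarrow> 'k" assume x: "x \<in> carrier (group_alg G)"
  show "\<one>\<^bsub>group_alg G\<^esub> \<otimes>\<^bsub>group_alg G\<^esub> x = x"
  proof
    fix z show "(\<one>\<^bsub>group_alg G\<^esub> \<otimes>\<^bsub>group_alg G\<^esub> x) z = x z"
      by (cases "z \<in> carrier G") (use x in \<open>auto simp: basis_times vecsD[OF times_in_vecs] vecsD\<close>)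
  qed
  show "x \<otimes>\<^bsub>group_alg G\<^esub> \<one>\<^bsub>group_alg G\<^esub> = x"
  proof
    fix z show "(x \<otimes>\<^bsub>group_alg G\<^esub> \<one>\<^bsub>group_alg G\<^esub>) z = x z"
      by (cases "z \<in> carrier G") (use x in \<open>auto simp: times_basis vecsD[OF times_in_vecs] vecsD\<close>)
  qed
qed (auto simp: times_assoc)

lemma times_one [simp]:
  "v \<in> vecs (carrier G) \<Longrightarrow> basis_vec \<one> \<star> v = v"
  "v \<in> vecs (carrier G) \<Longrightarrow> v \<star> basis_vec \<one> = v" for v :: "'a \<Rightarrow> 'k::field"
  using monoid.l_one[OF monoid_group_alg, of v] monoid.r_one[OF monoid_group_alg, of v] by auto

text \<open>\<open>inverse_in\<close> is a definite description, so evaluating it requires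
  uniqueness of two-sided inverses.\<close>

lemma inverse_in_eq:
  assumes "is_inverse_in (group_hopf G) v (w :: 'a \<Rightarrow> 'k::field)"
  shows "inverse_in (group_hopf G) v = w"
  unfolding inverse_in_def
proof (rule the_equality)
  show "is_inverse_in (group_hopf G) v w" by fact
next
  fix w' assume w': "is_inverse_in (group_hopf G) v w'"
  have "w' = w' \<star> (v \<star> w)" using assms w' by (auto simp: is_inverse_in_def)
  also have "\<dots> = w' \<star> v \<star> w" by (simp add: times_assoc)
  also have "\<dots> = w" using assms w' by (auto simp: is_inverse_in_def)
  finally show "w' = w" .
qed

lemma times_lin_ext:
  assumes "finite S"
  shows "lin_ext S f v \<star> lin_ext S f w = (\<lambda>z. \<Sum>x\<in>S. \<Sum>y\<in>S. v x * w y * (f x \<star> f y) z)"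
proof
  fix z
  let ?C = "carrier G"
  have "(lin_ext S f v \<star> lin_ext S f w) z =
      (\<Sum>a\<in>?C. \<Sum>b\<in>?C. \<Sum>x\<in>S. \<Sum>y\<in>S. v x * w y * (f x a * f y b * basis_vec (a \<otimes> b) z))"
    unfolding times_eq lin_ext_def sum_product unfolding sum_distrib_right
    by (simp add: mult_ac)
  also have "\<dots> = (\<Sum>a\<in>?C. \<Sum>x\<in>S. \<Sum>b\<in>?C. \<Sum>y\<in>S. v x * w y * (f x a * f y b * basis_vec (a \<otimes> b) z))"
    by (rule sum.cong[OF refl], rule sum.swap)
  also have "\<dots> = (\<Sum>x\<in>S. \<Sum>a\<in>?C. \<Sum>b\<in>?C. \<Sum>y\<in>S. v x * w y * (f x a * f y b * basis_vec (a \<otimes> b) z))"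
    by (rule sum.swap)
  also have "\<dots> = (\<Sum>x\<in>S. \<Sum>a\<in>?C. \<Sum>y\<in>S. \<Sum>b\<in>?C. v x * w y * (f x a * f y b * basis_vec (a \<otimes> b) z))"
    by (rule sum.cong[OF refl], rule sum.cong[OF refl], rule sum.swap)
  also have "\<dots> = (\<Sum>x\<in>S. \<Sum>y\<in>S. \<Sum>a\<in>?C. \<Sum>b\<in>?C. v x * w y * (f x a * f y b * basis_vec (a \<otimes> b) z))"
    by (rule sum.cong[OF refl], rule sum.swap)
  also have "\<dots> = (\<Sum>x\<in>S. \<Sum>y\<in>S. v x * w y * (f x \<star> f y) z)"
    by (simp add: times_eq sum_distrib_left)
  finally show "(lin_ext S f v \<star> lin_ext S f w) z = (\<Sum>x\<in>S. \<Sum>y\<in>S. v x * w y * (f x \<star> f y) z)" .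
qed

end

lemma fin_group_DirProd: "fin_group G \<Longrightarrow> fin_group H \<Longrightarrow> fin_group (G \<times>\<times> H)"
  by (simp add: fin_group_def fin_group_axioms_def DirProd_group)

text \<open>Both sides are bilinear in \<open>v\<close> and \<open>w\<close>, and on basis vectors
  the claim is multiplicativity of \<open>f\<close>. Algebra maps out of kG can therefore be treated
  as homomorphisms defined on the group.\<close>

lemma lin_ext_times:
  assumes "fin_group G" "fin_group K" and hom: "f \<in> hom G (group_alg K)"
  shows "lin_ext (carrier G) f (times_in (group_hopf G) v w) =
    times_in (group_hopf K) (lin_ext (carrier G) f v) (lin_ext (carrier G) f w)"
proof
  interpret G: fin_group G by fact
  interpret K: fin_group K by fact
  fix z
  show "lin_ext (carrier G) f (times_in (group_hopf G) v w) z =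
    times_in (group_hopf K) (lin_ext (carrier G) f v) (lin_ext (carrier G) f w) z"
    unfolding K.times_lin_ext[OF G.fin]
    unfolding lin_ext_def G.sum_times
    by (intro sum.cong refl) (use hom in \<open>auto simp: hom_def\<close>)
qed

lemma hom_lin_ext_comp:
  assumes "fin_group G" "fin_group K" "fin_group L"
    and f: "f \<in> hom G (group_alg K)" and g: "g \<in> hom K (group_alg L)"
  shows "(\<lambda>x. lin_ext (carrier K) g (f x)) \<in> hom G (group_alg L)"
proof (rule homI)
  fix x y assume "x \<in> carrier G" "y \<in> carrier G"
  then show "lin_ext (carrier K) g (f (x \<otimes>\<^bsub>G\<^esub> y)) =
    lin_ext (carrier K) g (f x) \<otimes>\<^bsub>group_alg L\<^esub> lin_ext (carrier K) g (f y)"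
    using lin_ext_times[OF assms(2,3) g] f by (auto simp: hom_def)
qed (use g in \<open>auto intro!: lin_ext_in_vecs simp: hom_def\<close>)

section \<open>Tensor products of group algebras\<close>

lemma times_in_tens:
  fixes v v' :: "'b \<Rightarrow> 'k::field" and w w' :: "'c \<Rightarrow> 'k"
  assumes "finite (hbasis A)" "finite (hbasis B)"
  shows "times_in (tensor_alg A B) (tens v w) (tens v' w') = tens (times_in A v v') (times_in B w w')"
proof
  fix z :: "'b \<times> 'c"
  obtain z1 z2 where z: "z = (z1, z2)" by (cases z)
  have "times_in (tensor_alg A B) (tens v w) (tens v' w') z =
    (\<Sum>a\<in>hbasis A. \<Sum>b\<in>hbasis B. \<Sum>a'\<in>hbasis A. \<Sum>b'\<in>hbasis B.
      (v a * v' a' * hmul A a a' z1) * (w b * w' b' * hmul B b b' z2))"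
    by (simp add: times_in_def tensor_alg_def tens_def z sum.cartesian_product' mult_ac)
  also have "\<dots> = (\<Sum>a\<in>hbasis A. \<Sum>a'\<in>hbasis A. \<Sum>b\<in>hbasis B. \<Sum>b'\<in>hbasis B.
      (v a * v' a' * hmul A a a' z1) * (w b * w' b' * hmul B b b' z2))"
    by (rule sum.cong[OF refl], rule sum.swap)
  also have "\<dots> = tens (times_in A v v') (times_in B w w') z"
    by (simp add: z tens_def times_in_def sum_distrib_left[symmetric] sum_distrib_right[symmetric])
  finally show "times_in (tensor_alg A B) (tens v w) (tens v' w') z = tens (times_in A v v') (times_in B w w') z" .
qed

lemma times_group_hopf_tens:
  assumes "fin_group G" "fin_group H"
  shows "times_in (group_hopf (G \<times>\<times> H)) (tens v w) (tens v' w') =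
    tens (times_in (group_hopf G) v v') (times_in (group_hopf H) w w')"
proof -
  interpret G: fin_group G by fact
  interpret H: fin_group H by fact
  show ?thesis
    using times_in_tens[of "group_hopf G" "group_hopf H" v w v' w'] by simp
qed

lemma hom_tens:
  assumes "fin_group K" "fin_group L" and "f \<in> hom G (group_alg K)" "g \<in> hom H (group_alg L)"
  shows "(\<lambda>(y, z). tens (f y) (g z)) \<in> hom (G \<times>\<times> H) (group_alg (K \<times>\<times> L))"
  using assms(3,4) by (auto simp: hom_def times_group_hopf_tens[OF assms(1,2)] intro!: tens_in_vecs)

text \<open>Triples are bracketed as G x (G x G), whereas \<Delta> \<otimes> id lands in (G x G) x
  G; rebracketing respects products.\<close>

lemma times_group_hopf_assoc:
  "times_in (group_hopf (G \<times>\<times> (H \<times>\<times> K))) (\<lambda>(x, y, z). v ((x, y), z)) (\<lambda>(x, y, z). w ((x, y), z)) =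
   (\<lambda>(x, y, z). times_in (group_hopf ((G \<times>\<times> H) \<times>\<times> K)) v w ((x, y), z))"
  by (simp add: fun_eq_iff times_in_def sum.cartesian_product' basis_vec_def)

text \<open>The flip is an algebra automorphism of kG \<otimes> kG; cocommutativity is invariance of
  \<Delta> under it.\<close>

lemma times_group_hopf_swap:
  "times_in (group_hopf (G \<times>\<times> G)) (v \<circ> prod.swap) (w \<circ> prod.swap) =
   times_in (group_hopf (G \<times>\<times> G)) v w \<circ> prod.swap"
proof
  fix z
  have "times_in (group_hopf (G \<times>\<times> G)) (v \<circ> prod.swap) (w \<circ> prod.swap) z =
     (\<Sum>x\<in>carrier (G \<times>\<times> G). \<Sum>y\<in>carrier (G \<times>\<times> G).
       v (prod.swap x) * w (prod.swap y) * basis_vec (prod.swap x \<otimes>\<^bsub>G \<times>\<times> G\<^esub> prod.swap y) (prod.swap z))"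
    unfolding times_in_def by (cases z) (auto simp: basis_vec_def intro!: sum.cong)
  also have "\<dots> = (\<Sum>x\<in>carrier (G \<times>\<times> G). \<Sum>y\<in>carrier (G \<times>\<times> G).
       v x * w y * basis_vec (x \<otimes>\<^bsub>G \<times>\<times> G\<^esub> y) (prod.swap z))"
  proof -
    have bij: "bij_betw prod.swap (carrier (G \<times>\<times> G)) (carrier (G \<times>\<times> G))"
      by (rule bij_betw_byWitness[where f' = prod.swap]) auto
    show ?thesis
      by (subst sum.reindex_bij_betw[OF bij, symmetric], rule sum.cong[OF refl],
          subst (2) sum.reindex_bij_betw[OF bij, symmetric], rule refl)
  qed
  finally show "times_in (group_hopf (G \<times>\<times> G)) (v \<circ> prod.swap) (w \<circ> prod.swap) z =
      (times_in (group_hopf (G \<times>\<times> G)) v w \<circ> prod.swap) z"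
    by (simp add: times_in_def)
qed

text \<open>As a linear extension, \<Delta> \<otimes> id becomes a map to which
  \<open>lin_ext_times\<close> applies. The support of \<open>t\<close> matters because
  \<open>comul_id\<close> copies the last coordinate even outside the basis.\<close>

lemma comul_id_eq:
  assumes "fin_group G" "hbasis H = carrier G" "t \<in> vecs (carrier G \<times> carrier G)"
  shows "comul_id H t = (\<lambda>(x, y, z). lin_ext (carrier (G \<times>\<times> G))
    (\<lambda>(b, c). tens (hcomul H b) (basis_vec c)) t ((x, y), z))"
proof -
  interpret fin_group G by fact
  have "(\<Sum>c\<in>carrier G. t (b, c) * (hcomul H b xy * basis_vec c z)) = t (b, z) * hcomul H b xy" for b xy z
    using vecsD[OF assms(3), of "(b, z)"]
    by (cases "z \<in> carrier G") (auto simp: basis_vec_def if_distrib[where f="(*) _"] cong: if_cong)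
  then show ?thesis
    by (simp add: fun_eq_iff comul_id_def lin_ext_def sum.cartesian_product' tens_def assms(2))
qed

lemma id_comul_eq:
  assumes "fin_group G" "hbasis H = carrier G" "t \<in> vecs (carrier G \<times> carrier G)"
  shows "id_comul H t = lin_ext (carrier (G \<times>\<times> G)) (\<lambda>(b, c). tens (basis_vec b) (hcomul H c)) t"
proof -
  interpret fin_group G by fact
  have "(\<Sum>b\<in>carrier G. t (b, c) * (basis_vec b z * hcomul H c xy)) = t (z, c) * hcomul H c xy" for c xy z
    using vecsD[OF assms(3), of "(z, c)"]
    by (cases "z \<in> carrier G") (auto simp: basis_vec_def if_distrib[where f="(*) _"]
        if_distrib[where f="\<lambda>c. c * _"] cong: if_cong)
  then show ?thesis
    by (simp add: fun_eq_iff id_comul_def lin_ext_def sum.cartesian_product' tens_def assms(2))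
      (subst sum.swap, simp)
qed

lemma counit_id_eq:
  assumes "fin_group G" "hbasis H = carrier G" "t \<in> vecs (carrier G \<times> carrier G)"
    and "\<And>g. g \<in> carrier G \<Longrightarrow> hcounit H g = 1"
  shows "counit_id H t = lin_ext (carrier (G \<times>\<times> G)) (\<lambda>(b, c). basis_vec c) t"
    and "id_counit H t = lin_ext (carrier (G \<times>\<times> G)) (\<lambda>(b, c). basis_vec b) t"
proof -
  interpret fin_group G by fact
  have 1: "(\<Sum>c\<in>carrier G. t (b, c) * basis_vec c z) = t (b, z)" for b z
    using vecsD[OF assms(3), of "(b, z)"]
    by (cases "z \<in> carrier G") (auto simp: basis_vec_def if_distrib[where f="(*) _"] cong: if_cong)
  have 2: "(\<Sum>b\<in>carrier G. t (b, c) * basis_vec b z) = t (z, c)" for c z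
    using vecsD[OF assms(3), of "(z, c)"]
    by (cases "z \<in> carrier G") (auto simp: basis_vec_def if_distrib[where f="(*) _"] cong: if_cong)
  show "counit_id H t = lin_ext (carrier (G \<times>\<times> G)) (\<lambda>(b, c). basis_vec c) t"
    by (simp add: fun_eq_iff counit_id_def lin_ext_def sum.cartesian_product' assms(2,4) 1)
  show "id_counit H t = lin_ext (carrier (G \<times>\<times> G)) (\<lambda>(b, c). basis_vec b) t"
    by (simp add: fun_eq_iff id_counit_def lin_ext_def sum.cartesian_product' assms(2,4))
      (subst sum.swap, simp add: 2)
qed

lemma (in fin_group) times_basis_cancel:
  assumes "v \<in> vecs (carrier G)" "w \<in> vecs (carrier G)" "g \<in> carrier G"
    "v \<star> basis_vec g = w \<star> basis_vec g"
  shows "v = w"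
proof -
  have "v \<star> basis_vec g \<star> basis_vec (inv g) = w \<star> basis_vec g \<star> basis_vec (inv g)"
    using assms(4) by simp
  then show ?thesis using assms(1-3) by (simp add: times_assoc basis_times_basis)
qed

section \<open>Vectors supported on a subgroup\<close>

lemma subgroup_times:
  assumes "fin_group G" "subgroup H G" "v \<in> vecs H" "w \<in> vecs H"
  shows "times_in (group_hopf G) v w \<in> vecs H"
    and "form_ext H f (times_in (group_hopf G) v w) =
      (\<Sum>x\<in>H. \<Sum>y\<in>H. v x * w y * f (x \<otimes>\<^bsub>G\<^esub> y))"
    and "times_in (group_hopf G) v w = times_in (group_hopf (G\<lparr>carrier := H\<rparr>)) v w"
proof -
  interpret G: fin_group G by fact
  interpret H: subgroup H G by fact
  note sub = H.subset
  have fH: "finite H" using sub G.fin finite_subset by blast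
  have red: "(\<Sum>x\<in>carrier G. \<Sum>y\<in>carrier G. v x * w y * f x y) = (\<Sum>x\<in>H. \<Sum>y\<in>H. v x * w y * f x y)" for f
  proof -
    have "(\<Sum>x\<in>carrier G. \<Sum>y\<in>carrier G. v x * w y * f x y) = (\<Sum>x\<in>H. \<Sum>y\<in>carrier G. v x * w y * f x y)"
      by (rule sum.mono_neutral_right) (use sub vecsD[OF assms(3)] in auto)
    also have "\<dots> = (\<Sum>x\<in>H. \<Sum>y\<in>H. v x * w y * f x y)"
      by (intro sum.cong refl sum.mono_neutral_right) (use sub vecsD[OF assms(4)] in auto)
    finally show ?thesis .
  qed
  show *: "times_in (group_hopf G) v w = times_in (group_hopf (G\<lparr>carrier := H\<rparr>)) v w"
    by (rule ext) (simp add: times_in_def red)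
  show v: "times_in (group_hopf G) v w \<in> vecs H"
    by (rule vecsI) (auto simp: G.times_eq red basis_vec_def intro!: sum.neutral)
  have "form_ext H f (times_in (group_hopf G) v w) = form_ext (carrier G) f (times_in (group_hopf G) v w)"
    using form_ext_mono[OF G.fin sub v] by simp
  also have "\<dots> = (\<Sum>x\<in>H. \<Sum>y\<in>H. v x * w y * f (x \<otimes>\<^bsub>G\<^esub> y))"
    by (simp add: form_ext_def G.sum_times red)
  finally show "form_ext H f (times_in (group_hopf G) v w) = (\<Sum>x\<in>H. \<Sum>y\<in>H. v x * w y * f (x \<otimes>\<^bsub>G\<^esub> y))" .
qed

lemma form_ext_times_subgroup:
  assumes "fin_group G" "subgroup H G" "v \<in> vecs H" "w \<in> vecs H"
    and "\<And>x y. x \<in> H \<Longrightarrow> y \<in> H \<Longrightarrow> f (x \<otimes>\<^bsub>G\<^esub> y) = f x * f y"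
  shows "form_ext H f (times_in (group_hopf G) v w) = form_ext H f v * form_ext H f w"
  unfolding subgroup_times(2)[OF assms(1-4)]
  by (simp add: form_ext_def sum_product assms(5) algebra_simps)

lemma form_ext_times:
  assumes "fin_group G" and "\<And>x y. x \<in> carrier G \<Longrightarrow> y \<in> carrier G \<Longrightarrow> f (x \<otimes>\<^bsub>G\<^esub> y) = f x * f y"
  shows "form_ext (carrier G) f (times_in (group_hopf G) v w) =
    form_ext (carrier G) f v * form_ext (carrier G) f w"
proof -
  interpret fin_group G by fact
  show ?thesis unfolding form_ext_def sum_times sum_product
    by (simp add: assms(2) mult_ac)
qed

lemma (in fin_group) times_lin_ext_left:
  assumes "finite S" shows "lin_ext S f v \<star> w = lin_ext S (\<lambda>x. f x \<star> w) v"
proof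
  fix z
  have "(lin_ext S f v \<star> w) z =
      (\<Sum>a\<in>carrier G. \<Sum>b\<in>carrier G. \<Sum>x\<in>S. v x * (f x a * w b * basis_vec (a \<otimes> b) z))"
    by (simp add: times_eq lin_ext_def sum_distrib_right sum_distrib_left mult_ac)
  also have "\<dots> = (\<Sum>a\<in>carrier G. \<Sum>x\<in>S. \<Sum>b\<in>carrier G. v x * (f x a * w b * basis_vec (a \<otimes> b) z))"
    by (rule sum.cong[OF refl], rule sum.swap)
  also have "\<dots> = (\<Sum>x\<in>S. \<Sum>a\<in>carrier G. \<Sum>b\<in>carrier G. v x * (f x a * w b * basis_vec (a \<otimes> b) z))"
    by (rule sum.swap)
  finally show "(lin_ext S f v \<star> w) z = lin_ext S (\<lambda>x. f x \<star> w) v z"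
    by (simp add: times_eq lin_ext_def sum_distrib_left)
qed

lemma (in fin_group) times_lin_ext_right:
  assumes "finite S" shows "w \<star> lin_ext S f v = lin_ext S (\<lambda>x. w \<star> f x) v"
proof
  fix z
  have "(w \<star> lin_ext S f v) z =
      (\<Sum>a\<in>carrier G. \<Sum>b\<in>carrier G. \<Sum>x\<in>S. v x * (w a * f x b * basis_vec (a \<otimes> b) z))"
    by (simp add: times_eq lin_ext_def sum_distrib_right sum_distrib_left mult_ac)
  also have "\<dots> = (\<Sum>a\<in>carrier G. \<Sum>x\<in>S. \<Sum>b\<in>carrier G. v x * (w a * f x b * basis_vec (a \<otimes> b) z))"
    by (rule sum.cong[OF refl], rule sum.swap)
  also have "\<dots> = (\<Sum>x\<in>S. \<Sum>a\<in>carrier G. \<Sum>b\<in>carrier G. v x * (w a * f x b * basis_vec (a \<otimes> b) z))"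
    by (rule sum.swap)
  finally show "(w \<star> lin_ext S f v) z = lin_ext S (\<lambda>x. w \<star> f x) v z"
    by (simp add: times_eq lin_ext_def sum_distrib_left)
qed

lemma (in fin_group) conj_vec:
  assumes K: "subgroup K G" and g: "g \<in> carrier G"
    and \<theta>: "\<And>z. z \<in> K \<Longrightarrow> \<theta> z \<in> K" "\<And>z. z \<in> K \<Longrightarrow> g \<otimes> z = \<theta> z \<otimes> g"
    and v: "v \<in> vecs K"
  shows "basis_vec g \<star> v = lin_ext K (\<lambda>z. basis_vec (\<theta> z)) v \<star> basis_vec g"
proof -
  have sub: "K \<subseteq> carrier G" using K by (rule subgroup.subset)
  then have fK: "finite K" using fin finite_subset by blast
  have "basis_vec g \<star> v = basis_vec g \<star> lin_ext K basis_vec v"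
    using lin_ext_basis_vec[OF fK v] by simp
  also have "\<dots> = lin_ext K (\<lambda>z. basis_vec (g \<otimes> z)) v"
    unfolding times_lin_ext_right[OF fK]
    by (rule lin_ext_cong) (use sub g in \<open>auto simp: basis_times_basis subset_iff\<close>)
  also have "\<dots> = lin_ext K (\<lambda>z. basis_vec (\<theta> z) \<star> basis_vec g) v"
    by (rule lin_ext_cong) (use sub g \<theta> in \<open>auto simp: basis_times_basis subset_iff\<close>)
  finally show ?thesis unfolding times_lin_ext_left[OF fK] .
qed

text \<open>A character \<open>\<chi> x\<close> of \<open>K\<close> turns products in the group algebra of \<open>K\<close> into products in
  \<open>k\<close>, and conjugation by \<open>g\<close> becomes a reindexing \<open>\<tau>\<close> of the characters.\<close>

lemma (in fin_group) twisted_power: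
  assumes K: "subgroup K G" and g: "g \<in> carrier G"
    and \<theta>: "\<And>z. z \<in> K \<Longrightarrow> \<theta> z \<in> K" "\<And>z. z \<in> K \<Longrightarrow> g \<otimes> z = \<theta> z \<otimes> g"
    and \<chi>: "\<And>x y z. y \<in> K \<Longrightarrow> z \<in> K \<Longrightarrow> \<chi> x (y \<otimes> z) = \<chi> x y * \<chi> x z"
    and one: "\<And>x. \<chi> x \<one> = 1"
    and \<tau>: "\<And>x z. z \<in> K \<Longrightarrow> \<chi> x (\<theta> z) = \<chi> (\<tau> x) z"
    and v: "v \<in> vecs K"
  shows "\<exists>w\<in>vecs K. (v \<star> basis_vec g) [^]\<^bsub>group_alg G\<^esub> (k::nat) = w \<star> basis_vec (g [^] k) \<and>
    (\<forall>x. form_ext K (\<chi> x) w = (\<Prod>i<k. form_ext K (\<chi> ((\<tau> ^^ i) x)) v))"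
proof (induction k)
  interpret A: monoid "group_alg G" by (rule monoid_group_alg)
  have sub: "K \<subseteq> carrier G" using K by (rule subgroup.subset)
  then have fK: "finite K" using fin finite_subset by blast
  have oneK: "\<one> \<in> K" using K by (rule subgroup.one_closed)
  {
    case 0
    show ?case
      by (rule bexI[of _ "basis_vec \<one>"]) (use oneK fK one in auto)
  next
    case (Suc k)
    then obtain w where w: "w \<in> vecs K" "(v \<star> basis_vec g) [^]\<^bsub>group_alg G\<^esub> k = w \<star> basis_vec (g [^] k)"
      "\<And>x. form_ext K (\<chi> x) w = (\<Prod>i<k. form_ext K (\<chi> ((\<tau> ^^ i) x)) v)" by blast
    let ?w = "lin_ext K (\<lambda>z. basis_vec (\<theta> z)) w"
    have w'K: "?w \<in> vecs K" by (rule lin_ext_in_vecs) (simp add: \<theta>)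
    have fw: "form_ext K (\<chi> x) ?w = form_ext K (\<chi> (\<tau> x)) w" for x
      unfolding form_ext_lin_ext[OF fK fK]
      by (rule form_ext_cong) (simp add: \<theta> \<tau> fK)
    have cj: "basis_vec g \<star> w = ?w \<star> basis_vec g"
      by (rule conj_vec[OF K g]) (use \<theta> w in auto)
    \<comment> \<open>The new factor is split off on the left: moving \<open>g\<close> past
      \<open>w\<close> shifts every index in the product for \<open>w\<close> by one, and
      \<open>v\<close> supplies index 0.\<close>
    have "(v \<star> basis_vec g) [^]\<^bsub>group_alg G\<^esub> Suc k =
        (v \<star> basis_vec g) \<star> (v \<star> basis_vec g) [^]\<^bsub>group_alg G\<^esub> k"
      using A.nat_pow_Suc2[of "v \<star> basis_vec g" k] by simp
    also have "\<dots> = v \<star> (basis_vec g \<star> w) \<star> basis_vec (g [^] k)"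
      by (simp add: w(2) times_assoc)
    also have "\<dots> = v \<star> ?w \<star> (basis_vec g \<star> basis_vec (g [^] k))"
      by (simp only: cj times_assoc)
    also have "\<dots> = v \<star> ?w \<star> basis_vec (g [^] Suc k)"
      using g nat_pow_Suc2[OF g, of k] by (simp add: basis_times_basis)
    finally have 1: "(v \<star> basis_vec g) [^]\<^bsub>group_alg G\<^esub> Suc k = v \<star> ?w \<star> basis_vec (g [^] Suc k)" .
    have "form_ext K (\<chi> x) (v \<star> ?w) = (\<Prod>i<Suc k. form_ext K (\<chi> ((\<tau> ^^ i) x)) v)" for x
      using form_ext_times_subgroup[OF fin_group_axioms K v w'K, of "\<chi> x"] \<chi>
      by (simp add: fw w(3) prod.lessThan_Suc_shift funpow_swap1 del: prod.lessThan_Suc)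
    then show ?case
      using 1 subgroup_times(1)[OF fin_group_axioms K v w'K] by blast
  }
qed

section \<open>Cocycles on the plane\<close>

definition cocycle :: "('a::ab_group_add \<Rightarrow> 'a \<Rightarrow> 'k::field) \<Rightarrow> bool" where
  "cocycle s \<longleftrightarrow> (\<forall>x y. s x y \<noteq> 0) \<and> (\<forall>x y z. s x y * s (x + y) z = s y z * s x (y + z)) \<and>
     (\<forall>x. s x 0 = 1 \<and> s 0 x = 1)"

lemma cocycleD:
  assumes "cocycle s"
  shows "s x y \<noteq> 0" "s x y * s (x + y) z = s y z * s x (y + z)" "s x 0 = 1" "s 0 x = 1"
  using assms by (auto simp: cocycle_def)

lemma cocycle_mult: "cocycle s \<Longrightarrow> cocycle s' \<Longrightarrow> cocycle (\<lambda>x y. s x y * s' x y)"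
  unfolding cocycle_def by (auto simp: algebra_simps)

lemma cocycle_inverse: "cocycle s \<Longrightarrow> cocycle (\<lambda>x y. inverse (s x y))"
  unfolding cocycle_def by (simp flip: inverse_mult_distrib)

lemma cocycle_comp:
  assumes "cocycle s" "\<And>x y. h (x + y) = h x + h y"
  shows "cocycle (\<lambda>x y. s (h x) (h y))"
proof -
  have "h 0 = 0" using assms(2)[of 0 0] by simp
  then show ?thesis using assms by (simp add: cocycle_def)
qed

text \<open>The commutator pairing of the central extension belonging to the cocycle
  \<open>s\<close>; where \<open>s\<close> does not vanish, it is 1 exactly when \<open>s\<close> is
  symmetric.\<close>

definition alt :: "('a \<Rightarrow> 'a \<Rightarrow> 'k::field) \<Rightarrow> 'a \<Rightarrow> 'a \<Rightarrow> 'k" where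
  "alt s x y = s x y / s y x"

text \<open>Expanding \<open>s (x + y) z\<close> and \<open>s z (x + y)\<close> by the cocycle
  identity produces the same factor \<open>s x y\<close>; a third instance trades
  \<open>s x (y + z)\<close> for \<open>s (z + x) y\<close>, after which everything unwanted
  cancels.\<close>

lemma alt_add_left:
  assumes "cocycle s" shows "alt s (x + y) z = alt s x z * alt s y z"
proof -
  note c = cocycleD[OF assms]
  have 1: "s (x + y) z = s y z * s x (y + z) / s x y"
    using c(1)[of x y] c(2)[of x y z] by (simp add: field_simps)
  have 2: "s z (x + y) = s z x * s (z + x) y / s x y"
    using c(1)[of x y] c(2)[of z x y] by (simp add: field_simps)
  have 3: "s x (y + z) = s x z * s (z + x) y / s z y"
    using c(1)[of z y] c(2)[of x z y] by (simp add: field_simps add.commute)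
  show ?thesis
    unfolding alt_def 1 2 3 using c(1) by (simp add: field_simps)
qed

lemma alt_swap: "alt s y x = inverse (alt s x y)"
  by (simp add: alt_def)

lemma alt_nonzero: "cocycle s \<Longrightarrow> alt s x y \<noteq> 0"
  by (simp add: alt_def cocycleD)

lemma alt_self: "cocycle s \<Longrightarrow> alt s x x = 1"
  by (simp add: alt_def cocycleD)

lemma int_mult_hom:
  fixes h :: "int \<Rightarrow> 'k::field"
  assumes add: "\<And>a b. h (a + b) = h a * h b" and "\<And>a. h a \<noteq> 0"
  shows "h a = h 1 powi a"
proof -
  have 0: "h 0 = 1" using add[of 0 0] assms(2) by simp
  show ?thesis
  proof (induction a rule: int_induct[where k=0])
    case (step1 i)
    then show ?case using assms by (simp add: power_int_add)
  next
    case (step2 i)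
    have "h (i - 1) * h 1 = h i" using add[of "i - 1" 1] by simp
    then show ?case using step2 assms(2)[of 1] by (simp add: power_int_diff field_simps)
  qed (simp add: 0)
qed

text \<open>An alternating bicharacter in rank two is determined by its value on the standard basis,
  as every alternating bilinear form on Z^2 is a multiple of the determinant.\<close>

lemma alt_det:
  assumes c: "cocycle (s :: int \<times> int \<Rightarrow> int \<times> int \<Rightarrow> 'k::field)"
  shows "alt s x y = alt s (1, 0) (0, 1) powi det2 x y"
proof -
  obtain a b where x: "x = (a, b)" by force
  obtain a' b' where y: "y = (a', b')" by force
  let ?e = "alt s (1, 0) (0, 1)"
  have L: "alt s (a, b) z = alt s (1, 0) z powi a * alt s (0, 1) z powi b" for a b z
  proof -
    have "alt s (a, b) z = alt s (a, 0) z * alt s (0, b) z"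
      using alt_add_left[OF c, of "(a, 0)" "(0, b)" z] by simp
    also have "alt s (a, 0) z = alt s (1, 0) z powi a"
      by (rule int_mult_hom[of "\<lambda>a. alt s (a, 0) z"])
        (use alt_add_left[OF c, of "(_, 0)" "(_, 0)" z] alt_nonzero[OF c] in auto)
    also have "alt s (0, b) z = alt s (0, 1) z powi b"
      by (rule int_mult_hom[of "\<lambda>b. alt s (0, b) z"])
        (use alt_add_left[OF c, of "(0, _)" "(0, _)" z] alt_nonzero[OF c] in auto)
    finally show ?thesis .
  qed
  have nz: "?e \<noteq> 0" by (rule alt_nonzero[OF c])
  have e1: "alt s (1, 0) (a', b') = ?e powi b'"
  proof -
    have "alt s (1, 0) (a', b') = inverse (alt s (0, 1) (1, 0) powi b')"
      unfolding alt_swap[of s "(1, 0)" "(a', b')"] L[of a' b' "(1, 0)"] alt_self[OF c] by simp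
    then show ?thesis unfolding alt_swap[of s "(0, 1)" "(1, 0)"] by (simp add: power_int_inverse)
  qed
  have e2: "alt s (0, 1) (a', b') = ?e powi (- a')"
    unfolding alt_swap[of s "(0, 1)" "(a', b')"] L[of a' b' "(0, 1)"] alt_self[OF c]
    by (simp add: power_int_minus)
  have "alt s x y = ?e powi (b' * a) * ?e powi (- a' * b)"
    unfolding x y L[of a b "(a', b')"] e1 e2 by (simp only: power_int_mult)
  also have "\<dots> = ?e powi (b' * a + - a' * b)"
    by (rule power_int_add[symmetric]) (use nz in simp)
  finally show ?thesis by (simp add: det2_def x y algebra_simps)
qed

text \<open>The section \<open>x \<mapsto> e\<^sub>1\<^bsup>x\<^sub>1\<^esup> e\<^sub>2\<^bsup>x\<^sub>2\<^esup>\<close> of the commutative central extension defined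
  by a symmetric cocycle is a homomorphism because \<open>\<int>\<^sup>2\<close> is free.\<close>

lemma symmetric_cocycle_splits:
  fixes s :: "int \<times> int \<Rightarrow> int \<times> int \<Rightarrow> 'k::field"
  assumes c: "cocycle s" and sym: "\<And>x y. s x y = s y x"
  obtains \<nu> where "\<And>x. \<nu> x \<noteq> 0" "\<And>x y. \<nu> x * \<nu> y = s x y * \<nu> (x + y)"
proof -
  note cD = cocycleD[OF c]
  define E :: "('k \<times> int \<times> int) monoid" where
    "E = \<lparr>carrier = (UNIV - {0}) \<times> UNIV,
      monoid.mult = (\<lambda>(c, x) (d, y). (c * d * s x y, x + y)), one = (1, 0)\<rparr>"
  interpret E: comm_group E
  proof (rule comm_groupI)
    fix u v w assume "u \<in> carrier E" "v \<in> carrier E" "w \<in> carrier E"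
    obtain c x d y b z where uvw: "u = (c, x)" "v = (d, y)" "w = (b, z)" by (metis surj_pair)
    have "s x y * s (x + y) z = s y z * s x (y + z)" by (rule cD(2))
    then have "c * d * b * (s x y * s (x + y) z) = c * d * b * (s y z * s x (y + z))" by simp
    then show "u \<otimes>\<^bsub>E\<^esub> v \<otimes>\<^bsub>E\<^esub> w = u \<otimes>\<^bsub>E\<^esub> (v \<otimes>\<^bsub>E\<^esub> w)"
      by (simp add: E_def uvw mult_ac add.assoc)
  next
    fix u assume "u \<in> carrier E"
    then obtain c x where u: "u = (c, x)" "c \<noteq> 0" by (auto simp: E_def)
    \<comment> \<open>The inverse of (c, x) must cancel \<open>s (- x) x\<close> as well as
      \<open>c\<close>, since the product in \<open>E\<close> carries the factor
      \<open>s\<close>.\<close>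
    then show "\<exists>v\<in>carrier E. v \<otimes>\<^bsub>E\<^esub> u = \<one>\<^bsub>E\<^esub>"
      by (intro bexI[of _ "(inverse (c * s (- x) x), - x)"]) (auto simp: E_def cD field_simps)
  qed (auto simp: E_def cD sym add.commute)
  have mem: "(1, x) \<in> carrier E" for x by (simp add: E_def)
  define g where "g = (\<lambda>x. (1, (1, 0)) [^]\<^bsub>E\<^esub> (fst x :: int) \<otimes>\<^bsub>E\<^esub> (1, (0, 1)) [^]\<^bsub>E\<^esub> (snd x :: int))"
  have gc: "g x \<in> carrier E" for x by (simp add: g_def mem)
  have gadd: "g (x + y) = g x \<otimes>\<^bsub>E\<^esub> g y" for x y
    by (simp add: g_def mem E.int_pow_mult E.m_ac)
  have snd_mult: "snd (u \<otimes>\<^bsub>E\<^esub> v) = snd u + snd v" for u v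
    by (auto simp: E_def split: prod.split)
  have snd_pow: "snd (u [^]\<^bsub>E\<^esub> (k::int)) = (k * fst (snd u), k * snd (snd u))" if "u \<in> carrier E" for u k
  proof (induction k rule: int_induct[where k=0])
    case base then show ?case by (simp add: E_def zero_prod_def)
  next
    case (step1 i)
    have "u [^]\<^bsub>E\<^esub> (i + 1) = u [^]\<^bsub>E\<^esub> i \<otimes>\<^bsub>E\<^esub> u" using that by (simp add: E.int_pow_mult)
    then show ?case using step1 by (simp add: snd_mult plus_prod_def algebra_simps)
  next
    case (step2 i)
    have "u [^]\<^bsub>E\<^esub> i = u [^]\<^bsub>E\<^esub> (i - 1) \<otimes>\<^bsub>E\<^esub> u"
      using that E.int_pow_mult[of u "i - 1" 1] by simp
    then have "snd (u [^]\<^bsub>E\<^esub> i) = snd (u [^]\<^bsub>E\<^esub> (i - 1)) + snd u" by (simp add: snd_mult)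
    then have "snd (u [^]\<^bsub>E\<^esub> (i - 1)) = snd (u [^]\<^bsub>E\<^esub> i) - snd u" by simp
    then show ?case using step2 by (simp add: minus_prod_def algebra_simps)
  qed
  have sg: "snd (g x) = x" for x by (simp add: g_def snd_mult snd_pow mem plus_prod_def)
  \<comment> \<open>The first component of \<open>g\<close> satisfies the reciprocal of the wanted
    relation, with \<open>s x y\<close> on the other side; hence the inverse.\<close>
  define \<nu> where "\<nu> x = inverse (fst (g x))" for x
  show thesis
  proof
    show nz: "\<nu> x \<noteq> 0" for x using gc[of x] by (auto simp: \<nu>_def E_def)
    fix x y
    have "fst (g (x + y)) = fst (g x) * fst (g y) * s x y"
      unfolding gadd using sg[of x] sg[of y] by (simp add: E_def split: prod.split) (metis fst_conv snd_conv)
    then show "\<nu> x * \<nu> y = s x y * \<nu> (x + y)"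
      using cD(1)[of x y] by (simp add: \<nu>_def field_simps)
  qed
qed

definition congr :: "nat \<Rightarrow> int \<times> int \<Rightarrow> int \<times> int \<Rightarrow> bool" where
  "congr q x y \<longleftrightarrow> [fst x = fst y] (mod int q) \<and> [snd x = snd y] (mod int q)"

lemma congr_refl [simp]: "congr q x x" by (simp add: congr_def)

text \<open>Divisibility of the units of \<open>k\<close> makes the splitting over \<open>\<int>\<^sup>2\<close> descend to the torsion
  group \<open>(\<int>/q)\<^sup>2\<close>.\<close>

lemma periodic_symmetric_cocycle_splits:
  fixes s :: "int \<times> int \<Rightarrow> int \<times> int \<Rightarrow> 'k::alg_closed_field"
  assumes c: "cocycle s" and sym: "\<And>x y. s x y = s y x" and "q > 0"
    and per: "\<And>x y y'. congr q y y' \<Longrightarrow> s x y = s x y'"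
  obtains \<nu> where "\<And>x. \<nu> x \<noteq> 0" "\<And>x y. \<nu> x * \<nu> y = s x y * \<nu> (x + y)"
    "\<And>x y. congr q x y \<Longrightarrow> \<nu> x = \<nu> y"
proof -
  obtain \<mu> where nz: "\<And>x. \<mu> x \<noteq> 0" and split: "\<And>x y. \<mu> x * \<mu> y = s x y * \<mu> (x + y)"
    using symmetric_cocycle_splits[OF c sym] by blast
  let ?q = "int q"
  \<comment> \<open>By periodicity \<open>s\<close> is trivial as soon as its second argument lies
    in the sublattice q Z^2, so \<open>\<mu>\<close> is multiplicative there.\<close>
  have mult: "\<mu> (x + (?q * i, ?q * j)) = \<mu> x * \<mu> (?q * i, ?q * j)" for x i j
  proof -
    have "s x (?q * i, ?q * j) = s x 0"
      by (rule per) (simp add: congr_def cong_0_iff)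
    then show ?thesis using split[of x "(?q * i, ?q * j)"] cocycleD(3)[OF c] by simp
  qed
  \<comment> \<open>With these roots, x \<mapsto> r1^x1 r2^x2 is a character of Z^2 that agrees with
    \<open>\<mu>\<close> on q Z^2. Dividing \<open>\<mu>\<close> by it keeps the coboundary and
    makes the splitting periodic.\<close>
  obtain r1 where r1: "r1 ^ q = \<mu> (?q, 0)" using nth_root_exists[OF \<open>q > 0\<close>] by blast
  obtain r2 where r2: "r2 ^ q = \<mu> (0, ?q)" using nth_root_exists[OF \<open>q > 0\<close>] by blast
  have r0: "r1 \<noteq> 0" "r2 \<noteq> 0" using r1 r2 nz \<open>q > 0\<close> by (metis power_0_left less_numeral_extra(3))+
  have 1: "\<mu> (?q * i, 0) = r1 powi (?q * i)" for i
    using int_mult_hom[of "\<lambda>i. \<mu> (?q * i, 0)" i] mult[of "(?q * _, 0)" _ 0] nz r1[symmetric]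
    by (simp add: distrib_left power_int_mult)
  have 2: "\<mu> (0, ?q * j) = r2 powi (?q * j)" for j
    using int_mult_hom[of "\<lambda>i. \<mu> (0, ?q * i)" j] mult[of "(0, ?q * _)" 0] nz r2[symmetric]
    by (simp add: distrib_left power_int_mult)
  have 12: "\<mu> (?q * i, ?q * j) = r1 powi (?q * i) * r2 powi (?q * j)" for i j
    using mult[of "(?q * i, 0)" 0 j] by (simp add: 1 2)
  define \<nu> where "\<nu> x = \<mu> x / (r1 powi fst x * r2 powi snd x)" for x
  show thesis
  proof
    show "\<nu> x \<noteq> 0" for x using nz r0 by (simp add: \<nu>_def)
    show "\<nu> x * \<nu> y = s x y * \<nu> (x + y)" for x y
      using split[of x y] r0 by (simp add: \<nu>_def power_int_add field_simps)
    fix x y assume "congr q x y"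
    then obtain i j where ij: "fst x = fst y + ?q * i" "snd x = snd y + ?q * j"
      by (metis congr_def cong_iff_lin cong_sym)
    then have x: "x = y + (?q * i, ?q * j)" by (simp add: prod_eq_iff)
    show "\<nu> x = \<nu> y"
      unfolding \<nu>_def x mult 12 using r0 by (simp add: power_int_add field_simps)
  qed
qed

section \<open>Roots of unity\<close>

locale prim_root =
  fixes q :: nat and \<xi> :: "'k::field_char_0"
  assumes prim: "is_primitive_root_of_unity q \<xi>"
begin

lemma q_pos: "q > 0" and root: "\<xi> ^ q = 1" and
  root_min: "0 < i \<Longrightarrow> i < q \<Longrightarrow> \<xi> ^ i \<noteq> 1"
  using prim by (auto simp: is_primitive_root_of_unity_def)

lemma root_nonzero [simp]: "\<xi> \<noteq> 0"
  using root q_pos by (metis power_0_left less_numeral_extra(3) zero_neq_one)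

lemma root_powi_mod: "\<xi> powi (a mod int q) = \<xi> powi a"
proof -
  have "\<xi> powi a = \<xi> powi (int q * (a div int q) + a mod int q)" by simp
  also have "\<dots> = \<xi> powi (a mod int q)"
    using root by (subst power_int_add) (auto simp: power_int_mult)
  finally show ?thesis ..
qed

lemma root_powi_cong: "[a = b] (mod int q) \<Longrightarrow> \<xi> powi a = \<xi> powi b"
  by (metis cong_def root_powi_mod)

lemma root_powi_eq_1_iff: "\<xi> powi a = 1 \<longleftrightarrow> int q dvd a"
proof
  assume "\<xi> powi a = 1"
  then have "\<xi> powi (a mod int q) = 1" by (simp add: root_powi_mod)
  then have "\<xi> ^ nat (a mod int q) = 1" using q_pos by (simp add: power_int_nonneg_exp)
  moreover have "nat (a mod int q) < q" using q_pos by (simp add: nat_less_iff)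
  ultimately have "nat (a mod int q) = 0" using root_min by blast
  then have "a mod int q = 0" using q_pos pos_mod_sign[of "int q" a] by linarith
  then show "int q dvd a" by (rule dvd_eq_mod_eq_0[THEN iffD2])
next
  assume "int q dvd a"
  then show "\<xi> powi a = 1" using root_powi_cong[of a 0] by (simp add: cong_0_iff)
qed

lemma root_sum: "(\<Sum>i\<in>{0..<int q}. \<xi> powi (a * i)) = (if int q dvd a then of_nat q else 0)"
proof (cases "int q dvd a")
  case True
  then have "\<xi> powi (a * i) = 1" for i by (subst root_powi_eq_1_iff) simp
  with True show ?thesis by simp
next
  case False
  let ?z = "\<xi> powi a"
  have ne: "?z \<noteq> 1" using False by (simp add: root_powi_eq_1_iff)
  have "{0..<int q} = int ` {..<q}" by (simp add: image_int_atLeastLessThan lessThan_atLeast0)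
  then have "(\<Sum>i\<in>{0..<int q}. \<xi> powi (a * i)) = (\<Sum>i<q. ?z ^ i)"
    by (simp add: sum.reindex power_int_mult)
  also have "\<dots> = (?z ^ q - 1) / (?z - 1)" using ne by (simp add: geometric_sum)
  also have "?z ^ q = 1" by (simp add: power_int_power' root_powi_eq_1_iff)
  finally show ?thesis using False by simp
qed

text \<open>The polynomial \<open>X\<^sup>q - 1\<close> has at most \<open>q\<close> roots.\<close>

lemma root_of_unity_power:
  assumes "z ^ q = 1" obtains a where "0 \<le> a" "a < int q" "z = \<xi> powi a"
proof -
  let ?R = "{z. z ^ q = (1::'k)}"
  let ?P = "(\<lambda>a. \<xi> powi a) ` {0..<int q}"
  define f where "f = Polynomial.monom (1::'k) q - Polynomial.monom 1 0"
  have "Polynomial.coeff f q = 1" using q_pos by (simp only: f_def Polynomial.coeff_diff Polynomial.coeff_monom) simp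
  then have f0: "f \<noteq> 0" by force
  have "degree f \<le> q"
    unfolding f_def by (intro degree_diff_le degree_monom_le[THEN order_trans]) auto
  moreover have R: "?R = {z. poly f z = 0}" by (simp only: f_def poly_diff poly_monom) simp
  ultimately have card: "card ?R \<le> q" using card_poly_roots_bound[OF f0] by simp
  have fin: "finite ?R" unfolding R by (rule poly_roots_finite[OF f0])
  have "inj_on (\<lambda>a. \<xi> powi a) {0..<int q}"
  proof (rule inj_onI)
    fix a b assume ab: "a \<in> {0..<int q}" "b \<in> {0..<int q}" "\<xi> powi a = \<xi> powi b"
    then have "\<xi> powi (a - b) = 1" by (simp add: power_int_diff)
    then have "int q dvd a - b" by (simp add: root_powi_eq_1_iff)
    then have "[a = b] (mod int q)" by (simp add: cong_iff_dvd_diff)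
    then show "a = b" using ab(1,2) by (simp add: cong_def)
  qed
  then have "card ?P = q" by (simp add: card_image)
  moreover have "?P \<subseteq> ?R" by (auto simp: power_int_power' root_powi_eq_1_iff)
  ultimately have "?P = ?R" using fin card by (metis card_seteq)
  then have "z \<in> ?P" using assms by blast
  then show thesis using that by auto
qed

end

section \<open>The group and its characters\<close>

definition diag :: "int \<Rightarrow> int \<Rightarrow> int \<times> int \<Rightarrow> int \<times> int" where
  "diag a b x = (a * fst x, b * snd x)"

lemma diag_add: "diag a b (x + y) = diag a b x + diag a b y"
  by (simp add: diag_def prod_eq_iff algebra_simps)

lemma diag_diag: "diag a b (diag c d x) = diag (a * c) (b * d) x"
  by (simp add: diag_def mult_ac)

lemma diag_1 [simp]: "diag 1 1 x = x"
  by (simp add: diag_def)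

lemma diag_0 [simp]: "diag a b 0 = 0"
  by (simp add: diag_def zero_prod_def)

lemma congr_diag: "congr q x y \<Longrightarrow> congr q (diag a b x) (diag a b y)"
  by (simp add: congr_def diag_def cong_scalar_left)

lemma diag_congr: "[a = a'] (mod int q) \<Longrightarrow> [b = b'] (mod int q) \<Longrightarrow> congr q (diag a b x) (diag a' b' x)"
  by (simp add: congr_def diag_def cong_scalar_right)

lemma congr_add: "congr q x y \<Longrightarrow> congr q x' y' \<Longrightarrow> congr q (x + x') (y + y')"
  by (simp add: congr_def cong_add)

lemma congr_sym: "congr q x y \<Longrightarrow> congr q y x"
  by (simp add: congr_def cong_sym_eq)

locale setting = prim_root q \<xi> for q :: nat and \<xi> :: "'k::{alg_closed_field, field_char_0}" +
  fixes p n l :: nat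
  assumes p: "prime p" and q: "prime q" and pq: "p \<noteq> q" and qp: "[q = 1] (mod p)"
    and n1: "1 < n" and nq: "n \<le> q - 1" and np: "[n ^ p = 1] (mod q)" and lp: "l < p - 1"
begin

abbreviation G where "G \<equiv> G_grp p q n l"
abbreviation \<Gamma> where "\<Gamma> \<equiv> Gam p q n l"

text \<open>The matrix of conjugation by a^k on \<Gamma>. Being diagonal, it also describes the
  action on characters, with no transpose.\<close>

definition A :: "nat \<Rightarrow> int \<times> int \<Rightarrow> int \<times> int" where
  "A k = diag (int n ^ k) ((int n ^ l) ^ k)"

text \<open>Coordinates of elements and characters are taken in \<open>\<int>\<^sup>2\<close> and \<open>\<nat>\<close> instead of modulo \<open>q\<close> and \<open>p\<close>,
  which makes the group law additive; \<open>congr q\<close> is then the equality of coordinates.\<close>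

definition el :: "int \<times> int \<Rightarrow> nat \<Rightarrow> G_elt" where
  "el u k = ((fst u mod int q, snd u mod int q), int k mod int p)"

lemma p_pos: "p > 0" and p_gt1: "p > 1" and q_gt1: "q > 1"
  using p q prime_gt_0_nat prime_gt_1_nat by auto

lemma p_less_q: "p < q"
proof -
  have "p dvd q - 1" using qp q_gt1 by (metis cong_to_1_nat)
  then have "p \<le> q - 1" using q_gt1 by (intro dvd_imp_le) auto
  then show ?thesis using q_gt1 by simp
qed

lemma n_pow: "[int n ^ p = 1] (mod int q)"
  using np by (metis cong_int_iff of_nat_1 of_nat_power)

lemma A_0 [simp]: "A 0 x = x"
  by (simp add: A_def)

lemma A_A: "A i (A j x) = A (i + j) x"
  by (simp add: A_def diag_diag power_add)

lemma A_funpow: "(A (Suc 0) ^^ i) x = A i x"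
  by (induction i) (simp_all add: A_A)

lemma A_add: "A k (x + y) = A k x + A k y"
  by (simp add: A_def diag_add)

lemma A_congr: "congr q x y \<Longrightarrow> congr q (A k x) (A k y)"
  by (simp add: A_def congr_diag)

lemma A_mult_p: "congr q (A (i * p + j) x) (A j x)"
proof -
  have 1: "[(int n ^ e) ^ (i * p + j) = (int n ^ e) ^ j] (mod int q)" for e
  proof -
    have "[(int n ^ p) ^ (e * i) * (int n ^ e) ^ j = 1 ^ (e * i) * (int n ^ e) ^ j] (mod int q)"
      by (intro cong_mult cong_pow n_pow cong_refl)
    moreover have "(int n ^ p) ^ (e * i) * (int n ^ e) ^ j = (int n ^ e) ^ (i * p + j)"
      by (simp add: power_mult[symmetric] power_add[symmetric] algebra_simps)
    ultimately show ?thesis by simp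
  qed
  show ?thesis unfolding A_def using 1[of 1] 1[of l] by (intro diag_congr) auto
qed

lemma A_p: "congr q (A p x) x"
  using A_mult_p[of 1 0 x] by simp

lemma A_mod: "congr q (A (k mod p) x) (A k x)"
  using A_mult_p[of "k div p" "k mod p" x] by (simp add: congr_sym)

lemma el_eq_iff: "el u k = el v m \<longleftrightarrow> congr q u v \<and> [k = m] (mod p)"
  by (auto simp: el_def congr_def cong_def) (simp_all flip: zmod_int)

lemma carrier_G: "carrier G = ({0..<int q} \<times> {0..<int q}) \<times> {0..<int p}"
  using p_pos q_pos
  by (simp add: G_grp_def semidirect_product_def carrier_integer_mod_group DirProd_def)

lemma carrier_Gam: "carrier \<Gamma> = ({0..<int q} \<times> {0..<int q}) \<times> {0}"
  using q_pos by (simp add: Gam_def carrier_integer_mod_group DirProd_def)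

lemma el_closed [simp, intro]: "el u k \<in> carrier G"
  using p_pos q_pos by (simp add: carrier_G el_def)

lemma el_0_closed [simp, intro]: "el u 0 \<in> carrier \<Gamma>"
  using q_pos by (simp add: carrier_Gam el_def)

lemma G_cases:
  assumes "g \<in> carrier G" obtains u k where "k < p" "g = el u k"
proof -
  obtain i j f where g: "g = ((i, j), f)" by (metis surj_pair)
  show thesis
    by (rule that[of "nat f" "(i, j)"]) (use assms in \<open>auto simp: g carrier_G el_def\<close>)
qed

lemma Gam_cases:
  assumes "g \<in> carrier \<Gamma>" obtains u where "g = el u 0"
proof -
  obtain i j f where g: "g = ((i, j), f)" by (metis surj_pair)
  show thesis
    by (rule that[of "(i, j)"]) (use assms in \<open>auto simp: g carrier_Gam el_def\<close>)
qed

lemma el_mult [simp]: "el u i \<otimes>\<^bsub>G\<^esub> el v j = el (u + A i v) (i + j)"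
proof -
  \<comment> \<open>\<open>F_act\<close> sees the exponent already reduced modulo \<open>p\<close>;
    periodicity of the action then removes the reduction.\<close>
  have "el u i \<otimes>\<^bsub>G\<^esub> el v j = el (u + A (i mod p) v) (i + j)"
    by (simp add: G_grp_def semidirect_product_def DirProd_def el_def F_act_def A_def diag_def
        mod_simps zmod_int[symmetric]) (simp add: zmod_int mod_simps)
  also have "\<dots> = el (u + A i v) (i + j)"
    unfolding el_eq_iff by (intro conjI congr_add congr_refl A_mod cong_refl)
  finally show ?thesis .
qed

lemma one_G: "\<one>\<^bsub>G\<^esub> = el 0 0"
  by (simp add: G_grp_def semidirect_product_def DirProd_def el_def)

lemma group_G: "group G"
proof (rule groupI)
  fix x y assume "x \<in> carrier G" "y \<in> carrier G"
  then show "x \<otimes>\<^bsub>G\<^esub> y \<in> carrier G" by (auto elim!: G_cases)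
next
  fix x y z assume "x \<in> carrier G" "y \<in> carrier G" "z \<in> carrier G"
  then show "x \<otimes>\<^bsub>G\<^esub> y \<otimes>\<^bsub>G\<^esub> z = x \<otimes>\<^bsub>G\<^esub> (y \<otimes>\<^bsub>G\<^esub> z)"
    by (auto elim!: G_cases simp: A_add A_A add.assoc)
next
  fix x assume "x \<in> carrier G"
  then show "\<one>\<^bsub>G\<^esub> \<otimes>\<^bsub>G\<^esub> x = x" by (auto elim!: G_cases simp: one_G)
next
  fix x assume "x \<in> carrier G"
  then obtain u k where x: "k < p" "x = el u k" by (rule G_cases)
  have "el (- A (p - k) u) (p - k) \<otimes>\<^bsub>G\<^esub> x = \<one>\<^bsub>G\<^esub>"
    using x by (simp add: one_G el_eq_iff cong_def)
  then show "\<exists>y\<in>carrier G. y \<otimes>\<^bsub>G\<^esub> x = \<one>\<^bsub>G\<^esub>" by blast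
qed (simp add: one_G)

sublocale G: group G by (rule group_G)

lemma fin_group_G: "fin_group G"
  by unfold_locales (simp add: carrier_G)

sublocale G: fin_group G by (rule fin_group_G)

lemma subgroup_Gam: "subgroup (carrier \<Gamma>) G"
proof (rule G.subgroupI)
  show "carrier \<Gamma> \<subseteq> carrier G" using p_pos by (auto simp: carrier_Gam carrier_G)
  show "carrier \<Gamma> \<noteq> {}" by blast
next
  fix x y assume "x \<in> carrier \<Gamma>" "y \<in> carrier \<Gamma>"
  then show "x \<otimes>\<^bsub>G\<^esub> y \<in> carrier \<Gamma>" by (auto elim!: Gam_cases)
next
  fix x assume "x \<in> carrier \<Gamma>"
  then obtain u where u: "x = el u 0" by (rule Gam_cases)
  have "inv\<^bsub>G\<^esub> x = el (- u) 0" by (rule G.inv_equality) (simp_all add: u one_G)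
  then show "inv\<^bsub>G\<^esub> x \<in> carrier \<Gamma>" by simp
qed

lemma Gam_sub_G: "carrier \<Gamma> \<subseteq> carrier G"
  using subgroup_Gam by (rule subgroup.subset)

lemma fin_Gam [simp]: "finite (carrier \<Gamma>)" and card_Gam: "card (carrier \<Gamma>) = q * q"
  and card_G: "card (carrier G) = p * (q * q)"
  by (simp_all add: carrier_Gam carrier_G card_cartesian_product)

abbreviation "G2 \<equiv> G \<times>\<times> G"
abbreviation "G3 \<equiv> G \<times>\<times> (G \<times>\<times> G)"
abbreviation "\<Gamma>2 \<equiv> carrier \<Gamma> \<times> carrier \<Gamma>"
abbreviation "\<Gamma>3 \<equiv> carrier \<Gamma> \<times> (carrier \<Gamma> \<times> carrier \<Gamma>)"

lemma fin_group_G2: "fin_group G2" and fin_group_G3: "fin_group G3"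
  by (intro fin_group_DirProd fin_group_G)+

sublocale G2: fin_group G2 by (rule fin_group_G2)
sublocale G3: fin_group G3 by (rule fin_group_G3)

lemma subgroup_Gam2: "subgroup \<Gamma>2 G2" and subgroup_Gam3: "subgroup \<Gamma>3 G3"
  by (intro DirProd_subgroups subgroup_Gam G.is_group G2.is_group)+

text \<open>Defined on all of G by ignoring the exponent of \<open>a\<close>; multiplicativity is
  claimed on \<Gamma> only.\<close>

definition ch :: "int \<times> int \<Rightarrow> G_elt \<Rightarrow> 'k" where
  "ch x = (\<lambda>((i, j), k). \<xi> powi (fst x * i + snd x * j))"

lemma ch_el: "ch x (el u k) = \<xi> powi (fst x * fst u + snd x * snd u)"
  unfolding ch_def el_def prod.case
  by (rule root_powi_cong) (intro cong_add cong_mult; simp add: cong_def)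

lemma ch_nonzero [simp]: "ch x g \<noteq> 0"
  by (simp add: ch_def split: prod.split)

lemma ch_mult: "g \<in> carrier \<Gamma> \<Longrightarrow> h \<in> carrier \<Gamma> \<Longrightarrow> ch x (g \<otimes>\<^bsub>G\<^esub> h) = ch x g * ch x h"
  by (auto elim!: Gam_cases simp: ch_el power_int_add[symmetric] algebra_simps)

lemma ch_add: "ch (x + y) g = ch x g * ch y g"
  by (simp add: ch_def power_int_add[symmetric] algebra_simps split: prod.split)

lemma ch_0 [simp]: "ch 0 g = 1"
  by (simp add: ch_def split: prod.split)

lemma ch_minus: "ch (- x) g = inverse (ch x g)"
  using ch_add[of x "- x" g] by (simp add: field_simps)

lemma ch_congr: "congr q x y \<Longrightarrow> ch x g = ch y g"
  unfolding ch_def congr_def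
  by (auto split: prod.split intro!: root_powi_cong cong_add cong_mult)

lemma ch_one: "ch x (el 0 k) = 1"
  by (simp add: ch_el)

text \<open>On \<open>\<Gamma>\<close> this is the endomorphism \<open>s \<mapsto> s\<^sup>a\<close>, \<open>t \<mapsto> t\<^sup>b\<close>.\<close>

definition scl :: "int \<Rightarrow> int \<Rightarrow> G_elt \<Rightarrow> G_elt" where
  "scl a b = (\<lambda>((i, j), k). el (a * i, b * j) 0)"

lemma scl_el [simp]: "scl a b (el u k) = el (diag a b u) 0"
  unfolding scl_def diag_def
  by (simp add: el_def mod_simps)

lemma ch_scl: "ch x (scl a b g) = ch (diag a b x) g"
  by (simp add: scl_def ch_el split: prod.split) (simp add: ch_def diag_def mult_ac)

lemma scl_closed [simp]: "scl a b g \<in> carrier \<Gamma>"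
  by (simp add: scl_def split: prod.split)

section \<open>Fourier transform\<close>

text \<open>The value at \<open>v\<close> of the algebra map from k\<Gamma> to k that extends the
  character with coordinates \<open>x\<close>. Coefficients of \<open>v\<close> off \<Gamma> are not
  seen, so product and injectivity statements need a support condition.\<close>

definition hat :: "(G_elt \<Rightarrow> 'k) \<Rightarrow> int \<times> int \<Rightarrow> 'k" where
  "hat v x = form_ext (carrier \<Gamma>) (ch x) v"

definition hat2 :: "(G_elt \<times> G_elt \<Rightarrow> 'k) \<Rightarrow> int \<times> int \<Rightarrow> int \<times> int \<Rightarrow> 'k" where
  "hat2 v x y = form_ext \<Gamma>2 (\<lambda>(g, h). ch x g * ch y h) v"

definition hat3 :: "(G_elt \<times> G_elt \<times> G_elt \<Rightarrow> 'k) \<Rightarrow> int \<times> int \<Rightarrow> int \<times> int \<Rightarrow> int \<times> int \<Rightarrow> 'k" where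
  "hat3 v x y z = form_ext \<Gamma>3 (\<lambda>(g, h, k). ch x g * (ch y h * ch z k)) v"

lemma hat_congr: "congr q x y \<Longrightarrow> hat v x = hat v y"
  unfolding hat_def by (intro form_ext_cong ch_congr)

lemma hat2_congr: "congr q x x' \<Longrightarrow> congr q y y' \<Longrightarrow> hat2 v x y = hat2 v x' y'"
  unfolding hat2_def by (intro form_ext_cong) (auto simp: ch_congr[of x x'] ch_congr[of y y'])

lemma hat_times: "v \<in> vecs (carrier \<Gamma>) \<Longrightarrow> w \<in> vecs (carrier \<Gamma>) \<Longrightarrow>
    hat (G.times v w) x = hat v x * hat w x"
  unfolding hat_def
  by (rule form_ext_times_subgroup[OF fin_group_G subgroup_Gam]) (auto intro: ch_mult)

lemma hat2_times: "v \<in> vecs \<Gamma>2 \<Longrightarrow> w \<in> vecs \<Gamma>2 \<Longrightarrow> hat2 (G2.times v w) x y = hat2 v x y * hat2 w x y"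
  unfolding hat2_def
  by (rule form_ext_times_subgroup[OF fin_group_G2 subgroup_Gam2]) (auto simp: ch_mult)

lemma hat3_times: "v \<in> vecs \<Gamma>3 \<Longrightarrow> w \<in> vecs \<Gamma>3 \<Longrightarrow>
    hat3 (G3.times v w) x y z = hat3 v x y z * hat3 w x y z"
  unfolding hat3_def
  by (rule form_ext_times_subgroup[OF fin_group_G3 subgroup_Gam3]) (auto simp: ch_mult)

lemma hat_basis: "g \<in> carrier \<Gamma> \<Longrightarrow> hat (basis_vec g) x = ch x g"
  by (simp add: hat_def)

lemma hat2_basis: "g \<in> carrier \<Gamma> \<Longrightarrow> h \<in> carrier \<Gamma> \<Longrightarrow> hat2 (basis_vec (g, h)) x y = ch x g * ch y h"
  by (simp add: hat2_def)

lemma hat2_tens: "hat2 (tens v w) x y = hat v x * hat w y"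
  unfolding hat2_def hat_def by (rule form_ext_tens)

lemma hat2_alt: "hat2 v x y = hat (\<lambda>g. hat (\<lambda>h. v (g, h)) y) x"
  unfolding hat2_def hat_def form_ext_def
  by (simp add: sum.cartesian_product' sum_distrib_left mult_ac)

lemma hat3_alt: "hat3 v x y z = hat (\<lambda>g. hat2 (\<lambda>h. v (g, h)) y z) x"
  unfolding hat2_def hat3_def hat_def form_ext_def
  by (simp add: sum.cartesian_product' sum_distrib_left mult_ac)

abbreviation X :: "(int \<times> int) set" where "X \<equiv> {0..<int q} \<times> {0..<int q}"

lemma sum_ch: "(\<Sum>g\<in>carrier \<Gamma>. ch x g) = (if congr q x 0 then of_nat (q * q) else 0)"
proof -
  have "(\<Sum>g\<in>carrier \<Gamma>. ch x g) =
      (\<Sum>i\<in>{0..<int q}. \<xi> powi (fst x * i)) * (\<Sum>j\<in>{0..<int q}. \<xi> powi (snd x * j))"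
    by (simp add: carrier_Gam sum.cartesian_product' ch_def power_int_add sum_product)
  then show ?thesis by (auto simp: root_sum congr_def cong_0_iff)
qed

lemma sum_ch_dual:
  "(\<Sum>x\<in>X. ch x (el u 0)) = (if congr q u 0 then of_nat (q * q) else 0)"
proof -
  have "(\<Sum>x\<in>X. ch x (el u 0)) =
      (\<Sum>i\<in>{0..<int q}. \<xi> powi (fst u * i)) * (\<Sum>j\<in>{0..<int q}. \<xi> powi (snd u * j))"
    by (simp add: sum.cartesian_product' ch_el power_int_add sum_product mult.commute)
  then show ?thesis by (auto simp: root_sum congr_def cong_0_iff)
qed

lemma sum_ch_diff:
  assumes "g \<in> carrier \<Gamma>" "h \<in> carrier \<Gamma>"
  shows "(\<Sum>x\<in>X. ch x h * inverse (ch x g)) = (if h = g then of_nat (q * q) else 0)"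
proof -
  obtain u v where uv: "g = el u 0" "h = el v 0" using assms by (metis Gam_cases)
  have "(\<Sum>x\<in>X. ch x h * inverse (ch x g)) = (\<Sum>x\<in>X. ch x (el (v - u) 0))"
    by (intro sum.cong refl)
      (simp add: uv ch_el power_int_minus[symmetric] power_int_add[symmetric] algebra_simps)
  also have "\<dots> = (if congr q (v - u) 0 then of_nat (q * q) else 0)" by (rule sum_ch_dual)
  also have "congr q (v - u) 0 \<longleftrightarrow> h = g"
    by (simp add: uv el_eq_iff congr_def cong_diff_iff_cong_0)
  finally show ?thesis .
qed

lemma hat_inversion:
  assumes "g \<in> carrier \<Gamma>"
  shows "(\<Sum>x\<in>X. hat v x * inverse (ch x g)) = of_nat (q * q) * v g"
proof -
  have "(\<Sum>x\<in>X. hat v x * inverse (ch x g)) = (\<Sum>h\<in>carrier \<Gamma>. v h * (\<Sum>x\<in>X. ch x h * inverse (ch x g)))"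
    unfolding hat_def form_ext_def sum_distrib_right sum_distrib_left
    by (subst sum.swap) (simp add: mult.assoc)
  also have "\<dots> = (\<Sum>h\<in>carrier \<Gamma>. if h = g then of_nat (q * q) * v h else 0)"
    by (intro sum.cong refl) (simp add: sum_ch_diff assms)
  also have "\<dots> = of_nat (q * q) * v g" using assms by simp
  finally show ?thesis .
qed

text \<open>Free of a support condition, so that it applies to slices of functions of several
  variables, one variable at a time.\<close>

lemma hat_inj_pointwise:
  assumes "\<And>x. hat v x = hat w x" "g \<in> carrier \<Gamma>" shows "v g = w g"
  using hat_inversion[OF assms(2), of v] hat_inversion[OF assms(2), of w] q_pos
  by (simp add: assms(1))

lemma hat_inj:
  assumes "v \<in> vecs (carrier \<Gamma>)" "w \<in> vecs (carrier \<Gamma>)" "\<And>x. hat v x = hat w x"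
  shows "v = w"
proof
  fix g show "v g = w g"
    using hat_inj_pointwise[OF assms(3), of g] vecsD[OF assms(1), of g] vecsD[OF assms(2), of g]
    by (cases "g \<in> carrier \<Gamma>") simp_all
qed

lemma hat2_inj:
  assumes "v \<in> vecs \<Gamma>2" "w \<in> vecs \<Gamma>2" "\<And>x y. hat2 v x y = hat2 w x y"
  shows "v = w"
proof
  fix gh :: "G_elt \<times> G_elt"
  obtain g h where gh: "gh = (g, h)" by (cases gh)
  have "v (g, h) = w (g, h)" if gh: "g \<in> carrier \<Gamma>" "h \<in> carrier \<Gamma>"
  proof -
    have "hat (\<lambda>h. v (g, h)) y = hat (\<lambda>h. w (g, h)) y" for y
      by (rule hat_inj_pointwise[OF _ gh(1), of "\<lambda>g. hat (\<lambda>h. v (g, h)) y"])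
        (simp add: hat2_alt[symmetric] assms)
    then show ?thesis using hat_inj_pointwise[OF _ gh(2), of "\<lambda>h. v (g, h)" "\<lambda>h. w (g, h)"] by blast
  qed
  then show "v gh = w gh" using vecsD[OF assms(1), of gh] vecsD[OF assms(2), of gh]
    unfolding gh by (metis SigmaD1 SigmaD2)
qed

lemma hat3_inj:
  assumes "v \<in> vecs \<Gamma>3" "w \<in> vecs \<Gamma>3" "\<And>x y z. hat3 v x y z = hat3 w x y z"
  shows "v = w"
proof
  fix ghk :: "G_elt \<times> G_elt \<times> G_elt"
  obtain g h k where ghk: "ghk = (g, h, k)" by (metis surj_pair)
  have "v (g, h, k) = w (g, h, k)" if gh: "g \<in> carrier \<Gamma>"
  proof -
    have *: "hat2 (\<lambda>h. v (g, h)) y z = hat2 (\<lambda>h. w (g, h)) y z" for y z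
      by (rule hat_inj_pointwise[OF _ gh]) (simp add: hat3_alt[symmetric] assms)
    have "(\<lambda>h. v (g, h)) = (\<lambda>h. w (g, h))"
    proof (rule hat2_inj[OF _ _ *])
      show "(\<lambda>h. v (g, h)) \<in> vecs \<Gamma>2" by (rule vecsI, rule vecsD[OF assms(1)]) blast
      show "(\<lambda>h. w (g, h)) \<in> vecs \<Gamma>2" by (rule vecsI, rule vecsD[OF assms(2)]) blast
    qed
    then show ?thesis by metis
  qed
  then show "v ghk = w ghk" using vecsD[OF assms(1), of ghk] vecsD[OF assms(2), of ghk]
    unfolding ghk by (metis SigmaD1)
qed

text \<open>Fourier inversion supplies the vector. By orthogonality only the representative
  \<open>x'\<close> of \<open>x\<close> in the box \<open>X\<close> contributes, and periodicity of
  \<open>f\<close> identifies the two values.\<close>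

lemma hat_surj:
  assumes "\<And>x y. congr q x y \<Longrightarrow> f x = f y"
  obtains v where "v \<in> vecs (carrier \<Gamma>)" "\<And>x. hat v x = f x"
proof
  let ?v = "\<lambda>g. if g \<in> carrier \<Gamma> then (\<Sum>y\<in>X. f y * inverse (ch y g)) / of_nat (q * q) else 0"
  show "?v \<in> vecs (carrier \<Gamma>)" by (simp add: vecs_def)
  fix x
  define x' where "x' = (fst x mod int q, snd x mod int q)"
  have x': "x' \<in> X" "congr q x x'" using q_pos by (auto simp: x'_def congr_def cong_def)
  have c: "congr q (x - y) 0 \<longleftrightarrow> y = x'" if "y \<in> X" for y
    using that by (auto simp: x'_def congr_def cong_0_iff cong_iff_dvd_diff[symmetric] cong_def prod_eq_iff)
  have "hat ?v x = (\<Sum>g\<in>carrier \<Gamma>. \<Sum>y\<in>X. f y * ch (x - y) g) / of_nat (q * q)"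
  proof -
    have "ch (x - y) g = ch x g * inverse (ch y g)" for y g
      using ch_add[of x "- y" g] by (simp add: ch_minus)
    then show ?thesis
      by (simp add: hat_def form_ext_def sum_distrib_right sum_distrib_left sum_divide_distrib mult_ac)
  qed
  also have "\<dots> = (\<Sum>y\<in>X. f y * (\<Sum>g\<in>carrier \<Gamma>. ch (x - y) g)) / of_nat (q * q)"
    by (subst sum.swap) (simp add: sum_distrib_left)
  also have "(\<Sum>y\<in>X. f y * (\<Sum>g\<in>carrier \<Gamma>. ch (x - y) g)) = (\<Sum>y\<in>X. if y = x' then of_nat (q * q) * f y else 0)"
    by (intro sum.cong refl) (simp add: sum_ch c)
  also have "\<dots> = of_nat (q * q) * f x'" using x'(1) by (subst sum.delta) auto
  also have "f x' = f x" using assms x'(2) by metis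
  finally show "hat ?v x = f x" using q_pos by simp
qed

text \<open>Products are pointwise after the transform, hence commutative.\<close>

lemma times_commute:
  assumes "v \<in> vecs (carrier \<Gamma>)" "w \<in> vecs (carrier \<Gamma>)"
  shows "G.times v w = (G.times w v :: G_elt \<Rightarrow> 'k)"
  by (rule hat_inj) (use assms in \<open>auto simp: hat_times subgroup_times(1)[OF fin_group_G subgroup_Gam]\<close>)

lemma times2_commute:
  assumes "v \<in> vecs \<Gamma>2" "w \<in> vecs \<Gamma>2"
  shows "G2.times v w = (G2.times w v :: G_elt \<times> G_elt \<Rightarrow> 'k)"
  by (rule hat2_inj) (use assms in \<open>auto simp: hat2_times subgroup_times(1)[OF fin_group_G2 subgroup_Gam2]\<close>)

section \<open>Homomorphisms out of the group algebra\<close>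

definition sclv :: "int \<Rightarrow> int \<Rightarrow> (G_elt \<Rightarrow> 'k) \<Rightarrow> G_elt \<Rightarrow> 'k" where
  "sclv a b v = lin_ext (carrier \<Gamma>) (\<lambda>g. basis_vec (scl a b g)) v"

definition sclv2 :: "int \<Rightarrow> int \<Rightarrow> (G_elt \<times> G_elt \<Rightarrow> 'k) \<Rightarrow> G_elt \<times> G_elt \<Rightarrow> 'k" where
  "sclv2 a b v = lin_ext \<Gamma>2 (\<lambda>g. basis_vec (scl a b (fst g), scl a b (snd g))) v"

lemma sclv_vecs [simp]: "sclv a b v \<in> vecs (carrier \<Gamma>)"
  unfolding sclv_def by (rule lin_ext_in_vecs) simp

lemma sclv2_vecs [simp]: "sclv2 a b v \<in> vecs \<Gamma>2"
  unfolding sclv2_def by (rule lin_ext_in_vecs) simp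

lemma hat_sclv: "hat (sclv a b v) x = hat v (diag a b x)"
  unfolding hat_def sclv_def
  by (subst form_ext_lin_ext) (auto intro!: form_ext_cong simp: ch_scl)

lemma hat2_sclv2: "hat2 (sclv2 a b v) x y = hat2 v (diag a b x) (diag a b y)"
  unfolding hat2_def sclv2_def
  by (subst form_ext_lin_ext) (auto intro!: form_ext_cong simp: ch_scl)

abbreviation aa where "aa \<equiv> el 0 (Suc 0)"
abbreviation "Av2 \<equiv> sclv2 (int n) (int n ^ l)"

lemma a_elt: "a_elt = aa"
  using p_gt1 by (simp add: a_elt_def el_def)

lemma A_1: "A (Suc 0) = diag (int n) (int n ^ l)"
  by (simp add: A_def fun_eq_iff)

lemma A_zero [simp]: "A k 0 = 0"
  by (simp add: A_def)

lemma aa_scl: "z \<in> carrier \<Gamma> \<Longrightarrow> aa \<otimes>\<^bsub>G\<^esub> z = scl (int n) (int n ^ l) z \<otimes>\<^bsub>G\<^esub> aa"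
  by (auto elim!: Gam_cases simp: A_1)

lemma a_times2: "v \<in> vecs \<Gamma>2 \<Longrightarrow>
    G2.times (basis_vec (aa, aa)) v = G2.times (Av2 v) (basis_vec (aa, aa))"
  unfolding sclv2_def by (rule G2.conj_vec[OF subgroup_Gam2]) (auto simp: aa_scl)

lemma aa_pow: "aa [^]\<^bsub>G\<^esub> k = el 0 k"
  by (induction k) (simp_all add: one_G)

lemma aa_pow2: "(aa, aa) [^]\<^bsub>G2\<^esub> k = (el 0 k, el 0 k)"
  by (induction k) (simp_all add: one_G)

lemma twisted_power1:
  assumes "v \<in> vecs (carrier \<Gamma>)"
  obtains w where "w \<in> vecs (carrier \<Gamma>)"
    "G.times v (basis_vec aa) [^]\<^bsub>group_alg G\<^esub> (k::nat) = G.times w (basis_vec (el 0 k))"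
    "\<And>x. hat w x = (\<Prod>i<k. hat v (A i x))"
proof -
  have "\<exists>w\<in>vecs (carrier \<Gamma>). G.times v (basis_vec aa) [^]\<^bsub>group_alg G\<^esub> k =
      G.times w (basis_vec (aa [^]\<^bsub>G\<^esub> k)) \<and>
      (\<forall>x. form_ext (carrier \<Gamma>) (ch x) w = (\<Prod>i<k. form_ext (carrier \<Gamma>) (ch ((A (Suc 0) ^^ i) x)) v))"
    by (rule G.twisted_power[OF subgroup_Gam, where \<theta> = "scl (int n) (int n ^ l)"])
      (auto simp: aa_scl ch_mult ch_scl assms one_G ch_one A_1)
  then show thesis using that by (auto simp: aa_pow hat_def A_funpow)
qed

lemma twisted_power2:
  assumes "v \<in> vecs \<Gamma>2"
  obtains w where "w \<in> vecs \<Gamma>2"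
    "G2.times v (basis_vec (aa, aa)) [^]\<^bsub>group_alg G2\<^esub> (k::nat) = G2.times w (basis_vec (el 0 k, el 0 k))"
    "\<And>x y. hat2 w x y = (\<Prod>i<k. hat2 v (A i x) (A i y))"
proof -
  let ?\<chi> = "\<lambda>z (g, h). ch (fst z) g * ch (snd z) h"
  let ?\<tau> = "\<lambda>z. (A (Suc 0) (fst z), A (Suc 0) (snd z))"
  have \<tau>: "(?\<tau> ^^ i) z = (A i (fst z), A i (snd z))" for i z
    by (induction i) (simp_all add: A_A)
  have "\<exists>w\<in>vecs \<Gamma>2. G2.times v (basis_vec (aa, aa)) [^]\<^bsub>group_alg G2\<^esub> k =
      G2.times w (basis_vec ((aa, aa) [^]\<^bsub>G2\<^esub> k)) \<and>
      (\<forall>x. form_ext \<Gamma>2 (?\<chi> x) w = (\<Prod>i<k. form_ext \<Gamma>2 (?\<chi> ((?\<tau> ^^ i) x)) v))"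
    by (rule G2.twisted_power[OF subgroup_Gam2,
          where \<theta> = "\<lambda>g. (scl (int n) (int n ^ l) (fst g), scl (int n) (int n ^ l) (snd g))"])
      (auto simp: aa_scl ch_mult ch_scl assms one_G ch_one A_1)
  then obtain w where w: "w \<in> vecs \<Gamma>2" "G2.times v (basis_vec (aa, aa)) [^]\<^bsub>group_alg G2\<^esub> k =
      G2.times w (basis_vec ((aa, aa) [^]\<^bsub>G2\<^esub> k))"
    "\<And>x. form_ext \<Gamma>2 (?\<chi> x) w = (\<Prod>i<k. form_ext \<Gamma>2 (?\<chi> ((?\<tau> ^^ i) x)) v)" by blast
  show thesis
  proof (rule that[OF w(1)])
    show "G2.times v (basis_vec (aa, aa)) [^]\<^bsub>group_alg G2\<^esub> k = G2.times w (basis_vec (el 0 k, el 0 k))"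
      using w(2) by (simp add: aa_pow2)
    show "hat2 w x y = (\<Prod>i<k. hat2 v (A i x) (A i y))" for x y
      using w(3)[of "(x, y)"] unfolding \<tau> by (simp add: hat2_def)
  qed
qed

text \<open>\<Gamma> and \<open>a\<close> generate G. All identities between coproducts are checked
  on these two kinds of elements only.\<close>

lemma hom_eqI:
  assumes "fin_group K" "f \<in> hom G (group_alg K)" "g \<in> hom G (group_alg K)"
    and "\<And>u. f (el u 0) = g (el u 0)" "f aa = g aa" and "x \<in> carrier G"
  shows "f x = g x"
proof -
  have "f (el u k) = g (el u k)" for u k
  proof (induction k)
    case (Suc k)
    have "el u (Suc k) = el u k \<otimes>\<^bsub>G\<^esub> aa" by simp
    then show ?case using assms(2,3,5) Suc by (metis (no_types, lifting) el_closed hom_mult)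
  qed (rule assms(4))
  then show ?thesis using assms(6) by (metis G_cases)
qed

text \<open>The relations of the semidirect product have to hold for the images. The p-th power of
  \<open>v a\<close> is the norm of \<open>v\<close>, which is trivial by assumption; and
  \<open>v a\<close> conjugates the image of \<Gamma> as \<open>a\<close> does.\<close>

lemma hom_exists:
  assumes v: "v \<in> vecs (carrier \<Gamma>)" and norm: "\<And>x. (\<Prod>k<p. hat v (A k x)) = 1"
  obtains f where "f \<in> hom G (group_alg G)" "\<And>u. f (el u 0) = basis_vec (el (diag a b u) 0)"
    "f aa = G.times v (basis_vec aa)"
proof -
  interpret M: monoid "group_alg G :: (G_elt \<Rightarrow> 'k) monoid" by (rule G.monoid_group_alg)
  let ?W = "G.times v (basis_vec aa)"
  let ?b = "\<lambda>u. basis_vec (el u 0) :: G_elt \<Rightarrow> 'k"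
  define P where "P k = ?W [^]\<^bsub>group_alg G\<^esub> (k::nat)" for k
  have P0: "P 0 = basis_vec (el 0 0)" by (simp add: P_def one_G)
  have PV: "P k \<in> vecs (carrier G)" for k
    using M.nat_pow_closed[of ?W k] by (simp add: P_def)
  have P_add: "P (i + j) = G.times (P i) (P j)" for i j
    using M.nat_pow_mult[of ?W i j] by (simp add: P_def)
  have Pp: "P p = basis_vec (el 0 0)"
  proof -
    obtain w where w: "w \<in> vecs (carrier \<Gamma>)" "P p = G.times w (basis_vec (el 0 p))"
      "\<And>x. hat w x = (\<Prod>i<p. hat v (A i x))" unfolding P_def using twisted_power1[OF v, where k = p] by blast
    have "w = basis_vec (el 0 0)"
      by (rule hat_inj) (use w norm in \<open>auto simp: hat_basis ch_one\<close>)
    moreover have "el 0 p = el 0 0" by (simp add: el_eq_iff cong_def)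
    ultimately show ?thesis using w(2) by (simp add: G.basis_times_basis)
  qed
  have P_mult: "P (i * p) = basis_vec (el 0 0)" for i
    by (induction i) (simp_all add: P0 P_add Pp G.basis_times_basis)
  have P_mod: "P (k mod p) = P k" for k
    using P_add[of "k div p * p" "k mod p"] PV[of "k mod p"] P_mult by (simp flip: one_G)
  let ?R = "diag a b"
  \<comment> \<open>Conjugation by \<open>v\<close> drops out because k\<Gamma> is commutative, and
    diagonal matrices commute with the action of \<open>a\<close>.\<close>
  have WR: "G.times ?W (?b (?R u)) = G.times (?b (?R (A (Suc 0) u))) ?W" for u
  proof -
    have "G.times ?W (?b (?R u)) = G.times v (basis_vec (aa \<otimes>\<^bsub>G\<^esub> el (?R u) 0))"
      by (simp only: G.times_assoc G.basis_times_basis el_closed)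
    also have "aa \<otimes>\<^bsub>G\<^esub> el (?R u) 0 = el (?R (A (Suc 0) u)) 0 \<otimes>\<^bsub>G\<^esub> aa"
      by (simp add: A_1 diag_diag mult.commute)
    also have "G.times v (basis_vec \<dots>) = G.times (G.times v (?b (?R (A (Suc 0) u)))) (basis_vec aa)"
      by (simp only: G.times_assoc G.basis_times_basis el_closed)
    also have "G.times v (?b (?R (A (Suc 0) u))) = G.times (?b (?R (A (Suc 0) u))) v"
      by (rule times_commute) (simp_all add: v)
    finally show ?thesis by (simp only: G.times_assoc)
  qed
  have PR: "G.times (P k) (?b (?R u)) = G.times (?b (?R (A k u))) (P k)" for k u
  proof (induction k arbitrary: u)
    case 0 then show ?case by (simp add: P0 flip: one_G)
  next
    case (Suc k)
    have "G.times (P (Suc k)) (?b (?R u)) = G.times (P k) (G.times ?W (?b (?R u)))"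
      by (simp add: P_def G.times_assoc)
    also have "\<dots> = G.times (G.times (P k) (?b (?R (A (Suc 0) u)))) ?W" by (subst WR) (simp only: G.times_assoc)
    also have "\<dots> = G.times (?b (?R (A (Suc k) u))) (P (Suc k))"
      unfolding Suc by (simp add: P_def G.times_assoc A_A)
    finally show ?case .
  qed
  define f where "f g = G.times (basis_vec (scl a b g)) (P (nat (snd g)))" for g
  have f_el: "f (el u k) = G.times (?b (?R u)) (P k)" for u k
  proof -
    have "nat (snd (el u k)) = k mod p" by (simp add: el_def flip: zmod_int)
    then show ?thesis by (simp add: f_def P_mod)
  qed
  show thesis
  proof (rule that)
    show "f \<in> hom G (group_alg G)"
    proof (rule homI)
      fix x y assume "x \<in> carrier G" "y \<in> carrier G"
      then obtain u i v j where xy: "x = el u i" "y = el v j" by (metis G_cases)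
      have "G.times (f x) (f y) = G.times (?b (?R u)) (G.times (G.times (P i) (?b (?R v))) (P j))"
        by (simp only: xy f_el G.times_assoc)
      also have "\<dots> = G.times (G.times (?b (?R u)) (?b (?R (A i v)))) (G.times (P i) (P j))"
        unfolding PR by (simp only: G.times_assoc)
      also have "\<dots> = f (x \<otimes>\<^bsub>G\<^esub> y)"
        by (simp add: xy f_el P_add G.basis_times_basis diag_add)
      finally show "f (x \<otimes>\<^bsub>G\<^esub> y) = f x \<otimes>\<^bsub>group_alg G\<^esub> f y" by simp
    qed (simp add: f_def)
    show "f (el u 0) = ?b (?R u)" for u
      by (simp add: f_el P0 flip: one_G)
    show "f aa = ?W"
      using f_el[of 0 1] M.nat_pow_mult[of ?W 1 0] by (simp add: P_def flip: one_G)
  qed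
qed

lemma lin_ext_Gam:
  assumes "\<And>u. f (el u 0) = basis_vec (el (diag a b u) 0)" "v \<in> vecs (carrier \<Gamma>)"
  shows "lin_ext (carrier G) f v = sclv a b v"
  unfolding sclv_def lin_ext_mono[OF G.fin Gam_sub_G assms(2)]
  by (rule lin_ext_cong) (auto elim!: Gam_cases simp: assms(1))

lemma basis_vec_hom: "basis_vec \<in> hom G (group_alg G :: (G_elt \<Rightarrow> 'k) monoid)"
  by (rule homI) (simp_all add: G.basis_times_basis)

text \<open>The composite is an algebra map, so it suffices that it fixes \<Gamma> and
  \<open>a\<close>. It sends \<open>a\<close> to f(v') v a, and \<open>vv'\<close> says in
  transforms that f(v') v = 1.\<close>

lemma hom_inverse:
  assumes f: "f \<in> hom G (group_alg G)" "\<And>u. f (el u 0) = basis_vec (el (diag a b u) 0)"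
      "f aa = G.times v (basis_vec aa)"
    and f': "f' \<in> hom G (group_alg G)" "\<And>u. f' (el u 0) = basis_vec (el (diag a' b' u) 0)"
      "f' aa = G.times v' (basis_vec aa)"
    and v: "v \<in> vecs (carrier \<Gamma>)" "v' \<in> vecs (carrier \<Gamma>)"
    and inv: "[a * a' = 1] (mod int q)" "[b * b' = 1] (mod int q)"
    and vv': "\<And>x. hat v' (diag a b x) * hat v x = 1"
    and w: "w \<in> vecs (carrier G)"
  shows "lin_ext (carrier G) f (lin_ext (carrier G) f' w) = w"
proof -
  let ?C = "carrier G"
  have "lin_ext ?C f (f' x) = (basis_vec x :: G_elt \<Rightarrow> 'k)" if "x \<in> ?C" for x
  proof (rule hom_eqI[OF fin_group_G _ basis_vec_hom _ _ that])
    show "(\<lambda>x. lin_ext ?C f (f' x)) \<in> hom G (group_alg G)"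
      by (rule hom_lin_ext_comp[OF fin_group_G fin_group_G fin_group_G f'(1) f(1)])
    show "lin_ext ?C f (f' (el u 0)) = basis_vec (el u 0)" for u
    proof -
      have "congr q (diag (a * a') (b * b') u) (diag 1 1 u)" by (intro diag_congr inv)
      then show ?thesis by (simp add: f f' diag_diag basis_vec_inj el_eq_iff)
    qed
    have "G.times (sclv a b v') v = basis_vec (el 0 0)"
      by (rule hat_inj)
        (simp_all add: v hat_times hat_sclv hat_basis ch_one vv' subgroup_times(1)[OF fin_group_G subgroup_Gam])
    then show "lin_ext ?C f (f' aa) = basis_vec aa"
      by (simp add: f' lin_ext_times[OF fin_group_G fin_group_G f(1)] f(3) lin_ext_Gam[OF f(2) v(2)]
          flip: G.times_assoc one_G)
  qed
  then have "lin_ext ?C f (lin_ext ?C f' w) = lin_ext ?C basis_vec w"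
    unfolding lin_ext_lin_ext[OF G.fin G.fin] by (rule lin_ext_cong)
  then show ?thesis using lin_ext_basis_vec[OF G.fin w] by simp
qed

lemma hom_bij:
  assumes f: "f \<in> hom G (group_alg G)" "\<And>u. f (el u 0) = basis_vec (el (diag a b u) 0)"
      "f aa = G.times v (basis_vec aa)"
    and v: "v \<in> vecs (carrier \<Gamma>)" "\<And>x. (\<Prod>k<p. hat v (A k x)) = 1"
    and inv: "[a * a' = 1] (mod int q)" "[b * b' = 1] (mod int q)"
  shows "bij_betw (lin_ext (carrier G) f) (vecs (carrier G)) (vecs (carrier G))"
proof -
  have nz: "hat v x \<noteq> 0" for x
  proof
    assume "hat v x = 0"
    then have "(\<Prod>k<p. hat v (A k x)) = 0" using p_pos by (intro prod_zero) (auto intro!: bexI[of _ 0])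
    with v(2) show False by simp
  qed
  \<comment> \<open>The inverse map should send \<open>a\<close> to v' a with f(v') v = 1. In
    transforms this prescribes the value of \<open>hat v'\<close> at \<open>diag a b x\<close>,
    which is solved with the inverse matrix \<open>diag a' b'\<close>.\<close>
  obtain v' where v': "v' \<in> vecs (carrier \<Gamma>)" "\<And>x. hat v' x = inverse (hat v (diag a' b' x))"
    by (rule hat_surj[of "\<lambda>x. inverse (hat v (diag a' b' x))"])
      (metis hat_congr congr_diag, blast)
  have "(\<Prod>k<p. hat v' (A k x)) = 1" for x
  proof -
    have "diag a' b' (A k x) = A k (diag a' b' x)" for k by (simp add: A_def diag_diag mult.commute)
    then show ?thesis using v(2)[of "diag a' b' x"]
        prod_inversef[of "\<lambda>k. hat v (A k (diag a' b' x))" "{..<p}"] by (simp add: v'(2) o_def)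
  qed
  then obtain f' where f': "f' \<in> hom G (group_alg G)" "\<And>u. f' (el u 0) = basis_vec (el (diag a' b' u) 0)"
      "f' aa = G.times v' (basis_vec aa)" using hom_exists[OF v'(1)] by blast
  have "congr q (diag (a' * a) (b' * b) x) (diag 1 1 x)" for x
    using inv by (intro diag_congr) (simp_all add: mult.commute)
  then have "hat v (diag a' b' (diag a b x)) = hat v x" for x
    using hat_congr by (simp add: diag_diag)
  then have 1: "hat v' (diag a b x) * hat v x = 1" for x by (simp add: v'(2) nz)
  have 2: "hat v (diag a' b' x) * hat v' x = 1" for x by (simp add: v'(2) nz)
  have vecs: "lin_ext (carrier G) g w \<in> vecs (carrier G)" if "g \<in> hom G (group_alg G)" for g w
    using that by (intro lin_ext_in_vecs) (auto simp: hom_def)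
  show ?thesis
    by (rule bij_betw_byWitness[where f' = "lin_ext (carrier G) f'"])
      (use hom_inverse[OF f f' v(1) v'(1) inv 1] hom_inverse[OF f' f v'(1) v(1) _ _ 2] inv vecs[OF f(1)] vecs[OF f'(1)]
        in \<open>auto simp: mult.commute\<close>)
qed

section \<open>The cocycle element\<close>

text \<open>Restricted to \<Gamma> because the members of \<open>char_group\<close> are extensional
  functions.\<close>

definition chi :: "int \<times> int \<Rightarrow> G_elt \<Rightarrow> 'k" where
  "chi x = restrict (ch x) (carrier \<Gamma>)"

lemma mult_Gam [simp]: "monoid.mult \<Gamma> = monoid.mult G" and one_Gam [simp]: "\<one>\<^bsub>\<Gamma>\<^esub> = \<one>\<^bsub>G\<^esub>"
  by (simp_all add: Gam_def)

lemma chi_in: "chi x \<in> carrier (char_group \<Gamma>)"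
  using subgroup.m_closed[OF subgroup_Gam]
  by (auto simp: chi_def char_group_def field_units_def hom_def ch_mult)

lemma chi_add: "chi x \<otimes>\<^bsub>char_group \<Gamma>\<^esub> chi y = chi (x + y)"
  by (auto simp: chi_def char_group_def ch_add)

lemma chi_0: "chi 0 = \<one>\<^bsub>char_group \<Gamma>\<^esub>"
  by (auto simp: chi_def char_group_def)

lemma chi_congr: "congr q x y \<Longrightarrow> chi x = chi y"
  unfolding chi_def by (intro restrict_ext ch_congr)

lemma s_elt: "s_elt = el (1, 0) 0" and t_elt: "t_elt = el (0, 1) 0"
  using q_gt1 by (simp_all add: s_elt_def t_elt_def el_def)

lemma chi_coords: "has_coords \<xi> (chi x) x"
  by (simp add: has_coords_def s_elt t_elt chi_def ch_el)

lemma chi_eq_iff: "chi x = chi y \<longleftrightarrow> congr q x y"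
proof
  assume eq: "chi x = chi y"
  have "fst x * fst u + snd x * snd u - (fst y * fst u + snd y * snd u) = k \<Longrightarrow> int q dvd k" for u k
    using fun_cong[OF eq, of "el u 0"] root_powi_eq_1_iff[of k]
    by (auto simp: chi_def ch_el power_int_diff)
  from this[of "(1, 0)"] this[of "(0, 1)"] show "congr q x y"
    by (simp add: congr_def cong_iff_dvd_diff)
qed (rule chi_congr)

text \<open>A character is determined by its values at \<open>s\<close> and \<open>t\<close>; these
  are q-th roots of unity, hence powers of \<open>\<xi>\<close>.\<close>

lemma char_eq_chi:
  assumes "\<chi> \<in> carrier (char_group \<Gamma>)" obtains x where "x \<in> X" "\<chi> = chi x"
proof -
  have hom: "\<chi> (g \<otimes>\<^bsub>G\<^esub> h) = \<chi> g * \<chi> h" "\<chi> g \<noteq> 0" if "g \<in> carrier \<Gamma>" "h \<in> carrier \<Gamma>" for g h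
    using assms that by (auto simp: char_group_def field_units_def hom_def)
  have ext: "\<chi> \<in> extensional (carrier \<Gamma>)" using assms by (simp add: char_group_def)
  have add: "\<chi> (el (u + v) 0) = \<chi> (el u 0) * \<chi> (el v 0)" for u v
    using hom(1)[of "el u 0" "el v 0"] by simp
  have nz: "\<chi> (el u 0) \<noteq> 0" for u using hom(2)[of "el u 0" "el u 0"] by simp
  have s: "\<chi> (el (i, 0) 0) = \<chi> s_elt powi i" for i
    unfolding s_elt by (rule int_mult_hom[of "\<lambda>i. \<chi> (el (i, 0) 0)"])
      (use add[of "(_, 0)" "(_, 0)"] nz in auto)
  have t: "\<chi> (el (0, i) 0) = \<chi> t_elt powi i" for i
    unfolding t_elt by (rule int_mult_hom[of "\<lambda>i. \<chi> (el (0, i) 0)"])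
      (use add[of "(0, _)" "(0, _)"] nz in auto)
  have st: "\<chi> (el (i, j) 0) = \<chi> s_elt powi i * \<chi> t_elt powi j" for i j
    using add[of "(i, 0)" "(0, j)"] by (simp add: s t)
  have 0: "\<chi> (el (0, 0) 0) = 1" using st[of 0 0] by simp
  have "el (int q, 0) 0 = el (0, 0) 0" "el (0, int q) 0 = el (0, 0) 0" by (simp_all add: el_def)
  then have "\<chi> s_elt ^ q = 1" "\<chi> t_elt ^ q = 1" using s[of "int q"] t[of "int q"] 0 by simp_all
  then obtain a b where ab: "0 \<le> a" "a < int q" "\<chi> s_elt = \<xi> powi a" "0 \<le> b" "b < int q" "\<chi> t_elt = \<xi> powi b"
    by (meson root_of_unity_power)
  show thesis
  proof
    show "(a, b) \<in> X" using ab by simp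
    show "\<chi> = chi (a, b)"
    proof (rule extensionalityI[OF ext])
      show "chi (a, b) \<in> extensional (carrier \<Gamma>)" by (simp add: chi_def)
      fix g assume "g \<in> carrier \<Gamma>"
      then obtain u where u: "g = el u 0" by (rule Gam_cases)
      then show "\<chi> g = chi (a, b) g"
        using st[of "fst u" "snd u"] by (simp add: chi_def ch_el ab power_int_mult[symmetric] power_int_add)
    qed
  qed
qed

lemma carrier_char_group: "carrier (char_group \<Gamma>) = chi ` X"
  using char_eq_chi chi_in by blast

text \<open>The sign comes from the convention \<open>\<delta>\<^sub>x = \<Sum>\<^sub>g x(g) g / |\<Gamma>|\<close>, with \<open>x(g)\<close> instead of its inverse.\<close>

lemma hat_char_idem:
  assumes "\<chi> \<in> carrier (char_group \<Gamma>)"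
  shows "hat (char_idem \<Gamma> \<chi>) x = (if \<chi> = chi (- x) then 1 else 0)"
proof -
  obtain u where u: "\<chi> = chi u" using char_eq_chi[OF assms] by blast
  have "hat (char_idem \<Gamma> \<chi>) x = (\<Sum>g\<in>carrier \<Gamma>. ch (u + x) g) / of_nat (q * q)"
    unfolding hat_def form_ext_def sum_divide_distrib
    by (intro sum.cong refl) (simp add: u char_idem_def chi_def ch_add order_def card_Gam)
  moreover have "congr q (u + x) 0 \<longleftrightarrow> \<chi> = chi (- x)"
    by (simp add: u chi_eq_iff congr_def cong_iff_dvd_diff)
  ultimately show ?thesis using q_pos by (simp add: sum_ch)
qed

lemma cocycle_element_vecs: "cocycle_element \<Gamma> \<omega> \<in> vecs \<Gamma>2"
  by (rule vecsI) (auto simp: cocycle_element_def tens_def char_idem_def split: prod.split if_splits intro!: sum.neutral)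

text \<open>The transform of each \<open>char_idem\<close> is an indicator function, so exactly one
  term of the double sum survives.\<close>

lemma hat2_cocycle_element: "hat2 (cocycle_element \<Gamma> \<omega>) x y = \<omega> (chi (- x)) (chi (- y))"
proof -
  let ?C = "carrier (char_group \<Gamma> :: (G_elt \<Rightarrow> 'k) monoid)"
  have fin: "finite ?C" by (simp add: carrier_char_group)
  have "hat2 (cocycle_element \<Gamma> \<omega>) x y =
      (\<Sum>\<chi>\<in>?C. \<Sum>\<psi>\<in>?C. \<omega> \<chi> \<psi> * hat2 (tens (char_idem \<Gamma> \<chi>) (char_idem \<Gamma> \<psi>)) x y)"
    unfolding hat2_def form_ext_def cocycle_element_def sum_distrib_right sum_distrib_left
    by (subst sum.swap, rule sum.cong[OF refl], subst sum.swap) (simp add: mult.assoc)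
  also have "\<dots> = (\<Sum>\<chi>\<in>?C. \<Sum>\<psi>\<in>?C. if \<chi> = chi (- x) \<and> \<psi> = chi (- y) then \<omega> \<chi> \<psi> else 0)"
    by (intro sum.cong refl) (simp add: hat2_tens hat_char_idem)
  also have "\<dots> = (\<Sum>\<chi>\<in>?C. if \<chi> = chi (- x) then \<omega> \<chi> (chi (- y)) else 0)"
    using fin chi_in by (intro sum.cong refl) (auto simp: sum.delta)
  also have "\<dots> = \<omega> (chi (- x)) (chi (- y))" using fin chi_in by (simp add: sum.delta)
  finally show ?thesis .
qed

section \<open>Hopf cocycle identities under the transform\<close>

lemma vecs_Gam_G: "v \<in> vecs (carrier \<Gamma>) \<Longrightarrow> v \<in> vecs (carrier G)"
  using vecs_mono[OF Gam_sub_G] by blast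

lemma vecs_Gam2_G2: "v \<in> vecs \<Gamma>2 \<Longrightarrow> v \<in> vecs (carrier G \<times> carrier G)"
  using vecs_mono[of \<Gamma>2 "carrier G \<times> carrier G"] Gam_sub_G by auto

lemma vecs_Gam3_G3: "v \<in> vecs \<Gamma>3 \<Longrightarrow> v \<in> vecs (carrier G \<times> carrier G \<times> carrier G)"
  using vecs_mono[of \<Gamma>3 "carrier G \<times> carrier G \<times> carrier G"] Gam_sub_G by auto

lemma one_in_Gam [simp]: "\<one>\<^bsub>G\<^esub> \<in> carrier \<Gamma>"
  by (simp add: one_G)

lemma ch_one_G: "ch x \<one>\<^bsub>G\<^esub> = 1"
  by (simp add: one_G ch_one)

lemmas times_vecs = subgroup_times(1)[OF fin_group_G subgroup_Gam]
  subgroup_times(1)[OF fin_group_G2 subgroup_Gam2] subgroup_times(1)[OF fin_group_G3 subgroup_Gam3]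

text \<open>\<Delta> is diagonal on \<Gamma>, so \<Delta> \<otimes> id multiplies two characters
  evaluated at the same element, that is, adds their coordinates. This turns Hopf 2-cocycles in
  k\<Gamma> \<otimes> k\<Gamma> into group 2-cocycles. A general \<open>H\<close> allows use for
  both kG and \<B>.\<close>

lemma comul_Gam:
  assumes H: "hbasis H = carrier G" "\<And>g. g \<in> carrier \<Gamma> \<Longrightarrow> hcomul H g = basis_vec (g, g)"
    and t: "t \<in> vecs \<Gamma>2"
  shows "comul_id H t \<in> vecs \<Gamma>3" "hat3 (comul_id H t) x y z = hat2 t (x + y) z"
    and "id_comul H t \<in> vecs \<Gamma>3" "hat3 (id_comul H t) x y z = hat2 t x (y + z)"
proof -
  have 1: "comul_id H t = (\<lambda>(a, b, c). if a = b then t (a, c) else 0)"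
  proof -
    have "(\<Sum>g\<in>carrier G. t (g, c) * hcomul H g (a, b)) = (if a = b then t (a, c) else 0)" for a b c
    proof -
      have "(\<Sum>g\<in>carrier G. t (g, c) * hcomul H g (a, b)) = (\<Sum>g\<in>carrier \<Gamma>. t (g, c) * hcomul H g (a, b))"
        by (rule sum.mono_neutral_right) (use Gam_sub_G vecsD[OF t] in auto)
      also have "\<dots> = (\<Sum>g\<in>carrier \<Gamma>. if g = a then if a = b then t (a, c) else 0 else 0)"
        by (intro sum.cong refl) (auto simp: H(2) basis_vec_def)
      also have "\<dots> = (if a = b then t (a, c) else 0)"
        using vecsD[OF t, of "(a, c)"] by (cases "a \<in> carrier \<Gamma>") auto
      finally show ?thesis .
    qed
    then show ?thesis by (simp add: comul_id_def fun_eq_iff H(1))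
  qed
  have 2: "id_comul H t = (\<lambda>(a, b, c). if b = c then t (a, b) else 0)"
  proof -
    have "(\<Sum>g\<in>carrier G. t (a, g) * hcomul H g (b, c)) = (if b = c then t (a, b) else 0)" for a b c
    proof -
      have "(\<Sum>g\<in>carrier G. t (a, g) * hcomul H g (b, c)) = (\<Sum>g\<in>carrier \<Gamma>. t (a, g) * hcomul H g (b, c))"
        by (rule sum.mono_neutral_right) (use Gam_sub_G vecsD[OF t] in auto)
      also have "\<dots> = (\<Sum>g\<in>carrier \<Gamma>. if g = b then if b = c then t (a, b) else 0 else 0)"
        by (intro sum.cong refl) (auto simp: H(2) basis_vec_def)
      also have "\<dots> = (if b = c then t (a, b) else 0)"
        using vecsD[OF t, of "(a, b)"] by (cases "b \<in> carrier \<Gamma>") auto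
      finally show ?thesis .
    qed
    then show ?thesis by (simp add: id_comul_def fun_eq_iff H(1))
  qed
  have supp: "t (g, h) \<noteq> 0 \<Longrightarrow> g \<in> carrier \<Gamma> \<and> h \<in> carrier \<Gamma>" for g h
    using vecsD[OF t, of "(g, h)"] by blast
  show "comul_id H t \<in> vecs \<Gamma>3" unfolding 1
    by (intro vecsI) (auto dest!: supp split: prod.splits if_splits)
  show "id_comul H t \<in> vecs \<Gamma>3" unfolding 2
    by (intro vecsI) (auto dest!: supp split: prod.splits if_splits)
  have if0: "(if P then a else 0) * (b::'k) = (if P then a * b else 0)" for P a b by simp
  show "hat3 (comul_id H t) x y z = hat2 t (x + y) z"
    unfolding 1 hat3_def hat2_def form_ext_def
    by (simp add: sum.cartesian_product' if0 ch_add mult_ac cong: if_cong)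
      (rule sum.cong[OF refl], subst sum.swap, simp add: if_distrib[where f = "(*) _"] cong: if_cong)
  show "hat3 (id_comul H t) x y z = hat2 t x (y + z)"
    unfolding 2 hat3_def hat2_def form_ext_def
    by (simp add: sum.cartesian_product' if0 ch_add mult_ac if_distrib[where f = "(*) _"] cong: if_cong)
qed

text \<open>The counit is the trivial character, whose coordinates are 0; normalization of the Hopf
  cocycle becomes normalization of the group cocycle.\<close>

lemma counit_Gam:
  assumes H: "hbasis H = carrier G" "\<And>g. g \<in> carrier G \<Longrightarrow> hcounit H g = 1"
    and t: "t \<in> vecs \<Gamma>2"
  shows "counit_id H t \<in> vecs (carrier \<Gamma>)" "hat (counit_id H t) x = hat2 t 0 x"
    and "id_counit H t \<in> vecs (carrier \<Gamma>)" "hat (id_counit H t) x = hat2 t x 0"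
proof -
  have 1: "counit_id H t = (\<lambda>z. \<Sum>g\<in>carrier \<Gamma>. t (g, z))"
    unfolding counit_id_def H(1)
    by (intro ext sum.mono_neutral_cong_right) (use Gam_sub_G vecsD[OF t] H(2) in auto)
  have 2: "id_counit H t = (\<lambda>z. \<Sum>g\<in>carrier \<Gamma>. t (z, g))"
    unfolding id_counit_def H(1)
    by (intro ext sum.mono_neutral_cong_right) (use Gam_sub_G vecsD[OF t] H(2) in auto)
  show "counit_id H t \<in> vecs (carrier \<Gamma>)" "id_counit H t \<in> vecs (carrier \<Gamma>)"
    unfolding 1 2 by (rule vecsI, rule sum.neutral, use vecsD[OF t] in auto)+
  show "hat (counit_id H t) x = hat2 t 0 x"
    unfolding 1 hat_def hat2_def form_ext_def
    by (simp add: sum.cartesian_product' sum_distrib_right) (rule sum.swap)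
  show "hat (id_counit H t) x = hat2 t x 0"
    unfolding 2 hat_def hat2_def form_ext_def
    by (simp add: sum.cartesian_product' sum_distrib_right)
qed

lemma hat3_tens_one:
  assumes "t \<in> vecs \<Gamma>2"
  shows "(\<lambda>(x, y, z). tens t (basis_vec \<one>\<^bsub>G\<^esub>) ((x, y), z)) \<in> vecs \<Gamma>3"
    and "hat3 (\<lambda>(x, y, z). tens t (basis_vec \<one>\<^bsub>G\<^esub>) ((x, y), z)) x y z = hat2 t x y"
    and "tens (basis_vec \<one>\<^bsub>G\<^esub>) t \<in> vecs \<Gamma>3"
    and "hat3 (tens (basis_vec \<one>\<^bsub>G\<^esub>) t) x y z = hat2 t y z"
proof -
  note one = one_in_Gam
  have supp: "t (g, h) \<noteq> 0 \<Longrightarrow> g \<in> carrier \<Gamma> \<and> h \<in> carrier \<Gamma>" for g h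
    using vecsD[OF assms, of "(g, h)"] by blast
  show "(\<lambda>(x, y, z). tens t (basis_vec \<one>\<^bsub>G\<^esub>) ((x, y), z)) \<in> vecs \<Gamma>3"
    using one by (intro vecsI) (auto dest!: supp simp: tens_def basis_vec_def split: prod.splits if_splits)
  show "tens (basis_vec \<one>\<^bsub>G\<^esub>) t \<in> vecs \<Gamma>3"
    by (rule tens_in_vecs) (simp_all add: one assms)
  have 1: "hat3 v x y z = form_ext (\<Gamma>2 \<times> carrier \<Gamma>) (\<lambda>(gh, k). (\<lambda>(g, h). ch x g * ch y h) gh * ch z k)
      (\<lambda>((a, b), c). v (a, b, c))" for v
    by (simp add: hat3_def form_ext_def sum.cartesian_product' mult_ac)
  have "(\<lambda>((a, b), c). (case (a, b, c) of (x, y, z) \<Rightarrow> tens t (basis_vec \<one>\<^bsub>G\<^esub>) ((x, y), z))) =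
      tens t (basis_vec \<one>\<^bsub>G\<^esub>)" by auto
  then show "hat3 (\<lambda>(x, y, z). tens t (basis_vec \<one>\<^bsub>G\<^esub>) ((x, y), z)) x y z = hat2 t x y"
    unfolding 1 by (simp only: form_ext_tens) (simp add: hat2_def one ch_one_G)
  have "hat3 (tens (basis_vec \<one>\<^bsub>G\<^esub>) t) x y z =
      form_ext (carrier \<Gamma> \<times> \<Gamma>2) (\<lambda>(g, hk). ch x g * (\<lambda>(h, k). ch y h * ch z k) hk) (tens (basis_vec \<one>\<^bsub>G\<^esub>) t)"
    unfolding hat3_def by (rule form_ext_cong) auto
  then show "hat3 (tens (basis_vec \<one>\<^bsub>G\<^esub>) t) x y z = hat2 t y z"
    by (simp only: form_ext_tens) (simp add: hat2_def one ch_one_G)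
qed

lemma hat_one: "hat (basis_vec \<one>\<^bsub>G\<^esub>) x = 1" "hat2 (basis_vec (\<one>\<^bsub>G\<^esub>, \<one>\<^bsub>G\<^esub>)) x y = 1"
  by (simp_all add: one_G hat_basis hat2_basis ch_one)

text \<open>All vectors involved are supported on powers of \<Gamma>, where the transform is
  injective, so each identity may be checked pointwise.\<close>

lemma invertible_normalized_cocycle_Gam:
  assumes \<phi>: "\<phi> \<in> vecs \<Gamma>2" "\<phi>' \<in> vecs \<Gamma>2" "cocycle (hat2 \<phi>)"
    and inv: "\<And>x y. hat2 \<phi>' x y = inverse (hat2 \<phi> x y)"
  shows "is_inverse_in (group_hopf G2) \<phi> \<phi>'"
    and "invertible_normalized_cocycle (group_hopf G) \<phi>"
proof -
  note c = cocycleD[OF \<phi>(3)]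
  let ?H = "group_hopf G :: (G_elt, 'k) hopf"
  have 1: "G2.times \<phi> \<phi>' = basis_vec (\<one>\<^bsub>G\<^esub>, \<one>\<^bsub>G\<^esub>)" "G2.times \<phi>' \<phi> = basis_vec (\<one>\<^bsub>G\<^esub>, \<one>\<^bsub>G\<^esub>)"
    by (rule hat2_inj; simp add: times_vecs \<phi> hat2_times inv c hat_one; simp add: one_G)+
  then show I: "is_inverse_in (group_hopf G2) \<phi> \<phi>'"
    by (simp add: is_inverse_in_def vecs_Gam2_G2 \<phi>)
  note cm = comul_Gam[of ?H, OF _ _ \<phi>(1), simplified]
  note cu = counit_Gam[of ?H, OF _ _ \<phi>(1), simplified]
  note t = hat3_tens_one[OF \<phi>(1)]
  have "G3.times (\<lambda>(x, y, z). tens \<phi> (basis_vec \<one>\<^bsub>G\<^esub>) ((x, y), z)) (comul_id ?H \<phi>) =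
      G3.times (tens (basis_vec \<one>\<^bsub>G\<^esub>) \<phi>) (id_comul ?H \<phi>)"
    by (rule hat3_inj) (simp_all add: times_vecs t cm hat3_times c(2))
  moreover have "counit_id ?H \<phi> = basis_vec \<one>\<^bsub>G\<^esub>" "id_counit ?H \<phi> = basis_vec \<one>\<^bsub>G\<^esub>"
    by (rule hat_inj; simp add: cu hat_one c)+
  ultimately show "invertible_normalized_cocycle ?H \<phi>"
    using I by (auto simp: invertible_normalized_cocycle_def invertible_in_def)
qed

end

section \<open>The Hopf algebras with underlying algebra \<open>kG\<close>\<close>

locale B_setting = setting q \<xi> p n l for q :: nat and \<xi> :: "'k::{alg_closed_field, field_char_0}"
    and p n l :: nat +
  fixes B :: "(G_elt, 'k) hopf"
  assumes B: "is_B p q n l B"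
begin

lemma B_basis [simp]: "hbasis B = carrier G" and B_one [simp]: "hone B = basis_vec \<one>\<^bsub>G\<^esub>"
  and B_mul [simp]: "x \<in> carrier G \<Longrightarrow> y \<in> carrier G \<Longrightarrow> hmul B x y = basis_vec (x \<otimes>\<^bsub>G\<^esub> y)"
  and B_counit [simp]: "x \<in> carrier G \<Longrightarrow> hcounit B x = 1"
  and B_comul_Gam: "x \<in> carrier \<Gamma> \<Longrightarrow> hcomul B x = basis_vec (x, x)"
  and B_noncocomm: "\<not> cocommutative B" and B_bialgebra: "bialgebra B"
  using B by (auto simp: is_B_def Let_def hopf_algebra_def)

abbreviation "\<Delta> \<equiv> hcomul B"

lemma tensor_B: "times_in (tensor_alg B B) = G2.times"
  by (rule times_in_cong) (auto simp: tensor_alg_def tens_basis_vec)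

lemma comul_hom: "\<Delta> \<in> hom G (group_alg G2)"
proof (rule homI)
  fix x assume "x \<in> carrier G"
  then show "\<Delta> x \<in> carrier (group_alg G2)" using B_bialgebra by (simp add: bialgebra_def)
next
  fix x y assume xy: "x \<in> carrier G" "y \<in> carrier G"
  have "lin_ext (hbasis B) \<Delta> (hmul B x y) = times_in (tensor_alg B B) (\<Delta> x) (\<Delta> y)"
    using B_bialgebra xy unfolding bialgebra_def by simp
  then show "\<Delta> (x \<otimes>\<^bsub>G\<^esub> y) = \<Delta> x \<otimes>\<^bsub>group_alg G2\<^esub> \<Delta> y"
    using xy by (simp add: tensor_B)
qed

lemma comul_vecs: "x \<in> carrier G \<Longrightarrow> \<Delta> x \<in> vecs (carrier G \<times> carrier G)"
  using comul_hom by (auto simp: hom_def)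

lemma J_exists:
  "\<exists>J. J \<in> vecs \<Gamma>2 \<and> \<Delta> aa = G2.times J (basis_vec (aa, aa)) \<and> (\<forall>x y. hat2 J x y \<noteq> 0)"
proof -
  obtain J where J: "invertible_in (tensor_alg (group_hopf \<Gamma> :: (G_elt, 'k) hopf) (group_hopf \<Gamma>)) J"
    "\<Delta> aa = G2.times J (basis_vec (aa, aa))"
    using B by (auto simp: is_B_def Let_def a_elt)
  have GG: "\<Gamma> \<times>\<times> \<Gamma> = G2\<lparr>carrier := \<Gamma>2\<rparr>" by (simp add: DirProd_def)
  obtain J' where J': "J \<in> vecs \<Gamma>2" "J' \<in> vecs \<Gamma>2"
    "times_in (group_hopf (\<Gamma> \<times>\<times> \<Gamma>)) J J' = basis_vec (\<one>\<^bsub>G\<^esub>, \<one>\<^bsub>G\<^esub>)"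
    using J(1) by (auto simp: invertible_in_def is_inverse_in_def)
  then have "G2.times J J' = basis_vec (\<one>\<^bsub>G\<^esub>, \<one>\<^bsub>G\<^esub>)"
    using subgroup_times(3)[OF fin_group_G2 subgroup_Gam2 J'(1,2)] by (simp add: GG)
  then have "hat2 J x y * hat2 J' x y = 1" for x y
    using hat2_times[OF J'(1,2)] hat_one(2) by metis
  then have "hat2 J x y \<noteq> 0" for x y using mult_zero_left zero_neq_one by metis
  with J(2) J'(1) show ?thesis by blast
qed

definition J where "J = (SOME J. J \<in> vecs \<Gamma>2 \<and> \<Delta> aa = G2.times J (basis_vec (aa, aa)) \<and>
  (\<forall>x y. hat2 J x y \<noteq> 0))"

abbreviation "j \<equiv> hat2 J"

lemma J: "J \<in> vecs \<Gamma>2" "\<Delta> aa = G2.times J (basis_vec (aa, aa))" "j x y \<noteq> 0"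
proof -
  have "J \<in> vecs \<Gamma>2 \<and> \<Delta> aa = G2.times J (basis_vec (aa, aa)) \<and> (\<forall>x y. j x y \<noteq> 0)"
    unfolding J_def by (rule someI_ex[OF J_exists])
  then show "J \<in> vecs \<Gamma>2" "\<Delta> aa = G2.times J (basis_vec (aa, aa))" "j x y \<noteq> 0" by blast+
qed

text \<open>\<Delta>(u a^k) = (u \<otimes> u) (J (a \<otimes> a))^k for u in \<Gamma>; collecting
  the powers of a \<otimes> a on the right leaves \<open>w\<close>, whose transform is a partial
  norm of \<open>j\<close>.\<close>

lemma comul_el:
  obtains w where "w \<in> vecs \<Gamma>2" "\<And>x y. hat2 w x y = (\<Prod>i<k. j (A i x) (A i y))"
    "\<And>u. \<Delta> (el u k) = G2.times (basis_vec (el u 0, el u 0)) (G2.times w (basis_vec (el 0 k, el 0 k)))"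
proof -
  interpret M: monoid "group_alg G2 :: (_ \<Rightarrow> 'k) monoid" by (rule G2.monoid_group_alg)
  obtain w where w: "w \<in> vecs \<Gamma>2"
    "G2.times J (basis_vec (aa, aa)) [^]\<^bsub>group_alg G2\<^esub> k = G2.times w (basis_vec (el 0 k, el 0 k))"
    "\<And>x y. hat2 w x y = (\<Prod>i<k. j (A i x) (A i y))"
    by (rule twisted_power2[OF J(1), where k = k]) blast
  have pow: "\<Delta> (el 0 k) = \<Delta> aa [^]\<^bsub>group_alg G2\<^esub> k" for k
  proof (induction k)
    case 0 show ?case by (simp add: B_comul_Gam one_G)
  next
    case (Suc k)
    have "el 0 (Suc k) = el 0 k \<otimes>\<^bsub>G\<^esub> aa" by simp
    then show ?case using comul_hom Suc by (metis M.nat_pow_Suc el_closed hom_mult)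
  qed
  have "\<Delta> (el u k) = G2.times (basis_vec (el u 0, el u 0)) (G2.times w (basis_vec (el 0 k, el 0 k)))" for u
  proof -
    have "el u k = el u 0 \<otimes>\<^bsub>G\<^esub> el 0 k" by simp
    then have "\<Delta> (el u k) = G2.times (\<Delta> (el u 0)) (\<Delta> (el 0 k))"
      using comul_hom by (metis el_closed group_alg_simps(2) hom_mult)
    then show ?thesis by (simp add: B_comul_Gam pow[of k] J(2) w(2))
  qed
  then show thesis using that w by blast
qed

text \<open>a^p = 1 forces the p-th power of \<Delta>(a) to be 1 \<otimes> 1, and that power is the
  full norm of \<open>j\<close> on the transform side.\<close>

lemma j_norm: "(\<Prod>i<p. j (A i x) (A i y)) = 1"
proof -
  obtain w where w: "w \<in> vecs \<Gamma>2" "\<And>x y. hat2 w x y = (\<Prod>i<p. j (A i x) (A i y))"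
    "\<And>u. \<Delta> (el u p) = G2.times (basis_vec (el u 0, el u 0)) (G2.times w (basis_vec (el 0 p, el 0 p)))"
    using comul_el[where k = p] by blast
  have 0: "el 0 p = \<one>\<^bsub>G\<^esub>" by (simp add: one_G el_eq_iff cong_def)
  have "basis_vec (\<one>\<^bsub>G\<^esub>, \<one>\<^bsub>G\<^esub>) = w"
    using w(3)[of 0] G2.times_one[of w] vecs_Gam2_G2[OF w(1)]
    by (simp add: 0 B_comul_Gam flip: one_G)
  then show ?thesis using w(2) hat_one(2) by metis
qed

lemma lin_ext_comul_aa:
  assumes "fin_group K" "f \<in> hom G2 (group_alg K)"
  shows "lin_ext (carrier G2) f (\<Delta> aa) =
      times_in (group_hopf K) (lin_ext (carrier G2) f J) (f (aa, aa))"
proof -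
  have "lin_ext (carrier G2) f (basis_vec (aa, aa)) = f (aa, aa)"
    by (rule lin_ext_basis) auto
  then show ?thesis unfolding J(2) lin_ext_times[OF fin_group_G2 assms] by simp
qed

text \<open>Applying \<Delta> \<otimes> id to J (a \<otimes> a) gives (\<Delta> \<otimes> id)(J) (J
  \<otimes> 1) (a \<otimes> a \<otimes> a), and id \<otimes> \<Delta> gives the mirror image.
  Coassociativity at \<open>a\<close>, after cancelling the last factor, is the cocycle
  identity.\<close>

lemma comul_cocycle: "cocycle j"
proof -
  have aa: "\<Delta> aa \<in> vecs (carrier G \<times> carrier G)" by (rule comul_vecs) simp
  have JV: "J \<in> vecs (carrier G \<times> carrier G)" by (rule vecs_Gam2_G2[OF J(1)])
  have fG22: "fin_group (G2 \<times>\<times> G)" by (intro fin_group_DirProd fin_group_G2 fin_group_G)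
  let ?L = "\<lambda>(b, c). tens (\<Delta> b) (basis_vec c)" and ?R = "\<lambda>(b, c). tens (basis_vec b) (\<Delta> c)"
  have L: "?L \<in> hom G2 (group_alg (G2 \<times>\<times> G))" and R: "?R \<in> hom G2 (group_alg G3)"
    by (intro hom_tens fin_group_G fin_group_G2 comul_hom basis_vec_hom)+
  let ?a3 = "basis_vec (aa, aa, aa) :: _ \<Rightarrow> 'k"
  have coassoc: "comul_id B (\<Delta> aa) = id_comul B (\<Delta> aa)"
    using B_bialgebra by (simp add: bialgebra_def)
  have "comul_id B (\<Delta> aa) = (\<lambda>(x, y, z). times_in (group_hopf (G2 \<times>\<times> G))
      (lin_ext (carrier G2) ?L J) (tens (\<Delta> aa) (basis_vec aa)) ((x, y), z))"
    unfolding comul_id_eq[OF fin_group_G B_basis aa] lin_ext_comul_aa[OF fG22 L] by simp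
  also have "\<dots> = G3.times (comul_id B J) (\<lambda>(x, y, z). tens (\<Delta> aa) (basis_vec aa) ((x, y), z))"
    unfolding comul_id_eq[OF fin_group_G B_basis JV] by (rule times_group_hopf_assoc[symmetric])
  also have "tens (\<Delta> aa) (basis_vec aa) = times_in (group_hopf (G2 \<times>\<times> G))
      (tens J (basis_vec \<one>\<^bsub>G\<^esub>)) (tens (basis_vec (aa, aa)) (basis_vec aa))"
    unfolding times_group_hopf_tens[OF fin_group_G2 fin_group_G] by (simp add: J(2))
  also have "(\<lambda>(x, y, z). times_in (group_hopf (G2 \<times>\<times> G))
      (tens J (basis_vec \<one>\<^bsub>G\<^esub>)) (tens (basis_vec (aa, aa)) (basis_vec aa)) ((x, y), z)) =
      G3.times (\<lambda>(x, y, z). tens J (basis_vec \<one>\<^bsub>G\<^esub>) ((x, y), z))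
        (\<lambda>(x, y, z). tens (basis_vec (aa, aa)) (basis_vec aa) ((x, y), z))"
    by (rule times_group_hopf_assoc[symmetric])
  also have "(\<lambda>(x, y, z). tens (basis_vec (aa, aa)) (basis_vec aa) ((x, y), z)) = ?a3"
    unfolding tens_basis_vec by (auto simp: basis_vec_def)
  finally have l: "comul_id B (\<Delta> aa) =
      G3.times (G3.times (comul_id B J) (\<lambda>(x, y, z). tens J (basis_vec \<one>\<^bsub>G\<^esub>) ((x, y), z))) ?a3"
    by (simp only: G3.times_assoc)
  have "id_comul B (\<Delta> aa) = G3.times (id_comul B J) (tens (basis_vec aa) (\<Delta> aa))"
    unfolding id_comul_eq[OF fin_group_G B_basis aa] id_comul_eq[OF fin_group_G B_basis JV]
    unfolding lin_ext_comul_aa[OF fin_group_G3 R] by simp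
  also have "tens (basis_vec aa) (\<Delta> aa) = G3.times (tens (basis_vec \<one>\<^bsub>G\<^esub>) J) (tens (basis_vec aa) (basis_vec (aa, aa)))"
    unfolding times_group_hopf_tens[OF fin_group_G fin_group_G2] by (simp add: J(2))
  finally have r: "id_comul B (\<Delta> aa) = G3.times (G3.times (id_comul B J) (tens (basis_vec \<one>\<^bsub>G\<^esub>) J)) ?a3"
    by (simp only: G3.times_assoc tens_basis_vec)
  note cm = comul_Gam[OF B_basis B_comul_Gam J(1)] and t = hat3_tens_one[OF J(1)]
  have eq: "G3.times (comul_id B J) (\<lambda>(x, y, z). tens J (basis_vec \<one>\<^bsub>G\<^esub>) ((x, y), z)) =
      G3.times (id_comul B J) (tens (basis_vec \<one>\<^bsub>G\<^esub>) J)"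
    by (rule G3.times_basis_cancel[of _ _ "(aa, aa, aa)"])
      (use coassoc l r in \<open>simp_all add: vecs_Gam3_G3 times_vecs cm t\<close>)
  have "j (x + y) z * j x y = j x (y + z) * j y z" for x y z
    using arg_cong[OF eq, of "\<lambda>v. hat3 v x y z"] by (simp add: hat3_times cm t)
  moreover have "counit_id B J = basis_vec \<one>\<^bsub>G\<^esub>" "id_counit B J = basis_vec \<one>\<^bsub>G\<^esub>"
  proof -
    \<comment> \<open>\<epsilon> \<otimes> id and id \<otimes> \<epsilon> are algebra maps; applied
      to \<Delta>(a) = J (a \<otimes> a) they return \<open>a\<close>, which cancels.\<close>
    have h: "(\<lambda>(b, c). basis_vec c) \<in> hom G2 (group_alg G :: (G_elt \<Rightarrow> 'k) monoid)"
      "(\<lambda>(b, c). basis_vec b) \<in> hom G2 (group_alg G :: (G_elt \<Rightarrow> 'k) monoid)"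
      by (auto intro!: homI simp: G.basis_times_basis)
    have "counit_id B (\<Delta> aa) = basis_vec aa" "id_counit B (\<Delta> aa) = basis_vec aa"
      using B_bialgebra by (simp_all add: bialgebra_def)
    moreover have "counit_id B t = lin_ext (carrier G2) (\<lambda>(b, c). basis_vec c) t"
      "id_counit B t = lin_ext (carrier G2) (\<lambda>(b, c). basis_vec b) t"
      if "t \<in> vecs (carrier G \<times> carrier G)" for t
      using counit_id_eq[OF fin_group_G B_basis that] by simp_all
    ultimately have c: "G.times (counit_id B J) (basis_vec aa) = G.times (basis_vec \<one>\<^bsub>G\<^esub>) (basis_vec aa)"
      "G.times (id_counit B J) (basis_vec aa) = G.times (basis_vec \<one>\<^bsub>G\<^esub>) (basis_vec aa)"
      using lin_ext_comul_aa[OF fin_group_G h(1)] lin_ext_comul_aa[OF fin_group_G h(2)] aa JV by simp_all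
    note cu = counit_Gam[OF B_basis B_counit J(1)]
    show "counit_id B J = basis_vec \<one>\<^bsub>G\<^esub>"
      by (rule G.times_basis_cancel[OF _ _ _ c(1)]) (simp_all add: cu vecs_Gam_G)
    show "id_counit B J = basis_vec \<one>\<^bsub>G\<^esub>"
      by (rule G.times_basis_cancel[OF _ _ _ c(2)]) (simp_all add: cu vecs_Gam_G)
  qed
  then have "j 0 x = 1" "j x 0 = 1" for x
    using counit_Gam[OF B_basis B_counit J(1)] hat_one(1) by metis+
  ultimately show ?thesis by (simp add: cocycle_def J(3) mult.commute)
qed

text \<open>If \<open>j\<close> were symmetric, \<open>J\<close> and hence \<Delta>(a) would be
  invariant under the flip. As \<Delta> is fixed by its values on \<Gamma> and \<open>a\<close>, all
  of \<B> would be cocommutative.\<close>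

lemma j_not_symmetric: "\<not> (\<forall>x y. j x y = j y x)"
proof
  assume sym: "\<forall>x y. j x y = j y x"
  have "J \<circ> prod.swap = J"
  proof (rule hat2_inj)
    show "J \<circ> prod.swap \<in> vecs \<Gamma>2" using J(1) by (auto simp: vecs_def)
    have "hat2 (J \<circ> prod.swap) x y = hat2 J y x" for x y
      unfolding hat2_def form_ext_def sum.cartesian_product' by (subst sum.swap) (simp add: mult_ac)
    then show "hat2 (J \<circ> prod.swap) x y = hat2 J x y" for x y using sym by simp
  qed (rule J(1))
  moreover have "basis_vec (aa, aa) \<circ> prod.swap = (basis_vec (aa, aa) :: _ \<Rightarrow> 'k)"
    by (auto simp: basis_vec_def)
  ultimately have aa: "\<Delta> aa \<circ> prod.swap = \<Delta> aa"
    unfolding J(2) times_group_hopf_swap[symmetric] by simp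
  have "\<Delta> x \<circ> prod.swap = \<Delta> x" if "x \<in> carrier G" for x
  proof (rule hom_eqI[OF fin_group_G2 _ comul_hom _ _ that])
    show "(\<lambda>x. \<Delta> x \<circ> prod.swap) \<in> hom G (group_alg G2)"
    proof (rule homI)
      fix x assume "x \<in> carrier G"
      then show "\<Delta> x \<circ> prod.swap \<in> carrier (group_alg G2)" using comul_vecs[of x] by (auto simp: vecs_def)
    next
      fix x y assume "x \<in> carrier G" "y \<in> carrier G"
      then have "\<Delta> (x \<otimes>\<^bsub>G\<^esub> y) = G2.times (\<Delta> x) (\<Delta> y)" using comul_hom by (auto simp: hom_def)
      then show "\<Delta> (x \<otimes>\<^bsub>G\<^esub> y) \<circ> prod.swap =
          (\<Delta> x \<circ> prod.swap) \<otimes>\<^bsub>group_alg G2\<^esub> (\<Delta> y \<circ> prod.swap)"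
        by (simp add: times_group_hopf_swap)
    qed
    show "\<Delta> (el u 0) \<circ> prod.swap = \<Delta> (el u 0)" for u
      by (auto simp: B_comul_Gam basis_vec_def)
  qed (rule aa)
  then have "cocommutative B" unfolding cocommutative_def by (metis B_basis comp_apply swap_simp)
  with B_noncocomm show False ..
qed

text \<open>Since (q, 0) is congruent to 0, the value of the alternating form on the standard basis
  is a q-th root of unity. Its exponent \<open>c\<close> is nonzero modulo \<open>q\<close>, for
  otherwise \<open>j\<close> would be symmetric.\<close>

lemma j_alt: obtains c where "\<not> int q dvd c" "\<And>x y. alt j x y = \<xi> powi (c * det2 x y)"
proof -
  let ?e = "alt j (1, 0) (0, 1)"
  have "alt j (int q, 0) (0, 1) = alt j 0 (0, 1)"
  proof -
    have "congr q (int q, 0) 0" by (simp add: congr_def cong_def)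
    then have "j (int q, 0) (0, 1) = j 0 (0, 1)" "j (0, 1) (int q, 0) = j (0, 1) 0"
      using hat2_congr congr_refl by blast+
    then show ?thesis by (simp add: alt_def)
  qed
  also have "\<dots> = 1" by (simp add: alt_def cocycleD[OF comul_cocycle])
  also have "alt j (int q, 0) (0, 1) = ?e ^ q" by (subst alt_det[OF comul_cocycle]) (simp add: det2_def)
  finally have "?e ^ q = 1" .
  then obtain c where c: "?e = \<xi> powi c" by (rule root_of_unity_power)
  have alt: "alt j x y = \<xi> powi (c * det2 x y)" for x y
    by (subst alt_det[OF comul_cocycle]) (simp add: c power_int_mult)
  moreover have "\<not> int q dvd c"
  proof
    assume "int q dvd c"
    then have "alt j x y = 1" for x y by (simp add: alt root_powi_eq_1_iff)
    then have "j x y = j y x" for x y using J(3) by (simp add: alt_def)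
    then show False using j_not_symmetric by blast
  qed
  ultimately show thesis using that by blast
qed

end

section \<open>The isomorphism\<close>

lemma det2_diag: "det2 (diag a b x) (diag a b y) = a * b * det2 x y"
  by (simp add: det2_def diag_def algebra_simps)

context setting
begin

text \<open>The order of \<open>n\<close> modulo \<open>q\<close> is exactly \<open>p\<close>: an
  exponent prime to \<open>p\<close> would, by Bezout, give n = 1 modulo q, contrary to 1 < n <
  q.\<close>

lemma n_pow_cong_1: "[int n ^ m = 1] (mod int q) \<Longrightarrow> p dvd m"
proof (rule ccontr)
  assume m: "[int n ^ m = 1] (mod int q)" and "\<not> p dvd m"
  then have "coprime m p" using p by (metis coprime_commute prime_imp_coprime)
  moreover have "m \<noteq> 0" using \<open>\<not> p dvd m\<close> by (metis dvd_0_right)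
  ultimately obtain a b where ab: "m * a = p * b + 1" by (metis bezout_nat coprime_iff_gcd_eq_1)
  have "[int n = (int n ^ p) ^ b * int n] (mod int q)"
    using cong_mult[OF cong_pow[OF n_pow, of b] cong_refl[of "int n"]] by (simp add: cong_sym_eq)
  also have "(int n ^ p) ^ b * int n = (int n ^ m) ^ a" using ab by (simp flip: power_mult power_Suc2)
  also have "[(int n ^ m) ^ a = 1] (mod int q)" using cong_pow[OF m, of a] by simp
  finally have "[n = 1] (mod q)" by (simp flip: cong_int_iff)
  then show False using n1 nq q_gt1 by (auto simp: cong_def)
qed

text \<open>\<open>n * n^l\<close> is the determinant of the action of \<open>a\<close>, the factor
  by which \<open>det2\<close> scales. Its k-th power is n^((l + 1) k), and the prime
  \<open>p\<close> exceeds both \<open>l + 1\<close> and \<open>k\<close>. The case k = 1 serves the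
  isomorphism, general \<open>k\<close> the grouplike elements.\<close>

lemma det_scale_pow: "0 < k \<Longrightarrow> k < p \<Longrightarrow> \<not> [(int n * int n ^ l) ^ k = 1] (mod int q)"
proof
  assume k: "0 < k" "k < p" and "[(int n * int n ^ l) ^ k = 1] (mod int q)"
  moreover have "int n ^ ((l + 1) * k) = (int n * int n ^ l) ^ k" by (subst power_mult) simp
  ultimately have "[int n ^ ((l + 1) * k) = 1] (mod int q)" by simp
  then have "p dvd (l + 1) * k" by (rule n_pow_cong_1)
  then have "p dvd l + 1 \<or> p dvd k" using p prime_dvd_mult_nat by blast
  then show False using k lp by (auto dest: dvd_imp_le)
qed

lemma coprime_q: "\<not> int q dvd a \<Longrightarrow> coprime a (int q)"
  using q by (metis coprime_commute prime_imp_coprime prime_nat_int_transfer)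

lemma A_prod_shift:
  assumes "\<And>x y. congr q x y \<Longrightarrow> f x = f y" "\<And>x. f x \<noteq> (0::'k)"
  shows "(\<Prod>k<p. f (A k (A 1 x))) = (\<Prod>k<p. f (A k x))"
proof -
  have "f x * (\<Prod>k<p. f (A (Suc k) x)) = (\<Prod>k<p. f (A k x)) * f (A p x)"
    using prod.lessThan_Suc_shift[of "\<lambda>k. f (A k x)" p] by simp
  moreover have "f (A p x) = f x" using assms(1) A_p by blast
  ultimately show ?thesis using assms(2)[of x] by (simp add: A_A)
qed

text \<open>The norm \<open>\<mu>\<close> of a splitting \<open>\<nu>\<^sub>0\<close> along the action of \<open>a\<close> is an invariant character, so it is
  itself the norm of \<open>\<mu>\<^bsup>1/p\<^esup>\<close>; dividing by that makes the norm trivial.\<close>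

lemma normalized_splitting:
  assumes \<sigma>: "cocycle \<sigma>" "\<And>x y. \<sigma> x y = \<sigma> y x"
    and per: "\<And>x y y'. congr q y y' \<Longrightarrow> \<sigma> x y = \<sigma> x y'"
    and norm: "\<And>x y. (\<Prod>k<p. \<sigma> (A k x) (A k y)) = 1"
  obtains \<nu> :: "int \<times> int \<Rightarrow> 'k" where "\<And>x. \<nu> x \<noteq> 0" "\<And>x y. \<nu> x * \<nu> y = \<sigma> x y * \<nu> (x + y)"
    "\<And>x y. congr q x y \<Longrightarrow> \<nu> x = \<nu> y" "\<And>x. (\<Prod>k<p. \<nu> (A k x)) = 1"
proof -
  obtain \<nu>0 where nz: "\<And>x. \<nu>0 x \<noteq> 0" and split: "\<And>x y. \<nu>0 x * \<nu>0 y = \<sigma> x y * \<nu>0 (x + y)"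
    and nu_per: "\<And>x y. congr q x y \<Longrightarrow> \<nu>0 x = \<nu>0 y"
    using periodic_symmetric_cocycle_splits[OF \<sigma> q_pos per] by blast
  define \<mu> where "\<mu> x = (\<Prod>k<p. \<nu>0 (A k x))" for x
  have \<mu>nz: "\<mu> x \<noteq> 0" for x by (simp add: \<mu>_def nz)
  \<comment> \<open>The coboundary of \<open>\<mu>\<close> is the norm of \<open>\<sigma>\<close>,
    which is trivial.\<close>
  have \<mu>add: "\<mu> x * \<mu> y = \<mu> (x + y)" for x y
  proof -
    have "\<mu> x * \<mu> y = (\<Prod>k<p. \<sigma> (A k x) (A k y)) * \<mu> (x + y)"
      unfolding \<mu>_def A_add by (simp only: prod.distrib[symmetric] split)
    then show ?thesis by (simp add: norm)
  qed
  have \<mu>per: "congr q x y \<Longrightarrow> \<mu> x = \<mu> y" for x y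
    unfolding \<mu>_def by (intro prod.cong refl nu_per A_congr)
  have \<mu>A: "\<mu> (A k x) = \<mu> x" for k x
  proof (induction k)
    case (Suc k)
    have "\<mu> (A (Suc k) x) = \<mu> (A 1 (A k x))" by (simp add: A_A)
    also have "\<dots> = \<mu> (A k x)" unfolding \<mu>_def by (rule A_prod_shift[OF nu_per nz])
    finally show ?case using Suc by simp
  qed simp
  have \<mu>0: "\<mu> 0 = 1" using \<mu>add[of 0 0] \<mu>nz[of 0] by simp
  have \<mu>pow: "\<mu> x ^ k = \<mu> (diag (int k) (int k) x)" for x k
  proof (induction k)
    case 0 then show ?case by (simp add: \<mu>0 diag_def flip: zero_prod_def)
  next
    case (Suc k)
    have "diag (int (Suc k)) (int (Suc k)) x = x + diag (int k) (int k) x"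
      by (simp add: diag_def prod_eq_iff algebra_simps)
    then show ?case using Suc by (simp add: \<mu>add)
  qed
  have \<mu>q: "\<mu> x ^ q = 1" for x
  proof -
    have "congr q (diag (int q) (int q) x) 0" by (simp add: congr_def diag_def cong_0_iff)
    then show ?thesis using \<mu>per \<mu>pow \<mu>0 by metis
  qed
  have "\<not> q dvd p" using p q pq by (metis primes_dvd_imp_eq)
  then have "coprime p q" using q by (metis coprime_commute prime_imp_coprime)
  then obtain b where "[p * b = 1] (mod q)" by (metis One_nat_def cong_solve_coprime_nat)
  then have "[p * b * (q - 1) + 1 = 1 * (q - 1) + 1] (mod q)"
    by (intro cong_add cong_mult cong_refl)
  then have "q dvd p * (b * (q - 1)) + 1"
    using q_gt1 by (simp add: mult.assoc cong_0_iff cong_def mod_0_imp_dvd)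
  then obtain m where m: "p * (b * (q - 1)) + 1 = q * m" by (metis dvd_def)
  \<comment> \<open>Modulo \<open>q\<close> this is -1/p, with \<open>q - 1\<close> standing for -1
    so that exponents remain natural numbers. As \<open>\<mu>\<close> takes values in q-th roots of
    unity, \<open>\<mu>^e\<close> is the reciprocal of the required p-th root.\<close>
  define e where "e = b * (q - 1)"
  show thesis
  proof (rule that[of "\<lambda>x. \<nu>0 x * \<mu> x ^ e"])
    fix x y
    show "\<nu>0 x * \<mu> x ^ e \<noteq> 0" using nz \<mu>nz by simp
    show "\<nu>0 x * \<mu> x ^ e * (\<nu>0 y * \<mu> y ^ e) = \<sigma> x y * (\<nu>0 (x + y) * \<mu> (x + y) ^ e)"
      using split[of x y] by (simp add: \<mu>add[symmetric] power_mult_distrib mult_ac)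
    show "congr q x y \<Longrightarrow> \<nu>0 x * \<mu> x ^ e = \<nu>0 y * \<mu> y ^ e" using nu_per \<mu>per by metis
    have "(\<Prod>k<p. \<nu>0 (A k x) * \<mu> (A k x) ^ e) = \<mu> x * (\<mu> x ^ e) ^ p"
      by (simp add: \<mu>A prod.distrib) (simp add: \<mu>_def)
    also have "\<dots> = \<mu> x ^ (p * e + 1)" by (simp add: power_mult[symmetric] mult.commute)
    also have "p * e + 1 = q * m" unfolding e_def by (rule m)
    also have "\<mu> x ^ (q * m) = (\<mu> x ^ q) ^ m" by (rule power_mult)
    also have "\<dots> = 1" by (simp add: \<mu>q)
    finally show "(\<Prod>k<p. \<nu>0 (A k x) * \<mu> (A k x) ^ e) = 1" .
  qed
qed

end

context B_setting
begin

text \<open>For a map sending \<open>a\<close> to \<open>v a\<close> and scaling \<Gamma> by R,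
  comparing the coproducts of \<open>a\<close> on the transform side gives \<nu>(x + y) w(x, y) /
  w(Ax, Ay) = j(Rx, Ry) \<nu>(x) \<nu>(y). Thus \<open>\<sigma>\<close> below has to be the
  coboundary of \<open>\<nu>\<close>.\<close>

lemma iso_deform:
  assumes \<phi>: "\<phi> \<in> vecs \<Gamma>2" "\<phi>' \<in> vecs \<Gamma>2" "cocycle (hat2 \<phi>)"
    and inv: "\<And>x y. hat2 \<phi>' x y = inverse (hat2 \<phi> x y)"
    and alt\<phi>: "\<And>x y. alt (hat2 \<phi>) x y = \<xi> powi det2 x y"
  shows "B \<simeq>\<^sub>H deform (group_hopf G) \<phi>"
proof -
  let ?w = "hat2 \<phi>"
  let ?C = "carrier G"
  let ?N = "int n * int n ^ l"
  note w = cocycleD[OF \<phi>(3)]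
  note j = comul_cocycle
  obtain c where c: "\<not> int q dvd c" and altj: "\<And>x y. alt j x y = \<xi> powi (c * det2 x y)"
    using j_alt by blast
  have N: "\<not> int q dvd 1 - ?N"
    using det_scale_pow[of 1] p_gt1 by (simp add: cong_iff_dvd_diff dvd_diff_commute)
  obtain c' where c': "[c * c' = 1] (mod int q)" using cong_solve_coprime_int[OF coprime_q[OF c]] by blast
  obtain N' where N': "[(1 - ?N) * N' = 1] (mod int q)" using cong_solve_coprime_int[OF coprime_q[OF N]] by blast
  \<comment> \<open>\<open>r\<close> solves c r = 1 - N modulo q, matching the two alternating
    forms; its inverse \<open>r'\<close> makes the scaling bijective, which is why 1 - N must be a
    unit.\<close>
  define r where "r = c' * (1 - ?N)"
  define r' where "r' = c * N'"
  have rr': "[r * r' = 1] (mod int q)"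
    using cong_mult[OF c' N'] by (simp add: r_def r'_def mult_ac)
  have cr: "[c * r = 1 - ?N] (mod int q)"
    using cong_mult[OF c' cong_refl[of "1 - ?N"]] by (simp add: r_def mult.assoc)
  let ?R = "diag r 1"
  define \<sigma> where "\<sigma> x y = ?w x y * inverse (?w (A 1 x) (A 1 y)) * inverse (j (?R x) (?R y))" for x y
  have \<sigma>: "cocycle \<sigma>"
  proof -
    have 1: "cocycle (\<lambda>x y. ?w (A 1 x) (A 1 y))" by (rule cocycle_comp[OF \<phi>(3) A_add])
    have 2: "cocycle (\<lambda>x y. j (?R x) (?R y))" by (rule cocycle_comp[OF j diag_add])
    have "\<sigma> = (\<lambda>x y. ?w x y * inverse (?w (A 1 x) (A 1 y)) * inverse (j (?R x) (?R y)))"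
      by (intro ext) (rule \<sigma>_def)
    then show ?thesis
      using cocycle_mult[OF cocycle_mult[OF \<phi>(3) cocycle_inverse[OF 1]] cocycle_inverse[OF 2]] by simp
  qed
  have "alt \<sigma> x y = 1" for x y
  proof -
    have "alt \<sigma> x y = alt ?w x y * inverse (alt ?w (A 1 x) (A 1 y)) * inverse (alt j (?R x) (?R y))"
      by (simp add: alt_def \<sigma>_def field_simps)
    also have "\<dots> = \<xi> powi (det2 x y + - (?N * det2 x y) + - (c * (r * det2 x y)))"
      by (simp add: alt\<phi> altj A_1 det2_diag power_int_diff divide_inverse)
    also have "\<dots> = 1"
    proof -
      have "[c * r * det2 x y = (1 - ?N) * det2 x y] (mod int q)" by (intro cong_mult cr cong_refl)
      then have "int q dvd (1 - ?N) * det2 x y - c * r * det2 x y"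
        by (simp add: cong_iff_dvd_diff dvd_diff_commute)
      then show ?thesis by (simp add: root_powi_eq_1_iff algebra_simps)
    qed
    finally show ?thesis .
  qed
  then have sym: "\<sigma> x y = \<sigma> y x" for x y
    using cocycleD(1)[OF \<sigma>] by (simp add: alt_def)
  have per: "\<sigma> x y = \<sigma> x y'" if "congr q y y'" for x y y'
  proof -
    have "?w x y = ?w x y'" by (rule hat2_congr[OF congr_refl that])
    moreover have "?w (A 1 x) (A 1 y) = ?w (A 1 x) (A 1 y')"
      by (rule hat2_congr[OF congr_refl A_congr[OF that]])
    moreover have "j (?R x) (?R y) = j (?R x) (?R y')"
      by (rule hat2_congr[OF congr_refl congr_diag[OF that]])
    ultimately show ?thesis by (simp only: \<sigma>_def)
  qed
  \<comment> \<open>The quotient of the \<open>w\<close> factors is cyclically telescoping because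
    A^p acts as the identity. The scaling commutes with A, so the \<open>j\<close> factors
    contribute a trivial norm.\<close>
  have norm: "(\<Prod>k<p. \<sigma> (A k x) (A k y)) = 1" for x y
  proof -
    have RA: "?R (A k x) = A k (?R x)" for k x by (simp add: A_def diag_diag mult.commute)
    have "(\<Prod>k<p. ?w (A (Suc k) x) (A (Suc k) y)) = (\<Prod>k<p. ?w (A k x) (A k y))"
    proof -
      have "?w x y * (\<Prod>k<p. ?w (A (Suc k) x) (A (Suc k) y)) =
          (\<Prod>k<p. ?w (A k x) (A k y)) * ?w (A p x) (A p y)"
        using prod.lessThan_Suc_shift[of "\<lambda>k. ?w (A k x) (A k y)" p] by simp
      moreover have "?w (A p x) (A p y) = ?w x y" by (intro hat2_congr A_p)
      ultimately show ?thesis using w(1)[of x y] by simp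
    qed
    moreover have "(\<Prod>k<p. ?w (A k x) (A k y)) \<noteq> 0" by (simp add: w)
    ultimately show ?thesis
      unfolding \<sigma>_def RA
      using j_norm[of "?R x" "?R y"] prod_inversef[of "\<lambda>k. ?w (A (Suc k) x) (A (Suc k) y)" "{..<p}"]
        prod_inversef[of "\<lambda>k. j (A k (?R x)) (A k (?R y))" "{..<p}"]
      by (simp add: prod.distrib A_A o_def)
  qed
  obtain \<nu> where nz: "\<And>x. \<nu> x \<noteq> 0" and split: "\<And>x y. \<nu> x * \<nu> y = \<sigma> x y * \<nu> (x + y)"
    and nu_per: "\<And>x y. congr q x y \<Longrightarrow> \<nu> x = \<nu> y" and nu_norm: "\<And>x. (\<Prod>k<p. \<nu> (A k x)) = 1"
    using normalized_splitting[OF \<sigma> sym per norm] by blast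
  obtain v where v: "v \<in> vecs (carrier \<Gamma>)" "\<And>x. hat v x = \<nu> x"
    using hat_surj[of \<nu>, OF nu_per] by blast
  have vn: "(\<Prod>k<p. hat v (A k x)) = 1" for x by (simp add: v nu_norm)
  obtain f where f: "f \<in> hom G (group_alg G)" "\<And>u. f (el u 0) = basis_vec (el (?R u) 0)"
    "f aa = G.times v (basis_vec aa)"
    using hom_exists[OF v(1) vn] by blast
  have fv: "f x \<in> vecs ?C" if "x \<in> ?C" for x using f(1) that by (auto simp: hom_def)
  have f1: "f \<one>\<^bsub>G\<^esub> = basis_vec \<one>\<^bsub>G\<^esub>" using f(2)[of 0] by (simp add: one_G)
  let ?K = "deform (group_hopf G) \<phi>"
  note I = invertible_normalized_cocycle_Gam(1)[OF \<phi> inv]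
  have \<phi>G: "\<phi> \<in> vecs (?C \<times> ?C)" "\<phi>' \<in> vecs (?C \<times> ?C)" using \<phi> by (simp_all add: vecs_Gam2_G2)
  have \<phi>\<phi>': "G2.times \<phi> \<phi>' = basis_vec (\<one>\<^bsub>G\<^esub>, \<one>\<^bsub>G\<^esub>)" "G2.times \<phi>' \<phi> = basis_vec (\<one>\<^bsub>G\<^esub>, \<one>\<^bsub>G\<^esub>)"
    using I by (simp_all add: is_inverse_in_def)
  have K_comul: "hcomul ?K x = G2.times (G2.times \<phi> (basis_vec (x, x))) \<phi>'" for x
    by (simp add: G2.inverse_in_eq[OF I])
  have K_hom: "hcomul ?K \<in> hom G (group_alg G2)"
  proof (rule homI)
    fix x y assume xy: "x \<in> ?C" "y \<in> ?C"
    have "G2.times (hcomul ?K x) (hcomul ?K y) =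
        G2.times \<phi> (G2.times (basis_vec (x, x)) (G2.times (G2.times \<phi>' \<phi>) (G2.times (basis_vec (y, y)) \<phi>')))"
      unfolding K_comul by (simp only: G2.times_assoc)
    also have "\<dots> = G2.times \<phi> (G2.times (G2.times (basis_vec (x, x)) (basis_vec (y, y))) \<phi>')"
      using G2.times_in_vecs[of "basis_vec (y, y)" \<phi>'] by (simp add: \<phi>\<phi>' G2.times_assoc G2.times_one(1)[simplified])
    also have "\<dots> = hcomul ?K (x \<otimes>\<^bsub>G\<^esub> y)"
      unfolding K_comul using xy by (simp add: G2.basis_times_basis G2.times_assoc)
    finally show "hcomul ?K (x \<otimes>\<^bsub>G\<^esub> y) = hcomul ?K x \<otimes>\<^bsub>group_alg G2\<^esub> hcomul ?K y" by simp
  qed (simp add: G2.times_in_vecs[simplified])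
  \<comment> \<open>\<open>\<phi>\<close> lies in the commutative algebra k\<Gamma> \<otimes>
    k\<Gamma>, so conjugation by it does not move g \<otimes> g.\<close>
  have K_Gam: "hcomul ?K g = basis_vec (g, g)" if "g \<in> carrier \<Gamma>" for g
  proof -
    have g: "basis_vec (g, g) \<in> vecs \<Gamma>2" using that by simp
    have "hcomul ?K g = G2.times (G2.times (basis_vec (g, g)) \<phi>) \<phi>'"
      unfolding K_comul times2_commute[OF \<phi>(1) g] ..
    then show ?thesis using that Gam_sub_G by (auto simp: G2.times_assoc \<phi>\<phi>' G2.times_one(2)[simplified])
  qed
  let ?ff = "\<lambda>(y, z). tens (f y) (f z)"
  have ff: "?ff \<in> hom G2 (group_alg G2)"
    by (rule hom_tens[OF fin_group_G fin_group_G f(1) f(1)])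
  have comul: "lin_ext (carrier G2) ?ff (\<Delta> x) = lin_ext ?C (hcomul ?K) (f x)" if "x \<in> ?C" for x
  proof (rule hom_eqI[OF fin_group_G2 _ _ _ _ that])
    show "(\<lambda>x. lin_ext (carrier G2) ?ff (\<Delta> x)) \<in> hom G (group_alg G2)"
      by (rule hom_lin_ext_comp[OF fin_group_G fin_group_G2 fin_group_G2 comul_hom ff])
    show "(\<lambda>x. lin_ext ?C (hcomul ?K) (f x)) \<in> hom G (group_alg G2)"
      by (rule hom_lin_ext_comp[OF fin_group_G fin_group_G fin_group_G2 f(1) K_hom])
    show "lin_ext (carrier G2) ?ff (\<Delta> (el u 0)) = lin_ext ?C (hcomul ?K) (f (el u 0))" for u
    proof -
      have "lin_ext (carrier G2) ?ff (\<Delta> (el u 0)) = ?ff (el u 0, el u 0)"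
        unfolding B_comul_Gam[OF el_0_closed] by (rule lin_ext_basis) auto
      then show ?thesis by (simp add: f(2) tens_basis_vec K_Gam del: deform_simps)
    qed
    have l: "lin_ext (carrier G2) ?ff (\<Delta> aa) =
        G2.times (G2.times (sclv2 r 1 J) (tens v v)) (basis_vec (aa, aa))"
    proof -
      have "lin_ext (carrier G2) ?ff J = lin_ext \<Gamma>2 ?ff J"
        by (rule lin_ext_mono) (use Gam_sub_G J(1) in auto)
      also have "\<dots> = sclv2 r 1 J"
        unfolding sclv2_def by (rule lin_ext_cong) (auto elim!: Gam_cases simp: f(2) tens_basis_vec)
      finally have "lin_ext (carrier G2) ?ff (\<Delta> aa) =
          G2.times (sclv2 r 1 J) (tens (f aa) (f aa))"
        unfolding lin_ext_comul_aa[OF fin_group_G2 ff] by simp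
      then show ?thesis
        unfolding f(3) times_group_hopf_tens[OF fin_group_G fin_group_G, symmetric] tens_basis_vec
        by (simp only: G2.times_assoc)
    qed
    \<comment> \<open>The coproduct of \<open>v\<close>: on \<Gamma> it is diagonal, so the
      transform becomes \<open>\<nu> (x + y)\<close>.\<close>
    define dv where "dv = lin_ext (carrier \<Gamma>) (\<lambda>g. basis_vec (g, g)) v"
    have dv: "dv \<in> vecs \<Gamma>2" unfolding dv_def by (rule lin_ext_in_vecs) simp
    have hdv: "hat2 dv x y = \<nu> (x + y)" for x y
      unfolding hat2_def dv_def v(2)[symmetric] hat_def
      by (subst form_ext_lin_ext) (auto simp: ch_add intro!: form_ext_cong)
    have "lin_ext ?C (hcomul ?K) (f aa) =
        G2.times (lin_ext ?C (hcomul ?K) v) (hcomul ?K aa)"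
      unfolding f(3) lin_ext_times[OF fin_group_G fin_group_G2 K_hom] by (simp del: deform_simps)
    also have "lin_ext ?C (hcomul ?K) v = dv"
      unfolding dv_def lin_ext_mono[OF G.fin Gam_sub_G v(1)] by (rule lin_ext_cong) (rule K_Gam)
    also have "G2.times dv (hcomul ?K aa) =
        G2.times dv (G2.times \<phi> (G2.times (basis_vec (aa, aa)) \<phi>'))"
      unfolding K_comul by (simp only: G2.times_assoc)
    \<comment> \<open>Moving a \<otimes> a to the right past the inverse of \<open>\<phi>\<close>
      applies A to its arguments, which is the origin of w(Ax, Ay) in
      \<open>\<sigma>\<close>.\<close>
    also have "\<dots> = G2.times (G2.times dv (G2.times \<phi> (Av2 \<phi>'))) (basis_vec (aa, aa))"
      unfolding a_times2[OF \<phi>(2)] by (simp only: G2.times_assoc)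
    also have "G2.times dv (G2.times \<phi> (Av2 \<phi>')) = G2.times (sclv2 r 1 J) (tens v v)"
    proof (rule hat2_inj)
      have vv: "tens v v \<in> vecs \<Gamma>2" by (intro tens_in_vecs v)
      show "G2.times dv (G2.times \<phi> (Av2 \<phi>')) \<in> vecs \<Gamma>2" "G2.times (sclv2 r 1 J) (tens v v) \<in> vecs \<Gamma>2"
        by (simp_all add: times_vecs dv \<phi> vv)
      fix x y
      show "hat2 (G2.times dv (G2.times \<phi> (Av2 \<phi>'))) x y = hat2 (G2.times (sclv2 r 1 J) (tens v v)) x y"
        using split[of x y] J(3)[of "?R x" "?R y"] w(1)
        by (simp add: times_vecs dv \<phi> vv hat2_times hdv hat2_tens v(2) hat2_sclv2 inv \<sigma>_def A_1 field_simps)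
    qed
    finally show "lin_ext (carrier G2) ?ff (\<Delta> aa) = lin_ext ?C (hcomul ?K) (f aa)"
      unfolding l by (rule HOL.sym)
  qed
  have counit: "form_ext ?C (\<lambda>_. 1) (f x) = 1" if "x \<in> ?C" for x
  proof -
    \<comment> \<open>The counit of \<open>v\<close> is its transform at 0, and the splitting
      relation at (0, 0) forces this to be 1.\<close>
    have \<nu>0: "\<nu> 0 = 1" using split[of 0 0] nz[of 0] cocycleD(3)[OF \<sigma>, of 0] by simp
    have "form_ext ?C (\<lambda>_. 1) (f (el u k)) = 1" for u k
    proof (induction k)
      case 0 then show ?case by (simp add: f(2))
    next
      case (Suc k)
      have "el u (Suc k) = el u k \<otimes>\<^bsub>G\<^esub> aa" by simp
      then have "f (el u (Suc k)) = G.times (f (el u k)) (f aa)"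
        using f(1) by (metis el_closed group_alg_simps(2) hom_mult)
      moreover have "ch 0 = (\<lambda>_. 1)" by (rule ext) simp
      then have "form_ext ?C (\<lambda>_. 1) v = 1"
        using form_ext_mono[OF G.fin Gam_sub_G v(1)] v(2)[of 0] \<nu>0 by (simp add: hat_def)
      ultimately show ?case using Suc
        by (simp add: form_ext_times[OF fin_group_G] f(3))
    qed
    then show ?thesis using that by (metis G_cases)
  qed
  have "is_hopf_iso B ?K f"
    unfolding is_hopf_iso_def
  proof (intro conjI ballI)
    show "bij_betw (lin_ext (hbasis B) f) (vecs (hbasis B)) (vecs (hbasis ?K))"
      using hom_bij[OF f v(1) vn rr', of 1] by simp
    show "lin_ext (hbasis B) f (hone B) = hone ?K" by (simp add: f1)
    fix x assume x: "x \<in> hbasis B"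
    show "f x \<in> vecs (hbasis ?K)" using x fv by simp
    show "lin_ext (hbasis B \<times> hbasis B) ?ff (\<Delta> x) = lin_ext (hbasis ?K) (hcomul ?K) (f x)"
      using comul x by (simp del: deform_simps(5))
    show "form_ext (hbasis ?K) (hcounit ?K) (f x) = hcounit B x"
      using counit x by (simp add: form_ext_def)
    fix y assume y: "y \<in> hbasis B"
    show "lin_ext (hbasis B) f (hmul B x y) = times_in ?K (f x) (f y)"
      using x y f(1) by (simp add: hom_def)
  qed
  then show ?thesis by (auto simp: hopf_isomorphic_def)
qed

end

theorem deformation_iso:
  fixes p q n l :: nat
    and \<xi> :: "'k::{alg_closed_field, field_char_0}"
    and \<omega> :: "(G_elt \<Rightarrow> 'k) \<Rightarrow> (G_elt \<Rightarrow> 'k) \<Rightarrow> 'k"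
  assumes "B_setting q \<xi> p n l \<B>"
    and \<omega>: "normalized_group_cocycle (char_group (Gam p q n l)) \<omega>"
    and det: "\<And>x y u v. x \<in> carrier (char_group (Gam p q n l)) \<Longrightarrow>
           y \<in> carrier (char_group (Gam p q n l)) \<Longrightarrow>
           has_coords \<xi> x u \<Longrightarrow> has_coords \<xi> y v \<Longrightarrow>
           \<omega> x y * inverse (\<omega> y x) = \<xi> powi det2 u v"
  shows "invertible_normalized_cocycle (group_hopf (G_grp p q n l)) (cocycle_element (Gam p q n l) \<omega>)"
    and "\<B> \<simeq>\<^sub>H deform (group_hopf (G_grp p q n l)) (cocycle_element (Gam p q n l) \<omega>)"
proof -
  interpret B_setting q \<xi> p n l \<B> by fact
  \<comment> \<open>The transform of the second element is the pointwise inverse of that of the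
    first, so it is the inverse required for the twist.\<close>
  let ?\<phi> = "cocycle_element \<Gamma> \<omega>" and ?\<phi>' = "cocycle_element \<Gamma> (\<lambda>x y. inverse (\<omega> x y))"
  have mult: "\<omega> (chi x) (chi y) * \<omega> (chi (x + y)) (chi z) = \<omega> (chi y) (chi z) * \<omega> (chi x) (chi (y + z))"
    for x y z
    using \<omega> chi_in[of x] chi_in[of y] chi_in[of z]
    unfolding normalized_group_cocycle_def chi_add[symmetric] by blast
  have c: "cocycle (hat2 ?\<phi>)"
    unfolding cocycle_def hat2_cocycle_element
    using \<omega> chi_in mult[of "- _" "- _" "- _"]
    by (simp add: normalized_group_cocycle_def chi_0)
  have inv: "hat2 ?\<phi>' x y = inverse (hat2 ?\<phi> x y)" for x y by (simp add: hat2_cocycle_element)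
  \<comment> \<open>The signs caused by the convention for the idempotents cancel here, as
    \<open>det2\<close> is bilinear.\<close>
  have alt: "alt (hat2 ?\<phi>) x y = \<xi> powi det2 x y" for x y
    using det[OF chi_in chi_in chi_coords chi_coords, of "- x" "- y"]
    by (simp add: alt_def hat2_cocycle_element divide_inverse det2_def)
  show "invertible_normalized_cocycle (group_hopf G) ?\<phi>"
    by (rule invertible_normalized_cocycle_Gam(2)[OF cocycle_element_vecs cocycle_element_vecs c inv])
  show "\<B> \<simeq>\<^sub>H deform (group_hopf G) ?\<phi>"
    by (rule iso_deform[OF cocycle_element_vecs cocycle_element_vecs c inv alt])
qed

section \<open>Linear characters of groups of order \<open>pq\<^sup>2\<close>\<close>

text \<open>A root of 1 + X + ... + X^(p-1); it differs from 1 because the value at 1 is p, which is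
  nonzero in characteristic zero.\<close>

lemma nontrivial_root_of_unity:
  assumes "prime p" obtains \<zeta> :: "'k::{alg_closed_field, field_char_0}" where "\<zeta> \<noteq> 1" "\<zeta> ^ p = 1"
proof -
  have p: "p > 1" using assms prime_gt_1_nat by blast
  obtain \<zeta> :: 'k where "(\<Sum>k\<le>p - 1. 1 * \<zeta> ^ k) = 0"
    using alg_closed[of "p - 1" "\<lambda>_. 1"] p by auto
  moreover have "{..p - 1} = {..<p}" using p by auto
  ultimately have 0: "(\<Sum>k<p. \<zeta> ^ k) = 0" by simp
  have "\<zeta> \<noteq> 1" using 0 p by auto
  moreover have "\<zeta> ^ p = 1" using 0 power_diff_1_eq[of \<zeta> p] by simp
  ultimately show thesis using that by blast
qed

text \<open>A group of prime order is generated by any nontrivial \<open>c\<close>, and c^i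
  \<mapsto> \<zeta>^i is well defined because \<zeta>^p = 1.\<close>

lemma (in group) prime_order_character:
  fixes \<zeta> :: "'k::field"
  assumes "prime p" "order G = p" and \<zeta>: "\<zeta> \<noteq> 1" "\<zeta> ^ p = 1"
  obtains \<chi> :: "'a \<Rightarrow> 'k" where "\<And>x y. x \<in> carrier G \<Longrightarrow> y \<in> carrier G \<Longrightarrow> \<chi> (x \<otimes> y) = \<chi> x * \<chi> y"
    "\<And>x. \<chi> x \<noteq> 0" "\<And>x. \<chi> x ^ p = 1" "\<exists>x\<in>carrier G. \<chi> x \<noteq> 1"
proof -
  have p: "p > 1" using assms(1) prime_gt_1_nat by blast
  have fin: "finite (carrier G)" using assms(2) p by (metis order_def card.infinite not_one_less_zero)
  have "carrier G \<noteq> {\<one>}" using assms(2) p by (auto simp: order_def)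
  then obtain c where c: "c \<in> carrier G" "c \<noteq> \<one>" using one_closed by blast
  then have ord: "ord c = p"
    using ord_dvd_group_order[OF c(1)] assms(1,2) ord_eq_1[OF c(1)] by (auto simp: prime_nat_iff)
  have gen: "\<exists>i::int. x = c [^] i" if "x \<in> carrier G" for x
  proof -
    let ?P = "(\<lambda>i::nat. c [^] i) ` {..<p}"
    have "inj_on (\<lambda>i::nat. c [^] i) {..<p}"
    proof (rule inj_onI)
      fix i j assume ij: "i \<in> {..<p}" "j \<in> {..<p}" "c [^] i = c [^] j"
      then have "int p dvd int j - int i" using int_pow_eq[OF c(1), of "int i" "int j"] by (simp add: ord int_pow_int)
      then have "[int j = int i] (mod int p)" by (simp add: cong_iff_dvd_diff)
      then show "i = j" using ij by (simp add: cong_int_iff cong_def)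
    qed
    then have "card ?P = card (carrier G)" using assms(2) by (simp add: card_image order_def)
    moreover have "?P \<subseteq> carrier G" using c by auto
    ultimately have "?P = carrier G" using fin by (simp add: card_subset_eq)
    then show ?thesis using that int_pow_int by (metis imageE)
  qed
  have \<zeta>0: "\<zeta> \<noteq> 0" using \<zeta> p by (metis power_0_left not_one_less_zero zero_neq_one)
  \<comment> \<open>An arbitrary choice of exponent; by \<open>\<zeta>eq\<close> the resulting power
    of \<open>\<zeta>\<close> does not depend on it.\<close>
  define e where "e x = (SOME i::int. x = c [^] i)" for x
  have e: "c [^] e x = x" if "x \<in> carrier G" for x
    using someI_ex[OF gen[OF that]] by (simp add: e_def)
  have \<zeta>eq: "\<zeta> powi i = \<zeta> powi j" if "c [^] i = c [^] j" for i j :: int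
  proof -
    have "int p dvd j - i" using that int_pow_eq[OF c(1)] ord by simp
    then obtain k where "j = i + int p * k" by (metis dvd_def add.commute diff_add_cancel)
    then show ?thesis using \<zeta> \<zeta>0 by (simp add: power_int_add power_int_mult)
  qed
  show thesis
  proof (rule that[of "\<lambda>x. \<zeta> powi e x"])
    fix x y assume xy: "x \<in> carrier G" "y \<in> carrier G"
    have "c [^] e (x \<otimes> y) = c [^] (e x + e y)" using xy c by (simp add: e int_pow_mult)
    then have "\<zeta> powi e (x \<otimes> y) = \<zeta> powi (e x + e y)" by (rule \<zeta>eq)
    then show "\<zeta> powi e (x \<otimes> y) = \<zeta> powi e x * \<zeta> powi e y" using \<zeta>0 by (simp add: power_int_add)
  next
    show "\<zeta> powi e x \<noteq> 0" for x using \<zeta>0 by simp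
    have "(\<zeta> powi e x) ^ p = (\<zeta> ^ p) powi e x" for x
      by (simp add: power_int_power power_int_power' mult.commute)
    then show "(\<zeta> powi e x) ^ p = 1" for x using \<zeta> by simp
    have "\<zeta> powi e c = \<zeta> powi 1" by (rule \<zeta>eq) (use c e in simp)
    then have "\<zeta> powi e c \<noteq> 1" using \<zeta> by simp
    then show "\<exists>x\<in>carrier G. \<zeta> powi e x \<noteq> 1" using c by blast
  qed
qed

text \<open>Among the \<open>m + 1\<close> cosets \<open>Q g h\<^sup>i\<close>, \<open>i \<le> m\<close>, two coincide.\<close>

lemma (in group) subgroup_normal_small_index:
  assumes Q: "subgroup Q G" and fin: "finite (carrier G)" and m: "card (rcosets Q) = m"
    and cop: "\<And>d. 0 < d \<Longrightarrow> d \<le> m \<Longrightarrow> coprime d (card Q)"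
  shows "Q \<lhd> G"
  unfolding normal_inv_iff
proof (intro conjI Q ballI)
  fix g h assume g: "g \<in> carrier G" and h: "h \<in> Q"
  have sub: "Q \<subseteq> carrier G" using Q by (rule subgroup.subset)
  then have hG: "h \<in> carrier G" using h by blast
  let ?c = "\<lambda>i::nat. Q #> (g \<otimes> h [^] i)"
  have "finite (rcosets Q)" using fin sub by (simp add: RCOSETS_def)
  moreover have "?c ` {..m} \<subseteq> rcosets Q" using g hG by (auto intro!: rcosetsI sub)
  ultimately have "card (?c ` {..m}) \<le> m" using m by (metis card_mono)
  then have "card (?c ` {..m}) < card {..m}" by simp
  then obtain i j where ij: "i \<le> m" "j \<le> m" "i < j" "?c i = ?c j"
    using pigeonhole[of ?c "{..m}"] unfolding inj_on_def by (metis atMost_iff nat_neq_iff)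
  define d where "d = j - i"
  have d: "0 < d" "d \<le> m" "j = d + i" using ij by (auto simp: d_def)
  have mem: "g \<otimes> h [^] i \<in> carrier G" "g \<otimes> h [^] j \<in> carrier G" using g hG by auto
  \<comment> \<open>Coinciding cosets say that the conjugate by \<open>g\<close> of h^d, with d = j
    - i, lies in Q.\<close>
  have "Q #> ((g \<otimes> h [^] j) \<otimes> inv (g \<otimes> h [^] i)) = Q"
    by (rule coset_mult_inv2[OF ij(4)[symmetric] mem(2,1) sub])
  then have "(g \<otimes> h [^] j) \<otimes> inv (g \<otimes> h [^] i) \<in> Q"
    by (rule coset_join1[OF _ _ Q]) (use mem in simp)
  moreover have "(g \<otimes> h [^] j) \<otimes> inv (g \<otimes> h [^] i) = g \<otimes> h [^] d \<otimes> inv g"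
  proof -
    have "h [^] i \<otimes> (inv (h [^] i) \<otimes> inv g) = inv g" using g hG by (simp flip: m_assoc)
    then show ?thesis using g hG by (simp add: d(3) inv_mult_group m_assoc flip: nat_pow_mult)
  qed
  ultimately have base: "g \<otimes> h [^] d \<otimes> inv g \<in> Q" by simp
  have pow: "g \<otimes> (h [^] d) [^] (k::nat) \<otimes> inv g \<in> Q" for k
  proof (induction k)
    case 0 then show ?case using g Q by (simp add: subgroup.one_closed)
  next
    case (Suc k)
    have "g \<otimes> (h [^] d) [^] Suc k \<otimes> inv g =
        (g \<otimes> (h [^] d) [^] k \<otimes> inv g) \<otimes> (g \<otimes> h [^] d \<otimes> inv g)"
    proof -
      have "inv g \<otimes> (g \<otimes> (h [^] d \<otimes> inv g)) = h [^] d \<otimes> inv g" using g hG by (simp flip: m_assoc)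
      then show ?thesis using g hG by (simp add: m_assoc)
    qed
    then show ?case using subgroup.m_closed[OF Q Suc base] by simp
  qed
  have hQ: "h [^] card Q = \<one>"
  proof -
    interpret H: group "G\<lparr>carrier := Q\<rparr>" by (rule subgroup_imp_group[OF Q])
    have "h [^]\<^bsub>G\<lparr>carrier := Q\<rparr>\<^esub> order (G\<lparr>carrier := Q\<rparr>) = \<one>\<^bsub>G\<lparr>carrier := Q\<rparr>\<^esub>"
      by (rule H.pow_order_eq_1) (use h in auto)
    then show ?thesis by (simp add: order_def nat_pow_consistent[symmetric])
  qed
  have Q0: "card Q \<noteq> 0" using finite_subset[OF sub fin] h by auto
  \<comment> \<open>\<open>d\<close> is at most the index, hence prime to the order of Q, so
    \<open>h\<close> is itself a power of h^d and its conjugate lies in Q too.\<close>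
  obtain a b where ab: "d * a = card Q * b + 1"
    using bezout_nat[of d "card Q"] cop[OF d(1,2)] d(1) by auto
  have "(h [^] d) [^] a = (h [^] card Q) [^] b \<otimes> h"
    using hG by (simp add: nat_pow_pow ab nat_pow_mult[symmetric])
  then have "(h [^] d) [^] a = h" using hG by (simp add: hQ)
  then show "g \<otimes> h \<otimes> inv g \<in> Q" using pow[of a] by simp
qed

lemma group_char_group:
  assumes "group N" shows "group (char_group N :: ('g \<Rightarrow> 'k::field) monoid)"
proof (rule groupI)
  interpret N: group N by fact
  let ?C = "char_group N :: ('g \<Rightarrow> 'k::field) monoid"
  fix x assume x: "x \<in> carrier ?C"
  have 1: "x \<one>\<^bsub>N\<^esub> = 1"
  proof -
    have h: "x (a \<otimes>\<^bsub>N\<^esub> b) = x a * x b" "x a \<noteq> 0" if "a \<in> carrier N" "b \<in> carrier N" for a b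
      using x that by (auto simp: char_group_def hom_def field_units_def)
    show ?thesis
      using h(1)[OF N.one_closed N.one_closed] h(2)[OF N.one_closed N.one_closed] by simp
  qed
  have "(\<lambda>g\<in>carrier N. inverse (x g)) \<in> carrier ?C"
    using x by (auto simp: char_group_def hom_def field_units_def Pi_iff)
  moreover have "(\<lambda>g\<in>carrier N. inverse (x g)) \<otimes>\<^bsub>?C\<^esub> x = \<one>\<^bsub>?C\<^esub>"
    using x by (auto simp: char_group_def hom_def field_units_def Pi_iff restrict_def)
  ultimately show "\<exists>y\<in>carrier ?C. y \<otimes>\<^bsub>?C\<^esub> x = \<one>\<^bsub>?C\<^esub>" by blast
  show "\<one>\<^bsub>?C\<^esub> \<otimes>\<^bsub>?C\<^esub> x = x"
    using x by (auto simp: char_group_def extensional_def restrict_def fun_eq_iff)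
next
  interpret N: group N by fact
  fix x y z :: "'g \<Rightarrow> 'k"
  assume "x \<in> carrier (char_group N)" "y \<in> carrier (char_group N)" "z \<in> carrier (char_group N)"
  then show "x \<otimes>\<^bsub>char_group N\<^esub> y \<otimes>\<^bsub>char_group N\<^esub> z = x \<otimes>\<^bsub>char_group N\<^esub> (y \<otimes>\<^bsub>char_group N\<^esub> z)"
    by (auto simp: char_group_def restrict_def fun_eq_iff)
next
  interpret N: group N by fact
  fix x y :: "'g \<Rightarrow> 'k"
  assume "x \<in> carrier (char_group N)" "y \<in> carrier (char_group N)"
  then show "x \<otimes>\<^bsub>char_group N\<^esub> y \<in> carrier (char_group N)"
    by (auto simp: char_group_def hom_def field_units_def Pi_iff)
next
  interpret N: group N by fact
  show "\<one>\<^bsub>char_group N\<^esub> \<in> carrier (char_group N)"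
    by (auto simp: char_group_def hom_def field_units_def)
qed

text \<open>Inflating a nontrivial character of the quotient of order \<open>p\<close> by the Sylow
  q-subgroup gives an element of order exactly \<open>p\<close> in the character group; Lagrange's
  theorem does the rest.\<close>

lemma prime_dvd_order_char_group:
  assumes N: "group N" and p: "prime p" "prime q" "p < q" and ord: "order N = p * (q * q)"
  shows "p dvd order (char_group N :: ('g \<Rightarrow> 'k::{alg_closed_field, field_char_0}) monoid)"
proof -
  interpret N: group N by fact
  let ?C = "char_group N :: ('g \<Rightarrow> 'k) monoid"
  interpret C: group ?C by (rule group_char_group[OF N])
  have p1: "p > 1" and q1: "q > 1" using p prime_gt_1_nat by auto
  have "order N > 0" using ord p1 q1 by simp
  then have fin: "finite (carrier N)" by (simp add: order_def card_gt_0_iff)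
  obtain Q where Q: "subgroup Q N" "card Q = q ^ 2"
    using sylow_thm[OF p(2) N _ fin, of 2 p] ord by (auto simp: power2_eq_square mult.commute)
  have m: "card (rcosets\<^bsub>N\<^esub> Q) = p"
    using N.lagrange[OF Q(1)] ord Q(2) q1 by (simp add: power2_eq_square)
  have "Q \<lhd> N"
  proof (rule N.subgroup_normal_small_index[OF Q(1) fin m])
    fix d assume "0 < d" "d \<le> p"
    then have "\<not> q dvd d" using p(3) by (auto dest: dvd_imp_le)
    then show "coprime d (card Q)" using p(2) Q(2) by (metis coprime_commute coprime_power_right_iff prime_imp_coprime)
  qed
  then interpret Q: normal Q N .
  interpret M: group "N Mod Q" by (rule Q.factorgroup_is_group)
  have "order (N Mod Q) = p" using m by (simp add: order_def FactGroup_def)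
  obtain \<zeta> :: 'k where \<zeta>: "\<zeta> \<noteq> 1" "\<zeta> ^ p = 1" using nontrivial_root_of_unity[OF p(1)] by blast
  obtain \<chi> :: "'g set \<Rightarrow> 'k"
    where \<chi>: "\<And>x y. x \<in> carrier (N Mod Q) \<Longrightarrow> y \<in> carrier (N Mod Q) \<Longrightarrow> \<chi> (x \<otimes>\<^bsub>N Mod Q\<^esub> y) = \<chi> x * \<chi> y"
    "\<And>x. \<chi> x \<noteq> 0" "\<And>x. \<chi> x ^ p = 1" "\<exists>x\<in>carrier (N Mod Q). \<chi> x \<noteq> 1"
    using M.prime_order_character[OF p(1) \<open>order (N Mod Q) = p\<close> \<zeta>] by blast
  define \<psi> where "\<psi> = (\<lambda>g\<in>carrier N. \<chi> (Q #>\<^bsub>N\<^esub> g))"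
  have hom: "(\<lambda>a. Q #>\<^bsub>N\<^esub> a) \<in> hom N (N Mod Q)" by (rule Q.r_coset_hom_Mod)
  have \<psi>: "\<psi> \<in> carrier ?C"
    using \<chi>(1,2) hom by (auto simp: \<psi>_def char_group_def field_units_def hom_def Pi_iff)
  have pow: "\<psi> [^]\<^bsub>?C\<^esub> k = (\<lambda>g\<in>carrier N. \<psi> g ^ k)" for k :: nat
  proof (induction k)
    case 0 show ?case by (simp add: char_group_def)
  next
    case (Suc k)
    have "\<psi> [^]\<^bsub>?C\<^esub> Suc k = (\<lambda>g\<in>carrier N. \<psi> g ^ k) \<otimes>\<^bsub>?C\<^esub> \<psi>" by (simp only: C.nat_pow_Suc Suc)
    also have "\<dots> = (\<lambda>g\<in>carrier N. \<psi> g ^ Suc k)"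
      by (simp add: char_group_def restrict_def fun_eq_iff mult.commute)
    finally show ?case .
  qed
  have "\<psi> [^]\<^bsub>?C\<^esub> p = \<one>\<^bsub>?C\<^esub>"
    unfolding pow by (auto simp: \<psi>_def \<chi>(3) char_group_def restrict_def fun_eq_iff)
  then have "C.ord \<psi> dvd p" using C.pow_eq_id[OF \<psi>] by blast
  moreover have "\<psi> \<noteq> \<one>\<^bsub>?C\<^esub>"
  proof
    assume eq: "\<psi> = \<one>\<^bsub>?C\<^esub>"
    have "\<chi> (Q #>\<^bsub>N\<^esub> g) = 1" if "g \<in> carrier N" for g
      using that fun_cong[OF eq, of g] by (simp add: \<psi>_def char_group_def)
    then show False using \<chi>(4) by (auto simp: FactGroup_def RCOSETS_def)
  qed
  ultimately have "C.ord \<psi> = p" using p(1) C.ord_eq_1[OF \<psi>] by (auto simp: prime_nat_iff)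
  then show ?thesis using C.ord_dvd_group_order[OF \<psi>] by simp
qed

section \<open>Grouplike elements\<close>

definition grouplikes :: "('b, 'k::field) hopf \<Rightarrow> ('b \<Rightarrow> 'k) set" where
  "grouplikes H = {v \<in> vecs (hbasis H). lin_ext (hbasis H) (hcomul H) v = tens v v \<and>
     form_ext (hbasis H) (hcounit H) v = 1}"

lemma dual_hopf_simps [simp]:
  "hbasis (dual_hopf H) = hbasis H"
  "hmul (dual_hopf H) x y = (\<lambda>z. if z \<in> hbasis H then hcomul H z (x, y) else 0)"
  "hone (dual_hopf H) = (\<lambda>z. if z \<in> hbasis H then hcounit H z else 0)"
  by (simp_all add: dual_hopf_def)

text \<open>An algebra map \<open>kN \<rightarrow> k\<close> is a character of \<open>N\<close>, and an algebra map \<open>H\<^sup>* \<rightarrow> k\<close> is a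
  grouplike element of \<open>H\<close>. The cardinality of \<open>N\<close> is read off as the trace of the identity.\<close>

lemma dual_group_algebra:
  fixes H :: "('b, 'k::field_char_0) hopf"
  assumes fin: "finite (hbasis H)"
    and comul: "\<And>x. x \<in> hbasis H \<Longrightarrow> hcomul H x \<in> vecs (hbasis H \<times> hbasis H)"
    and N: "group N" "finite (carrier N)"
    and iso: "is_hopf_iso (dual_hopf H) (deform (group_hopf N) J) f"
  shows "order N = card (hbasis H)"
    and "bij_betw (\<lambda>\<chi> x. if x \<in> hbasis H then form_ext (carrier N) \<chi> (f x) else 0)
      (carrier (char_group N)) (grouplikes H)"
proof -
  interpret N: fin_group N using N by (simp add: fin_group_def fin_group_axioms_def)
  let ?B = "hbasis H" and ?N = "carrier N"
  let ?D = "dual_hopf H"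
  let ?F = "lin_ext ?B f"
  have fN: "f x \<in> vecs ?N" if "x \<in> ?B" for x using iso that by (simp add: is_hopf_iso_def)
  have bij: "bij_betw ?F (vecs ?B) (vecs ?N)" using iso by (simp add: is_hopf_iso_def)
  have mul: "?F (hmul ?D x y) = N.times (f x) (f y)" if "x \<in> ?B" "y \<in> ?B" for x y
    using iso that by (simp add: is_hopf_iso_def)
  have one: "?F (hone ?D) = basis_vec \<one>\<^bsub>N\<^esub>" using iso by (simp add: is_hopf_iso_def)
  have oneB: "hone ?D \<in> vecs ?B" by (simp add: vecs_def)
  have inj: "v = w" if "v \<in> vecs ?B" "w \<in> vecs ?B" "?F v = ?F w" for v w
    using bij that by (auto simp: bij_betw_def inj_on_def)
  have "\<exists>e. e \<in> vecs ?B \<and> ?F e = basis_vec n" if "n \<in> ?N" for n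
  proof -
    have "basis_vec n \<in> ?F ` vecs ?B" using bij that by (simp add: bij_betw_def)
    then show ?thesis by (metis imageE)
  qed
  \<comment> \<open>\<open>E\<close> is the inverse of the algebra isomorphism on the group basis of
    kN.\<close>
  then obtain E where E: "\<And>n. n \<in> ?N \<Longrightarrow> E n \<in> vecs ?B" "\<And>n. n \<in> ?N \<Longrightarrow> ?F (E n) = basis_vec n"
    by metis
  have Ef: "lin_ext ?N E (f x) = basis_vec x" if "x \<in> ?B" for x
  proof (rule inj)
    show "lin_ext ?N E (f x) \<in> vecs ?B" by (rule lin_ext_in_vecs) (rule E)
    show "basis_vec x \<in> vecs ?B" using that by simp
    have "?F (lin_ext ?N E (f x)) = lin_ext ?N basis_vec (f x)"
      unfolding lin_ext_lin_ext[OF N(2) fin] by (rule lin_ext_cong) (rule E(2))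
    also have "\<dots> = f x" by (rule lin_ext_basis_vec[OF N(2) fN[OF that]])
    finally show "?F (lin_ext ?N E (f x)) = ?F (basis_vec x)" using fin that by simp
  qed
  \<comment> \<open>The composites of the isomorphism and its inverse in the two orders have the
    same trace. In characteristic zero this equality in k yields equality of the dimensions as
    natural numbers.\<close>
  have "of_nat (card ?B) = (\<Sum>x\<in>?B. (basis_vec x x :: 'k))" by (simp add: basis_vec_def)
  also have "\<dots> = (\<Sum>x\<in>?B. \<Sum>n\<in>?N. f x n * E n x)"
    by (intro sum.cong refl) (simp only: Ef[symmetric] lin_ext_def)
  also have "\<dots> = (\<Sum>n\<in>?N. \<Sum>x\<in>?B. E n x * f x n)"
    by (subst sum.swap) (simp add: mult.commute)
  also have "\<dots> = (\<Sum>n\<in>?N. (basis_vec n n :: 'k))"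
    by (intro sum.cong refl) (simp only: E(2)[symmetric] lin_ext_def)
  also have "\<dots> = of_nat (order N)" by (simp add: basis_vec_def order_def)
  finally show "order N = card ?B" by simp
  \<comment> \<open>A functional on the dual of \<open>H\<close> is an element of \<open>H\<close>;
    this one is the linear extension of \<open>\<chi>\<close> composed with the isomorphism.\<close>
  let ?\<Phi> = "\<lambda>\<chi> x. if x \<in> ?B then form_ext ?N \<chi> (f x) else 0"
  have \<Phi>: "form_ext ?B (?\<Phi> \<chi>) u = form_ext ?N \<chi> (?F u)" for \<chi> u
    unfolding form_ext_lin_ext[OF fin N(2)] by (rule form_ext_cong) simp
  have hom: "\<chi> (m \<otimes>\<^bsub>N\<^esub> n) = \<chi> m * \<chi> n" "\<chi> m \<noteq> 0"
    if "\<chi> \<in> carrier (char_group N)" "m \<in> ?N" "n \<in> ?N" for \<chi> :: "_ \<Rightarrow> 'k" and m n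
    using that by (auto simp: char_group_def field_units_def hom_def)
  have hom1: "\<chi> \<one>\<^bsub>N\<^esub> = 1" if "\<chi> \<in> carrier (char_group N)" for \<chi> :: "_ \<Rightarrow> 'k"
    using hom(1)[OF that N.one_closed N.one_closed] hom(2)[OF that N.one_closed N.one_closed] by simp
  show "bij_betw ?\<Phi> (carrier (char_group N)) (grouplikes H)"
  proof (rule bij_betwI')
    fix \<chi> \<chi>' :: "_ \<Rightarrow> 'k"
    assume \<chi>: "\<chi> \<in> carrier (char_group N)" and \<chi>': "\<chi>' \<in> carrier (char_group N)"
    show "?\<Phi> \<chi> = ?\<Phi> \<chi>' \<longleftrightarrow> \<chi> = \<chi>'"
    proof
      assume eq: "?\<Phi> \<chi> = ?\<Phi> \<chi>'"
      show "\<chi> = \<chi>'"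
      proof (rule extensionalityI[of _ ?N])
        fix n assume n: "n \<in> ?N"
        have "form_ext ?N \<chi> (?F (E n)) = form_ext ?N \<chi>' (?F (E n))"
          by (simp only: \<Phi>[symmetric] eq)
        then show "\<chi> n = \<chi>' n" using n N(2) by (simp add: E(2))
      qed (use \<chi> \<chi>' in \<open>simp_all add: char_group_def\<close>)
    qed (hypsubst, rule refl)
  next
    fix \<chi> :: "_ \<Rightarrow> 'k" assume \<chi>: "\<chi> \<in> carrier (char_group N)"
    have "lin_ext ?B (hcomul H) (?\<Phi> \<chi>) (x, y) = tens (?\<Phi> \<chi>) (?\<Phi> \<chi>) (x, y)" for x y
    proof (cases "x \<in> ?B \<and> y \<in> ?B")
      case True
      have "lin_ext ?B (hcomul H) (?\<Phi> \<chi>) (x, y) = form_ext ?B (?\<Phi> \<chi>) (hmul ?D x y)"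
        by (simp add: lin_ext_def form_ext_def mult.commute)
      also have "\<dots> = form_ext ?N \<chi> (N.times (f x) (f y))" unfolding \<Phi> using mul True by simp
      also have "\<dots> = tens (?\<Phi> \<chi>) (?\<Phi> \<chi>) (x, y)"
        using True by (simp add: form_ext_times[OF N.fin_group_axioms hom(1)[OF \<chi>]] tens_def)
      finally show ?thesis .
    next
      case False
      then have "hcomul H z (x, y) = 0" if "z \<in> ?B" for z
        using vecsD[OF comul[OF that], of "(x, y)"] by blast
      then show ?thesis using False by (auto simp: lin_ext_def tens_def)
    qed
    moreover have "form_ext ?B (hcounit H) (?\<Phi> \<chi>) = 1"
    proof -
      have "form_ext ?B (hcounit H) (?\<Phi> \<chi>) = form_ext ?B (?\<Phi> \<chi>) (hone ?D)"
        by (simp add: form_ext_def mult.commute)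
      also have "\<dots> = 1" unfolding \<Phi> one using N(2) hom1[OF \<chi>] by simp
      finally show ?thesis .
    qed
    ultimately show "?\<Phi> \<chi> \<in> grouplikes H" by (auto simp: grouplikes_def vecs_def fun_eq_iff)
  next
    fix v assume "v \<in> grouplikes H"
    then have v: "v \<in> vecs ?B" "lin_ext ?B (hcomul H) v = tens v v" "form_ext ?B (hcounit H) v = 1"
      by (auto simp: grouplikes_def)
    \<comment> \<open>Grouplikeness of \<open>v\<close> says precisely that, as a functional on the
      dual, it is multiplicative.\<close>
    have tv: "form_ext ?B v (hmul ?D x y) = v x * v y" for x y
    proof -
      have "form_ext ?B v (hmul ?D x y) = lin_ext ?B (hcomul H) v (x, y)"
        by (simp add: lin_ext_def form_ext_def mult.commute)
      then show ?thesis by (simp add: v(2) tens_def)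
    qed
    have E1: "E \<one>\<^bsub>N\<^esub> = hone ?D"
      by (rule inj) (use E oneB one in auto)
    \<comment> \<open>The product of the dual, through which \<open>E\<close> is seen to be
      multiplicative.\<close>
    define mm where "mm a b = (\<lambda>z. \<Sum>x\<in>?B. \<Sum>y\<in>?B. a x * b y * hmul ?D x y z)" for a b
    have mm_form: "form_ext ?B g (mm a b) = (\<Sum>x\<in>?B. \<Sum>y\<in>?B. a x * b y * form_ext ?B g (hmul ?D x y))"
      for a b g
      unfolding mm_def form_ext_def sum_distrib_right sum_distrib_left
      by (subst sum.swap, rule sum.cong[OF refl], subst sum.swap) (simp add: mult.assoc)
    have mmB: "mm a b \<in> vecs ?B" for a b by (auto simp: mm_def vecs_def)
    have F_mm: "?F (mm a b) = N.times (?F a) (?F b)" for a b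
    proof
      fix z
      have "?F (mm a b) z = form_ext ?B (\<lambda>x. f x z) (mm a b)" by (simp add: lin_ext_def form_ext_def)
      also have "\<dots> = (\<Sum>x\<in>?B. \<Sum>y\<in>?B. a x * b y * ?F (hmul ?D x y) z)"
        unfolding mm_form by (simp add: lin_ext_def form_ext_def)
      also have "\<dots> = N.times (?F a) (?F b) z"
        unfolding N.times_lin_ext[OF fin] by (intro sum.cong refl) (simp only: mul)
      finally show "?F (mm a b) z = N.times (?F a) (?F b) z" .
    qed
    have E_mm: "E (m \<otimes>\<^bsub>N\<^esub> n) = mm (E m) (E n)" if "m \<in> ?N" "n \<in> ?N" for m n
      by (rule inj) (use that in \<open>simp_all add: E mmB F_mm N.basis_times_basis\<close>)
    define \<chi> where "\<chi> = (\<lambda>n\<in>?N. form_ext ?B v (E n))"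
    have mult: "\<chi> (m \<otimes>\<^bsub>N\<^esub> n) = \<chi> m * \<chi> n" if "m \<in> ?N" "n \<in> ?N" for m n
    proof -
      have "form_ext ?B v (mm a b) = form_ext ?B v a * form_ext ?B v b" for a b
        unfolding mm_form tv by (simp add: form_ext_def sum_product mult_ac)
      then show ?thesis using that by (simp add: \<chi>_def E_mm)
    qed
    have "form_ext ?B v (hone ?D) = form_ext ?B (hcounit H) v"
      by (simp add: form_ext_def mult.commute)
    then have \<chi>1: "\<chi> \<one>\<^bsub>N\<^esub> = 1" by (simp add: \<chi>_def E1 v(3))
    have "\<chi> n \<noteq> 0" if "n \<in> ?N" for n
      using mult[of n "inv\<^bsub>N\<^esub> n"] \<chi>1 that by auto
    then have "\<chi> \<in> carrier (char_group N)"
      using mult by (auto simp: char_group_def field_units_def hom_def \<chi>_def)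
    moreover have "?\<Phi> \<chi> = v"
    proof
      fix x show "?\<Phi> \<chi> x = v x"
      proof (cases "x \<in> ?B")
        case True
        have "form_ext ?N \<chi> (f x) = form_ext ?N (\<lambda>n. form_ext ?B v (E n)) (f x)"
          by (rule form_ext_cong) (simp add: \<chi>_def)
        also have "\<dots> = form_ext ?B v (lin_ext ?N E (f x))"
          by (rule form_ext_lin_ext[OF N(2) fin, symmetric])
        finally show ?thesis using True fin by (simp add: Ef)
      qed (use vecsD[OF v(1)] in simp)
    qed
    ultimately show "\<exists>\<chi>\<in>carrier (char_group N). v = ?\<Phi> \<chi>" by metis
  qed
qed

section \<open>The grouplike elements of B\<close>

lemma (in setting) snd_el: "snd (el u k) = int (k mod p)"
  by (simp add: el_def flip: zmod_int)

lemma (in setting) Gam_iff: "el u k \<in> carrier \<Gamma> \<longleftrightarrow> p dvd k"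
  using q_pos by (simp add: carrier_Gam el_def mod_eq_0_iff_dvd)

context B_setting
begin

text \<open>\<open>J\<close> lies in k\<Gamma> \<otimes> k\<Gamma>, so \<Delta> maps the span of the
  coset \<Gamma> a^k into its own tensor square; \<open>snd\<close> reads off the coset.\<close>

lemma comul_support:
  assumes z: "z \<in> carrier G" and nz: "\<Delta> z (a, b) \<noteq> 0"
  shows "snd a = snd z" "snd b = snd z"
proof -
  obtain u k where uk: "k < p" "z = el u k" by (rule G_cases[OF z])
  obtain w where w: "w \<in> vecs \<Gamma>2" "\<And>x y. hat2 w x y = (\<Prod>i<k. j (A i x) (A i y))"
    "\<And>u. \<Delta> (el u k) = G2.times (basis_vec (el u 0, el u 0)) (G2.times w (basis_vec (el 0 k, el 0 k)))"
    using comul_el[where k = k] by blast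
  define W where "W = G2.times (basis_vec (el u 0, el u 0)) w"
  have W: "W \<in> vecs \<Gamma>2" unfolding W_def by (rule times_vecs) (simp_all add: w)
  have eq: "\<Delta> z = G2.times W (basis_vec (el 0 k, el 0 k))"
    by (simp only: uk(2) w(3) W_def G2.times_assoc)
  have ab: "a \<in> carrier G" "b \<in> carrier G" using vecsD[OF comul_vecs[OF z], of "(a, b)"] nz by auto
  then have "W ((a, b) \<otimes>\<^bsub>G2\<^esub> inv\<^bsub>G2\<^esub> (el 0 k, el 0 k)) \<noteq> 0"
    using nz unfolding eq by (subst (asm) G2.times_basis) auto
  then have mem: "a \<otimes>\<^bsub>G\<^esub> inv\<^bsub>G\<^esub> el 0 k \<in> carrier \<Gamma>" "b \<otimes>\<^bsub>G\<^esub> inv\<^bsub>G\<^esub> el 0 k \<in> carrier \<Gamma>"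
    using vecsD[OF W, of "(a \<otimes>\<^bsub>G\<^esub> inv\<^bsub>G\<^esub> el 0 k, b \<otimes>\<^bsub>G\<^esub> inv\<^bsub>G\<^esub> el 0 k)"]
    by (auto simp: inv_DirProd[OF G.is_group G.is_group])
  have "snd c = snd z" if c: "c \<in> carrier G" "c \<otimes>\<^bsub>G\<^esub> inv\<^bsub>G\<^esub> el 0 k \<in> carrier \<Gamma>" for c
  proof -
    obtain u' where "c \<otimes>\<^bsub>G\<^esub> inv\<^bsub>G\<^esub> el 0 k = el u' 0" using c(2) by (rule Gam_cases)
    then have "c = el u' 0 \<otimes>\<^bsub>G\<^esub> el 0 k" using c(1) by (metis G.inv_solve_right' el_closed)
    then show ?thesis by (simp add: uk(2) snd_el)
  qed
  then show "snd a = snd z" "snd b = snd z" using ab mem by blast+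
qed

text \<open>A scales \<open>det2\<close> by \<open>?M\<close>, so the exponent is c (1 + M + ... +
  M^(k-1)). If \<open>q\<close> divided it, then \<open>q\<close> would divide M^k - 1, which
  \<open>det_scale_pow\<close> excludes.\<close>

lemma prod_j_not_symmetric:
  assumes k: "0 < k" "k < p" shows "(\<Prod>i<k. alt j (A i (1, 0)) (A i (0, 1))) \<noteq> 1"
proof
  let ?M = "int n * int n ^ l"
  obtain c where c: "\<not> int q dvd c" "\<And>x y. alt j x y = \<xi> powi (c * det2 x y)" using j_alt by blast
  have "(\<Prod>i<k. \<xi> powi g i) = \<xi> powi (\<Sum>i<k. g i)" for g
    by (induction k) (simp_all add: power_int_add)
  moreover have "alt j (A i (1, 0)) (A i (0, 1)) = \<xi> powi (c * ?M ^ i)" for i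
    by (simp add: c(2) A_def det2_diag power_mult_distrib) (simp add: det2_def)
  ultimately have "(\<Prod>i<k. alt j (A i (1, 0)) (A i (0, 1))) = \<xi> powi (\<Sum>i<k. c * ?M ^ i)" by simp
  moreover assume "(\<Prod>i<k. alt j (A i (1, 0)) (A i (0, 1))) = 1"
  ultimately have "int q dvd c * (\<Sum>i<k. ?M ^ i)" by (simp add: root_powi_eq_1_iff sum_distrib_left)
  then have "int q dvd (\<Sum>i<k. ?M ^ i)"
    using c(1) q by (metis prime_dvd_mult_iff prime_nat_int_transfer)
  then have "int q dvd ?M ^ k - 1" by (simp add: power_diff_1_eq)
  then show False using det_scale_pow[OF k] by (simp add: cong_iff_dvd_diff)
qed

text \<open>A grouplike element lives on one coset and has the form u a^k with \<open>u\<close> in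
  k\<Gamma>. The transform of \<open>u\<close> then writes the partial norm of \<open>j\<close> as a
  coboundary, which is symmetric, so k = 0. Inside k\<Gamma> only the group elements are
  grouplike.\<close>

lemma grouplikes_B: "grouplikes B = basis_vec ` carrier \<Gamma>"
proof
  show "basis_vec ` carrier \<Gamma> \<subseteq> grouplikes B"
    using Gam_sub_G by (auto simp: grouplikes_def B_comul_Gam tens_basis_vec subset_iff)
  show "grouplikes B \<subseteq> basis_vec ` carrier \<Gamma>"
  proof
    fix v assume "v \<in> grouplikes B"
    then have v: "v \<in> vecs (carrier G)" "lin_ext (carrier G) \<Delta> v = tens v v"
      and eps: "form_ext (carrier G) (\<lambda>_. 1) v = 1"
      by (auto simp: grouplikes_def form_ext_def)
    have "v \<noteq> (\<lambda>_. 0)" using eps by (auto simp: form_ext_def)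
    then obtain a where a: "v a \<noteq> 0" by blast
    then have "a \<in> carrier G" using vecsD[OF v(1)] by blast
    then obtain u0 k where k: "k < p" "a = el u0 k" by (rule G_cases)
    \<comment> \<open>A nonzero coefficient of v \<otimes> v at (a, b) comes from the coproduct of
      some \<open>z\<close>, and then \<open>a\<close>, \<open>b\<close> and \<open>z\<close> lie in
      the same coset.\<close>
    have deg: "snd b = int k" if "v b \<noteq> 0" for b
    proof -
      have "lin_ext (carrier G) \<Delta> v (a, b) \<noteq> 0" using a that by (simp add: v(2) tens_def)
      then obtain z where "z \<in> carrier G" "\<Delta> z (a, b) \<noteq> 0"
        unfolding lin_ext_def by (metis (mono_tags, lifting) mult_zero_right sum.neutral)
      then show ?thesis using comul_support[of z a b] k by (simp add: snd_el)
    qed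
    let ?e = "el 0 k"
    define u where "u = G.times v (basis_vec (inv\<^bsub>G\<^esub> ?e))"
    have u: "u \<in> vecs (carrier \<Gamma>)"
    proof (rule vecsI)
      fix z assume z: "z \<notin> carrier \<Gamma>"
      show "u z = 0"
      proof (cases "z \<in> carrier G")
        case True
        then obtain u' k' where z': "k' < p" "z = el u' k'" by (rule G_cases)
        have "u z = v (z \<otimes>\<^bsub>G\<^esub> ?e)" using True by (simp add: u_def G.times_basis)
        moreover have "v (z \<otimes>\<^bsub>G\<^esub> ?e) = 0"
        proof (rule ccontr)
          assume "v (z \<otimes>\<^bsub>G\<^esub> ?e) \<noteq> 0"
          then have "int ((k' + k) mod p) = int k" using deg by (metis el_mult snd_el z'(2))
          then have "[k' + k = 0 + k] (mod p)" using k(1) by (simp add: cong_def)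
          then have "p dvd k'" by (metis cong_0_iff cong_add_rcancel_nat)
          then show False using z by (simp add: z'(2) Gam_iff)
        qed
        ultimately show ?thesis by simp
      qed (simp add: u_def vecsD[OF G.times_in_vecs])
    qed
    have v_eq: "v = G.times u (basis_vec ?e)"
      using v(1) by (simp add: u_def G.times_assoc G.basis_times_basis)
    obtain w where w: "w \<in> vecs \<Gamma>2" "\<And>x y. hat2 w x y = (\<Prod>i<k. j (A i x) (A i y))"
      "\<And>u. \<Delta> (el u k) = G2.times (basis_vec (el u 0, el u 0)) (G2.times w (basis_vec (el 0 k, el 0 k)))"
      using comul_el[where k = k] by blast
    have De: "\<Delta> ?e = G2.times w (basis_vec (?e, ?e))"
      using w(3)[of 0] G2.times_in_vecs[of w "basis_vec (?e, ?e)"] G2.times_one(1)[of "G2.times w (basis_vec (?e, ?e))"]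
      by (simp add: one_G)
    define du where "du = lin_ext (carrier \<Gamma>) (\<lambda>g. basis_vec (g, g)) u"
    have du: "du \<in> vecs \<Gamma>2" unfolding du_def by (rule lin_ext_in_vecs) simp
    have hdu: "hat2 du x y = hat u (x + y)" for x y
      unfolding hat2_def du_def hat_def
      by (subst form_ext_lin_ext) (auto simp: ch_add intro!: form_ext_cong)
    have "lin_ext (carrier G) \<Delta> u = du"
      unfolding du_def lin_ext_mono[OF G.fin Gam_sub_G u] by (rule lin_ext_cong) (rule B_comul_Gam)
    then have "G2.times (G2.times du w) (basis_vec (?e, ?e)) = lin_ext (carrier G) \<Delta> v"
      unfolding v_eq lin_ext_times[OF fin_group_G fin_group_G2 comul_hom]
      by (simp add: De G2.times_assoc)
    also have "\<dots> = G2.times (tens u u) (basis_vec (?e, ?e))"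
      unfolding v(2) by (subst (1 2) v_eq) (simp only: times_group_hopf_tens[OF fin_group_G fin_group_G, symmetric] tens_basis_vec)
    finally have eq: "G2.times du w = tens u u"
      by (rule G2.times_basis_cancel[rotated -1])
        (simp_all add: tens_in_vecs vecs_Gam_G u vecs_Gam2_G2 times_vecs du w(1))
    have hu: "hat u x * hat u y = hat u (x + y) * (\<Prod>i<k. j (A i x) (A i y))" for x y
      using arg_cong[OF eq, of "\<lambda>t. hat2 t x y"] by (simp add: hat2_times du w hdu hat2_tens)
    have "ch 0 = (\<lambda>_. 1)" by (rule ext) simp
    then have hu0: "hat u 0 = 1"
      using eps form_ext_times[OF fin_group_G, of "\<lambda>_. 1" u "basis_vec ?e"]
        form_ext_mono[OF G.fin Gam_sub_G u, of "\<lambda>_. 1"] by (simp add: v_eq hat_def)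
    \<comment> \<open>At (x, -x) the relation \<open>hu\<close> has a nonzero right-hand side
      because \<open>hat u 0 = 1\<close>.\<close>
    have hnz: "hat u x \<noteq> 0" for x
    proof -
      have "(\<Prod>i<k. j (A i x) (A i (- x))) \<noteq> 0" by (simp add: J(3))
      then show ?thesis using hu[of x "- x"] hu0 by auto
    qed
    have "k = 0"
    proof (rule ccontr)
      assume "k \<noteq> 0"
      \<comment> \<open>The left-hand side of \<open>hu\<close> and the factor
        \<open>hat u (x + y)\<close> are symmetric, so the remaining product of values of
        \<open>j\<close> is symmetric as well.\<close>
      have "(\<Prod>i<k. j (A i x) (A i y)) = (\<Prod>i<k. j (A i y) (A i x))" for x y
        using hu[of x y] hu[of y x] hnz[of "x + y"] by (simp add: mult.commute add.commute)
      then have "(\<Prod>i<k. alt j (A i x) (A i y)) = 1" for x y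
        using J(3) by (simp add: alt_def prod_dividef)
      then show False using prod_j_not_symmetric[of k] \<open>k \<noteq> 0\<close> k(1) by simp
    qed
    then have vG: "v \<in> vecs (carrier \<Gamma>)"
      using v_eq u by (simp add: vecs_Gam_G flip: one_G)
    have diag: "lin_ext (carrier G) \<Delta> v = lin_ext (carrier \<Gamma>) (\<lambda>g. basis_vec (g, g)) v"
      unfolding lin_ext_mono[OF G.fin Gam_sub_G vG] by (rule lin_ext_cong) (rule B_comul_Gam)
    \<comment> \<open>Comparing coefficients of v \<otimes> v with those of the diagonal element
      shows that the coefficients of \<open>v\<close> are orthogonal idempotents of k, so only one
      is nonzero and it equals 1.\<close>
    have vv: "v g * v h = (if g = h then v g else 0)" for g h
    proof -
      have "v g * v h = (\<Sum>x\<in>carrier \<Gamma>. v x * basis_vec (x, x) (g, h))"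
        using fun_cong[OF trans[OF v(2)[symmetric] diag], of "(g, h)"] by (simp add: tens_def lin_ext_def)
      also have "\<dots> = (\<Sum>x\<in>carrier \<Gamma>. if x = g then if g = h then v g else 0 else 0)"
        by (intro sum.cong refl) (auto simp: basis_vec_def)
      also have "\<dots> = (if g = h then v g else 0)" using vecsD[OF vG, of g] by auto
      finally show ?thesis .
    qed
    have va: "v a = 1" using vv[of a a] a by (metis mult_cancel_right2)
    have "v h = 0" if "h \<noteq> a" for h using vv[of a h] va that by simp
    then have "v = basis_vec a" unfolding basis_vec_def using va by auto
    moreover have "a \<in> carrier \<Gamma>" using vecsD[OF vG] a by blast
    ultimately show "v \<in> basis_vec ` carrier \<Gamma>" by blast
  qed
qed

end

theorem proposition5p3p1:
  fixes p q n l :: nat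
    and \<xi> :: "'k::{alg_closed_field, field_char_0}"
    and \<omega> :: "(G_elt \<Rightarrow> 'k) \<Rightarrow> (G_elt \<Rightarrow> 'k) \<Rightarrow> 'k"
    and \<B> :: "(G_elt, 'k) hopf"
  assumes "prime p" and "prime q" and "p \<noteq> q" and "[q = 1] (mod p)"
    and "1 < n" and "n \<le> q - 1" and "[n ^ p = 1] (mod q)"
    and "l < p - 1"
    and "is_primitive_root_of_unity q \<xi>"
    and "normalized_group_cocycle (char_group (Gam p q n l)) \<omega>"
    and "\<And>x y u v. x \<in> carrier (char_group (Gam p q n l)) \<Longrightarrow>
           y \<in> carrier (char_group (Gam p q n l)) \<Longrightarrow>
           has_coords \<xi> x u \<Longrightarrow> has_coords \<xi> y v \<Longrightarrow>
           \<omega> x y * inverse (\<omega> y x) = \<xi> powi det2 u v"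
    and "is_B p q n l \<B>"
  shows "(invertible_normalized_cocycle (group_hopf (G_grp p q n l))
            (cocycle_element (Gam p q n l) \<omega>) \<and>
          \<B> \<simeq>\<^sub>H deform (group_hopf (G_grp p q n l)) (cocycle_element (Gam p q n l) \<omega>)) \<and>
         \<not> (\<exists>(N :: 'n monoid) J. group N \<and> finite (carrier N) \<and>
              invertible_normalized_cocycle (group_hopf N) J \<and>
              dual_hopf \<B> \<simeq>\<^sub>H deform (group_hopf N) J)"
proof -
  let ?G = "G_grp p q n l" and ?\<phi> = "cocycle_element (Gam p q n l) \<omega>"
  have setting: "B_setting q \<xi> p n l \<B>"
    by unfold_locales (use assms in auto)
  interpret B_setting q \<xi> p n l \<B> by (rule setting)
  have "\<not> (\<exists>(N :: 'n monoid) J. group N \<and> finite (carrier N) \<and>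
      invertible_normalized_cocycle (group_hopf N) J \<and> dual_hopf \<B> \<simeq>\<^sub>H deform (group_hopf N) J)"
  proof
    assume "\<exists>(N :: 'n monoid) J. group N \<and> finite (carrier N) \<and>
      invertible_normalized_cocycle (group_hopf N) J \<and> dual_hopf \<B> \<simeq>\<^sub>H deform (group_hopf N) J"
    then obtain N :: "'n monoid" and J f where N: "group N" "finite (carrier N)"
      and f: "is_hopf_iso (dual_hopf \<B>) (deform (group_hopf N) J) f"
      by (auto simp: hopf_isomorphic_def)
    have fin: "finite (hbasis \<B>)" by simp
    have comul: "x \<in> hbasis \<B> \<Longrightarrow> \<Delta> x \<in> vecs (hbasis \<B> \<times> hbasis \<B>)" for x
      using comul_vecs by simp
    have "order N = p * (q * q)"
      using dual_group_algebra(1)[OF fin comul N f] by (simp add: card_G)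
    then have "p dvd card (carrier (char_group N :: ('n \<Rightarrow> 'k) monoid))"
      using prime_dvd_order_char_group[OF N(1) p q p_less_q] by (simp add: order_def)
    also have "card (carrier (char_group N :: ('n \<Rightarrow> 'k) monoid)) = card (grouplikes \<B>)"
      by (rule bij_betw_same_card[OF dual_group_algebra(2)[OF fin comul N f]])
    also have "\<dots> = q * q"
      by (simp add: grouplikes_B card_image inj_on_def basis_vec_inj card_Gam)
    finally show False
      using p q pq by (metis prime_dvd_mult_nat primes_dvd_imp_eq)
  qed
  then show ?thesis
    using deformation_iso[OF setting assms(10,11)] by blast
qed

end
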